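(* For positive integers $h$, $w$, and $n$, \begin{align*} |\mathrm{CSYT}_n(2h+1,2w+1)|&=|\mathrm{NCNN}_n(h+1,w+1)|,\\ |\mathrm{CSYT}_n(2h+1,2w)|&=|\mathrm{NCNN}_n(h+1,w+1/2)|,\\ |\mathrm{CSYT}_n(2h,2w+1)|&=|\mathrm{NCNN}_n(h+1/2,w+1)|,\\ |\mathrm{CSYT}_n(2h,2w)|&=\sum_{M\in\mathrm{NCNN}'_n(h+1,w+1)}(-1)^{z(M)}. \end{align*}
   Context: Tableaux: a standard Young tableau of size $n$ is a filling of the Young diagram of a partition of $n$ with $1,2,\dots,n$ (each once), increasing along rows and down columns. $\mathrm{Par}(a,b)$ is the set of partitions $\lambda$ with at most $a$ positive parts and $\lambda_1-\lambda_a\le b$ (with $\lambda_i=0$ beyond the length). For positive integers $a,b$, a semistandard (in particular, standard) Young tableau $T$ is $(a,b)$-cylindric if it has at most $a$ rows and $T\cup(T+(a,-b))$ is a semistandard Young tableau of a valid skew shape, where $T+(a,-b)$ is $T$ shifted $a$ units down and $b$ units to the left (this forces the shape of $T$ to lie in $\mathrm{Par}(a,b)$). $\mathrm{CSYT}_n(a,b)$ is the set of $(a,b)$-cylindric standard Young tableaux of size $n$. Matchings: a matching on $\{1,\dots,n\}$ is a set partition of $\{1,\dots,n\}$ into blocks of size one or two. The element of a singleton block is a fixed point; a pair $(i,j)$, $i<j$, forming a block of size two is an arc. For a positive integer $k$, a $k$-crossing is a set of $k$ arcs $(i_1,j_1),\dots,(i_k,j_k)$ with $i_1<\dots<i_k<j_1<\dots<j_k$;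 a $k$-nesting is a set of $k$ arcs with $i_1<\dots<i_k<j_k<\dots<j_1$. A $(k+1/2)$-crossing is a set of $k$ arcs together with a fixed point $v$ such that $i_1<\dots<i_k<v<j_1<\dots<j_k$; a $(k+1/2)$-nesting is a set of $k$ arcs together with a fixed point $v$ such that $i_1<\dots<i_k<v<j_k<\dots<j_1$. For a positive integer $k$, a matching is $k$-noncrossing (resp. $k$-nonnesting) if it has no $k$-crossing (resp. $k$-nesting); it is $(k+1/2)$-noncrossing (resp. $(k+1/2)$-nonnesting) if it has no $t$-crossing (resp. $t$-nesting) for any integer or half-integer $t\ge k+1/2$ (equivalently, neither a $(k+1/2)$- nor a $(k+1)$-crossing, resp. nesting). For integers or half-integers $r,s$, $\mathrm{NCNN}_n(r,s)$ is the set of $r$-noncrossing and $s$-nonnesting matchings on $\{1,\dots,n\}$. $\mathrm{NCNN}'_n(h+1,w+1)$ is the set of matchings in $\mathrm{NCNN}_n(h+1,w+1)$ in which every fixed point $v$ satisfies one of: (a) $v$ is contained neither in any $(h+1/2)$-crossing nor in any $(w+1/2)$-nesting; (b) $v$ is contained in both an $(h+1/2)$-crossing and a $(w+1/2)$-nesting. For such $M$, $z(M)$ is the number of fixed points of $M$ contained in both an $(h+1/2)$-crossing and a $(w+1/2)$-nesting. *)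

theory Defs
  imports Complex_Main "HOL-Library.Disjoint_Sets"
begin

section \<open>Tableaux\<close>

definition is_partition :: "nat list \<Rightarrow> bool" where
  "is_partition xs \<longleftrightarrow> sorted_wrt (\<ge>) xs \<and> 0 \<notin> set xs"

text \<open>Cells are pairs (row, column), with rows counted from the top. Coordinates are integers,
  since shifting to the left leads to nonpositive column indices.\<close>

definition young_diagram :: "nat list \<Rightarrow> (int \<times> int) set" where
  "young_diagram xs = {(int k + 1, j) | k j. k < length xs \<and> 1 \<le> j \<and> j \<le> int (xs ! k)}"

text \<open>Skew shapes are taken up to translation.\<close>

definition skew_shape :: "(int \<times> int) set \<Rightarrow> bool" where
  "skew_shape S \<longleftrightarrow> (\<exists>xs ys p q. is_partition xs \<and> is_partition ys \<and>
     young_diagram ys \<subseteq> young_diagram xs \<and>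
     S = (\<lambda>(i, j). (i + p, j + q)) ` (young_diagram xs - young_diagram ys))"

text \<open>A tableau is a partial map whose domain is its set of cells.\<close>

type_synonym tableau = "int \<times> int \<rightharpoonup> nat"

definition semistandard :: "tableau \<Rightarrow> bool" where
  "semistandard T \<longleftrightarrow> skew_shape (dom T) \<and> 0 \<notin> ran T \<and>
     (\<forall>i j j' x y. j < j' \<and> T (i, j) = Some x \<and> T (i, j') = Some y \<longrightarrow> x \<le> y) \<and>
     (\<forall>i i' j x y. i < i' \<and> T (i, j) = Some x \<and> T (i', j) = Some y \<longrightarrow> x < y)"

definition SYT :: "nat \<Rightarrow> tableau set" where
  "SYT n = {T. (\<exists>xs. is_partition xs \<and> sum_list xs = n \<and> dom T = young_diagram xs) \<and>
     inj_on T (dom T) \<and> ran T = {1..n} \<and>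
     (\<forall>i j j' x y. j < j' \<and> T (i, j) = Some x \<and> T (i, j') = Some y \<longrightarrow> x < y) \<and>
     (\<forall>i i' j x y. i < i' \<and> T (i, j) = Some x \<and> T (i', j) = Some y \<longrightarrow> x < y)}"

definition shift_tableau :: "int \<Rightarrow> int \<Rightarrow> tableau \<Rightarrow> tableau" where
  "shift_tableau p q T = (\<lambda>(i, j). T (i - p, j - q))"

text \<open>If \<open>T\<close> is a straight-shape tableau with at most \<open>a\<close> rows, then \<open>T\<close> and its shift have
  disjoint domains, so that \<open>++\<close> is indeed the union.\<close>

definition cylindric :: "nat \<Rightarrow> nat \<Rightarrow> tableau \<Rightarrow> bool" where
  "cylindric a b T \<longleftrightarrow> card (fst ` dom T) \<le> a \<and>
     semistandard (T ++ shift_tableau (int a) (- int b) T)"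

definition CSYT :: "nat \<Rightarrow> nat \<Rightarrow> nat \<Rightarrow> tableau set" where
  "CSYT n a b = {T \<in> SYT n. cylindric a b T}"


section \<open>Matchings\<close>

type_synonym matching = "nat set set"

definition is_matching :: "nat \<Rightarrow> matching \<Rightarrow> bool" where
  "is_matching n M \<longleftrightarrow> partition_on {1..n} M \<and> (\<forall>B\<in>M. card B = 1 \<or> card B = 2)"

definition fixed_points :: "matching \<Rightarrow> nat set" where
  "fixed_points M = {v. {v} \<in> M}"

definition arcs :: "matching \<Rightarrow> (nat \<times> nat) set" where
  "arcs M = {(i, j). i < j \<and> {i, j} \<in> M}"

text \<open>The arcs \<open>(i 1, j 1), \<dots>, (i k, j k)\<close> form a \<open>k\<close>-crossing or \<open>k\<close>-nesting, for \<open>k \<ge> 1\<close>.\<close>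

definition crossing_arcs :: "matching \<Rightarrow> nat \<Rightarrow> (nat \<Rightarrow> nat) \<Rightarrow> (nat \<Rightarrow> nat) \<Rightarrow> bool" where
  "crossing_arcs M k i j \<longleftrightarrow> (\<forall>t\<in>{1..k}. (i t, j t) \<in> arcs M) \<and>
     strict_mono_on {1..k} i \<and> i k < j 1 \<and> strict_mono_on {1..k} j"

definition nesting_arcs :: "matching \<Rightarrow> nat \<Rightarrow> (nat \<Rightarrow> nat) \<Rightarrow> (nat \<Rightarrow> nat) \<Rightarrow> bool" where
  "nesting_arcs M k i j \<longleftrightarrow> (\<forall>t\<in>{1..k}. (i t, j t) \<in> arcs M) \<and>
     strict_mono_on {1..k} i \<and> i k < j k \<and> strict_antimono_on {1..k} j"

text \<open>The point \<open>v\<close> is the fixed point of some \<open>(k + 1/2)\<close>-crossing or \<open>(k + 1/2)\<close>-nesting.\<close>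

definition in_half_crossing :: "matching \<Rightarrow> nat \<Rightarrow> nat \<Rightarrow> bool" where
  "in_half_crossing M k v \<longleftrightarrow>
     v \<in> fixed_points M \<and> (\<exists>i j. crossing_arcs M k i j \<and> i k < v \<and> v < j 1)"

definition in_half_nesting :: "matching \<Rightarrow> nat \<Rightarrow> nat \<Rightarrow> bool" where
  "in_half_nesting M k v \<longleftrightarrow>
     v \<in> fixed_points M \<and> (\<exists>i j. nesting_arcs M k i j \<and> i k < v \<and> v < j k)"

text \<open>In what follows \<open>r\<close> and \<open>s\<close> are integers or half-integers, represented as rationals.\<close>

definition has_crossing :: "matching \<Rightarrow> rat \<Rightarrow> bool" where
  "has_crossing M r \<longleftrightarrow> (\<exists>k::nat. k \<ge> 1 \<and>
     (r = of_nat k \<and> (\<exists>i j. crossing_arcs M k i j) \<or>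
      r = of_nat k + 1/2 \<and> (\<exists>v. in_half_crossing M k v)))"

definition has_nesting :: "matching \<Rightarrow> rat \<Rightarrow> bool" where
  "has_nesting M r \<longleftrightarrow> (\<exists>k::nat. k \<ge> 1 \<and>
     (r = of_nat k \<and> (\<exists>i j. nesting_arcs M k i j) \<or>
      r = of_nat k + 1/2 \<and> (\<exists>v. in_half_nesting M k v)))"

definition noncrossing :: "rat \<Rightarrow> matching \<Rightarrow> bool" where
  "noncrossing r M \<longleftrightarrow>
     (if r \<in> \<int> then \<not> has_crossing M r else (\<forall>t\<ge>r. \<not> has_crossing M t))"

definition nonnesting :: "rat \<Rightarrow> matching \<Rightarrow> bool" where
  "nonnesting s M \<longleftrightarrow>
     (if s \<in> \<int> then \<not> has_nesting M s else (\<forall>t\<ge>s. \<not> has_nesting M t))"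

definition NCNN :: "nat \<Rightarrow> rat \<Rightarrow> rat \<Rightarrow> matching set" where
  "NCNN n r s = {M. is_matching n M \<and> noncrossing r M \<and> nonnesting s M}"

text \<open>\<open>NCNN' n h w\<close> is the set usually written \<open>NCNN'\<^sub>n(h+1, w+1)\<close>: note the shift by one in
  the parameters.\<close>

definition NCNN' :: "nat \<Rightarrow> nat \<Rightarrow> nat \<Rightarrow> matching set" where
  "NCNN' n h w = {M \<in> NCNN n (of_nat h + 1) (of_nat w + 1). \<forall>v\<in>fixed_points M.
     \<not> in_half_crossing M h v \<and> \<not> in_half_nesting M w v \<or>
     in_half_crossing M h v \<and> in_half_nesting M w v}"

definition z_stat :: "nat \<Rightarrow> nat \<Rightarrow> matching \<Rightarrow> nat" where
  "z_stat h w M = card {v \<in> fixed_points M. in_half_crossing M h v \<and> in_half_nesting M w v}"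

end

theory Submission
  imports Defs "Jordan_Normal_Form.Determinant" "HOL-Computational_Algebra.Formal_Power_Series"
    "HOL-Library.Sublist"
begin

text \<open>Both sides count lattice walks. A cylindric tableau is a walk that adds boxes inside
  \<open>Par(a, b)\<close>, a type A alcove. Reading a matching from right to left, with row insertion at closing
  points and deletion at opening points, gives a walk from the empty partition to itself inside the
  \<open>h \<times> w\<close> box, whose steps add a box, remove a box, or (at fixed points) stay; by Schensted's theorem
  the numbers of rows and columns are the sizes of the largest crossing and nesting over a point. A
  stationary step carries the weight
  \<open>1 - [a even and h rows are occupied] - [b even and w columns are occupied]\<close>.

  To compare the two kinds of walks, view a partition as positions \<open>\<lambda>\<^sub>i - i\<close> of particles hopping on a
  ring with \<open>a + b\<close> sites. The generating function of all walks starting at a configuration is a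
  Pfaffian of a kernel depending on differences of positions. For the initial configuration a change
  of basis to vectors that are symmetric or antisymmetric under reflection makes the matrix block
  off-diagonal, so that the Pfaffian collapses to a determinant of size \<open>h\<close>. Its entries obey the hopping
  equation on a segment of \<open>h + w\<close> sites, with boundary conditions that depend on the parities of \<open>a\<close>
  and \<open>b\<close>; hence the determinant is the generating function of walks of \<open>h\<close> particles on this segment,
  that is, of walks in the box.\<close>

text \<open>The two walk counts cannot be matched step by step: on the ring the end point is free,
  while in the box the walk has to return to the empty partition. A free end point calls for a
  Pfaffian: its constant term is the same at every admissible configuration, and it vanishes as soon
  as a move makes two particles coincide, possibly after a full turn. A prescribed end point calls
  for a determinant whose constant term singles out one configuration. Exponential generating
  functions turn the move of one particle into the Leibniz rule, so each object obeys the recursion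
  of its walks.

  The stationary weight is not put in by hand. For odd \<open>a\<close> its leading 1 is the
  derivative of the factor \<open>fps_exp 1\<close> contributed by a point at infinity. For even
  \<open>a\<close> the lower end of the segment reflects, which gives a term only if fewer than
  \<open>h\<close> rows are occupied; for even \<open>b\<close> the upper end reflects with a change
  of sign, which subtracts a term if \<open>w\<close> columns are occupied. For matchings the weight
  becomes a factor 1, 0 or -1 at each fixed point, and these values produce the different right-hand
  sides.\<close>

section \<open>Pfaffian sums\<close>

text \<open>On skew-symmetric matrices of size \<open>2 m\<close>, this is the Pfaffian up to sign and the factor
  \<open>2\<^sup>m m!\<close>, which never needs to be known.\<close>

definition pfsum :: "nat \<Rightarrow> (nat \<Rightarrow> nat \<Rightarrow> 'a::comm_ring_1) \<Rightarrow> 'a" where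
  "pfsum m A = (\<Sum>p | p permutes {0..<2*m}. signof p * (\<Prod>r<m. A (p r) (p (r + m))))"

lemma pfsum_cong:
  assumes "\<And>i j. i < 2*m \<Longrightarrow> j < 2*m \<Longrightarrow> A i j = B i j"
  shows "pfsum m A = pfsum m B"
  unfolding pfsum_def
proof (intro sum.cong refl arg_cong2[of _ _ _ _ "(*)"] prod.cong)
  fix p r assume p: "p \<in> {p. p permutes {0..<2*m}}" and r: "r \<in> {..<m}"
  have "p r \<in> {0..<2*m}" "p (r + m) \<in> {0..<2*m}"
    using p r permutes_in_image[of p "{0..<2*m}"] by auto
  then show "A (p r) (p (r + m)) = B (p r) (p (r + m))"
    using assms by auto
qed

lemma prod_halves:
  fixes g :: "nat \<Rightarrow> 'a::comm_monoid_mult"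
  shows "(\<Prod>i = 0..<2*m. g i) = (\<Prod>r<m. g r * g (r + m))"
proof -
  have "{0..<2*m} = {0..<m} \<union> {0+m..<m+m}" by auto
  then have "(\<Prod>i = 0..<2*m. g i) = (\<Prod>i = 0..<m. g i) * (\<Prod>i = 0+m..<m+m. g i)"
    by (simp add: prod.union_disjoint)
  also have "(\<Prod>i = 0+m..<m+m. g i) = (\<Prod>i = 0..<m. g (i + m))"
    by (rule prod.shift_bounds_nat_ivl)
  finally show ?thesis by (simp add: prod.distrib atLeast0LessThan)
qed

text \<open>A function on \<open>{0..<2*m}\<close> encodes the choice of one pair
  \<open>(f r, f (r + m))\<close> for each factor, the indexing that the permutations in
  \<open>pfsum\<close> use.\<close>

lemma prod_sum_halves:
  fixes g :: "nat \<Rightarrow> nat \<Rightarrow> nat \<Rightarrow> 'a::comm_semiring_1"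
  assumes "finite S"
  shows "(\<Prod>r<m. \<Sum>k\<in>S. \<Sum>l\<in>S. g r k l)
       = (\<Sum>f\<in>{0..<2*m} \<rightarrow>\<^sub>E S. \<Prod>r<m. g r (f r) (f (r + m)))"
proof -
  have "(\<Prod>r<m. \<Sum>k\<in>S. \<Sum>l\<in>S. g r k l) = (\<Prod>r<m. \<Sum>q\<in>S \<times> S. g r (fst q) (snd q))"
    by (simp add: sum.cartesian_product split_beta)
  also have "\<dots> = (\<Sum>q\<in>{..<m} \<rightarrow>\<^sub>E S \<times> S. \<Prod>r<m. g r (fst (q r)) (snd (q r)))"
    using assms by (subst prod_sum_PiE) auto
  also have "\<dots> = (\<Sum>f\<in>{0..<2*m} \<rightarrow>\<^sub>E S. \<Prod>r<m. g r (f r) (f (r + m)))"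
  proof (rule sum.reindex_bij_witness[where
        i = "\<lambda>f. \<lambda>r\<in>{..<m}. (f r, f (r + m))" and
        j = "\<lambda>q. \<lambda>i\<in>{0..<2*m}. if i < m then fst (q i) else snd (q (i - m))"])
    fix q assume q: "q \<in> {..<m} \<rightarrow>\<^sub>E S \<times> S"
    then have *: "q x \<in> S \<times> S" if "x < m" for x using that by auto
    show "(\<lambda>r\<in>{..<m}. ((\<lambda>i\<in>{0..<2*m}. if i < m then fst (q i) else snd (q (i - m))) r,
       (\<lambda>i\<in>{0..<2*m}. if i < m then fst (q i) else snd (q (i - m))) (r + m))) = q"
      using q by (auto simp: fun_eq_iff restrict_def PiE_def extensional_def)
    show "(\<lambda>i\<in>{0..<2*m}. if i < m then fst (q i) else snd (q (i - m))) \<in> {0..<2*m} \<rightarrow>\<^sub>E S"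
    proof (rule PiE_I)
      fix i assume "i \<in> {0..<2*m}"
      then show "(\<lambda>i\<in>{0..<2*m}. if i < m then fst (q i) else snd (q (i - m))) i \<in> S"
        using *[of i] *[of "i - m"] by (auto simp: mem_Times_iff)
    qed auto
    show "(\<Prod>r<m. g r ((\<lambda>i\<in>{0..<2*m}. if i < m then fst (q i) else snd (q (i - m))) r)
             ((\<lambda>i\<in>{0..<2*m}. if i < m then fst (q i) else snd (q (i - m))) (r + m)))
        = (\<Prod>r<m. g r (fst (q r)) (snd (q r)))"
      by (intro prod.cong) auto
  next
    fix f assume f: "f \<in> {0..<2*m} \<rightarrow>\<^sub>E S"
    show "(\<lambda>i\<in>{0..<2*m}. if i < m then fst ((\<lambda>r\<in>{..<m}. (f r, f (r + m))) i)
             else snd ((\<lambda>r\<in>{..<m}. (f r, f (r + m))) (i - m))) = f"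
      using f by (auto simp: fun_eq_iff restrict_def PiE_def extensional_def)
    show "(\<lambda>r\<in>{..<m}. (f r, f (r + m))) \<in> {..<m} \<rightarrow>\<^sub>E S \<times> S"
      using f by (auto simp: PiE_iff)
  qed
  finally show ?thesis .
qed

lemma det_mat_reindexed_rows:
  fixes B :: "nat \<Rightarrow> nat \<Rightarrow> 'a::comm_ring_1"
  assumes "q permutes {0..<n}"
  shows "det (mat n n (\<lambda>(i, j). B (q i) j)) = signof q * det (mat n n (\<lambda>(i, j). B i j))"
proof -
  have "mat n n (\<lambda>(i, j). B (q i) j) = mat n n (\<lambda>(i, j). mat n n (\<lambda>(i, j). B i j) $$ (q i, j))"
    using permutes_in_image[OF assms] by (intro eq_matI) auto
  then show ?thesis using det_permute_rows[OF _ assms, of "mat n n (\<lambda>(i, j). B i j)"] by simp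
qed

text \<open>The Pfaffian analogue of Cauchy-Binet. Expanding all entries gives a sum over index
  functions \<open>f\<close>, each weighted by the determinant of the rows of \<open>B\<close>
  selected by \<open>f\<close>. It vanishes if \<open>f\<close> repeats an index; otherwise
  \<open>f\<close> is a permutation and the determinant is its sign times \<open>det B\<close>,
  which reassembles \<open>pfsum m A\<close>.\<close>

lemma pfsum_congruence:
  fixes A B :: "nat \<Rightarrow> nat \<Rightarrow> 'a::comm_ring_1"
  shows "pfsum m (\<lambda>i j. \<Sum>k = 0..<2*m. \<Sum>l = 0..<2*m. B k i * A k l * B l j)
       = det (mat (2*m) (2*m) (\<lambda>(i, j). B i j)) * pfsum m A"
proof -
  let ?I = "{0..<2*m}"
  let ?P = "{p. p permutes ?I}"
  let ?F = "?I \<rightarrow>\<^sub>E ?I"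
  let ?a = "\<lambda>f. \<Prod>r<m. A (f r) (f (r + m))"
  let ?d = "\<lambda>f. det (mat (2*m) (2*m) (\<lambda>(i, j). B (f i) j))"
  have "pfsum m (\<lambda>i j. \<Sum>k\<in>?I. \<Sum>l\<in>?I. B k i * A k l * B l j)
      = (\<Sum>p\<in>?P. signof p * (\<Sum>f\<in>?F. \<Prod>r<m. B (f r) (p r) * A (f r) (f (r + m)) * B (f (r + m)) (p (r + m))))"
    unfolding pfsum_def by (simp add: prod_sum_halves)
  also have "\<dots> = (\<Sum>p\<in>?P. \<Sum>f\<in>?F. ?a f * (signof p * (\<Prod>i\<in>?I. B (f i) (p i))))"
    unfolding prod_halves by (simp add: sum_distrib_left prod.distrib algebra_simps)
  also have "\<dots> = (\<Sum>f\<in>?F. ?a f * ?d f)"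
    unfolding sum.swap[of _ ?F] sum_distrib_left[symmetric]
  proof (intro sum.cong refl arg_cong2[of _ _ _ _ "(*)"])
    fix f
    show "(\<Sum>p\<in>?P. signof p * (\<Prod>i\<in>?I. B (f i) (p i))) = ?d f"
      unfolding det_def using permutes_in_image
      by (auto intro!: sum.cong prod.cong arg_cong2[of _ _ _ _ "(*)"])
  qed
  also have "\<dots> = (\<Sum>f\<in>{f\<in>?F. inj_on f ?I}. ?a f * ?d f)"
  proof (rule sum.mono_neutral_right)
    show "\<forall>f\<in>?F - {f\<in>?F. inj_on f ?I}. ?a f * ?d f = 0"
    proof
      fix f assume "f \<in> ?F - {f\<in>?F. inj_on f ?I}"
      then obtain i j where "i \<in> ?I" "j \<in> ?I" "i \<noteq> j" "f i = f j"
        unfolding inj_on_def by auto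
      then have "?d f = 0"
        by (intro det_identical_rows[of _ "2*m" i j]) (auto simp: row_def)
      then show "?a f * ?d f = 0" by simp
    qed
  qed (auto intro!: finite_PiE)
  also have "\<dots> = (\<Sum>q\<in>?P. ?a q * ?d q)"
  proof (rule sum.reindex_bij_witness[where
        j = "\<lambda>f i. if i \<in> ?I then f i else i" and i = "\<lambda>q. restrict q ?I"])
    fix f assume f: "f \<in> {f\<in>?F. inj_on f ?I}"
    show "restrict (\<lambda>i. if i \<in> ?I then f i else i) ?I = f"
      using f by (auto simp: fun_eq_iff restrict_def PiE_def extensional_def)
    have "f ` ?I = ?I"
      using f by (intro endo_inj_surj) auto
    then have "bij_betw f ?I ?I"
      using f by (simp add: bij_betw_def)
    then have "bij_betw (\<lambda>i. if i \<in> ?I then f i else i) ?I ?I"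
      by (subst bij_betw_cong[of _ _ f]) auto
    then show "(\<lambda>i. if i \<in> ?I then f i else i) \<in> ?P"
      by (auto intro: bij_imp_permutes)
    have "?d (\<lambda>i. if i \<in> ?I then f i else i) = ?d f"
      by (intro arg_cong[of _ _ det] eq_matI) auto
    then show "?a (\<lambda>i. if i \<in> ?I then f i else i) * ?d (\<lambda>i. if i \<in> ?I then f i else i) = ?a f * ?d f"
      by (auto intro!: arg_cong2[of _ _ _ _ "(*)"] prod.cong)
  next
    fix q assume q: "q \<in> ?P"
    show "(\<lambda>i. if i \<in> ?I then restrict q ?I i else i) = q"
      using q by (auto simp: permutes_def)
    show "restrict q ?I \<in> {f\<in>?F. inj_on f ?I}"
      using q permutes_in_image[of q ?I] permutes_inj[of q ?I] by (auto simp: inj_on_def inj_def)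
  qed
  also have "\<dots> = (\<Sum>q\<in>?P. det (mat (2*m) (2*m) (\<lambda>(i, j). B i j)) * (signof q * ?a q))"
    by (intro sum.cong) (auto simp: det_mat_reindexed_rows)
  also have "\<dots> = det (mat (2*m) (2*m) (\<lambda>(i, j). B i j)) * pfsum m A"
    by (simp add: pfsum_def sum_distrib_left)
  finally show ?thesis .
qed

lemma pfsum_zero_row:
  assumes "i < 2*m" and "\<And>j. j < 2*m \<Longrightarrow> A i j = 0" and "\<And>j. j < 2*m \<Longrightarrow> A j i = 0"
  shows "pfsum m A = 0"
  unfolding pfsum_def
proof (rule sum.neutral, rule ballI)
  fix p assume p: "p \<in> {p. p permutes {0..<2*m}}"
  then have im: "p r < 2*m" if "r < 2*m" for r
    using that permutes_in_image[of p "{0..<2*m}"] by auto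
  obtain r where r: "p r = i" "r < 2*m"
    using p assms(1) permutes_image[of p "{0..<2*m}"] by (metis atLeast0LessThan imageE lessThan_iff mem_Collect_eq)
  have "\<exists>r<m. A (p r) (p (r + m)) = 0"
  proof (cases "r < m")
    case True
    then show ?thesis using assms(2)[of "p (r + m)"] im[of "r + m"] r by auto
  next
    case False
    then show ?thesis using assms(3)[of "p (r - m)"] im[of "r - m"] r by (intro exI[of _ "r - m"]) auto
  qed
  then have "(\<Prod>r<m. A (p r) (p (r + m))) = 0" by (auto intro: prod_zero)
  then show "signof p * (\<Prod>r<m. A (p r) (p (r + m))) = 0" by simp
qed

text \<open>The kernel vector \<open>c\<close> is put into column \<open>i\<close> of the identity
  matrix. Congruence by this matrix makes row and column \<open>i\<close> vanish, while its
  determinant \<open>c i\<close> is nonzero and can be cancelled.\<close>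

lemma pfsum_kernel:
  fixes A :: "nat \<Rightarrow> nat \<Rightarrow> 'a::idom"
  assumes i: "i < 2*m" "c i \<noteq> 0"
    and ker: "\<And>j. j < 2*m \<Longrightarrow> (\<Sum>k = 0..<2*m. c k * A k j) = 0"
    and skew: "\<And>j k. j < 2*m \<Longrightarrow> k < 2*m \<Longrightarrow> A j k = - A k j"
  shows "pfsum m A = 0"
proof -
  define B where "B k j = (if j = i then c k else if k = j then 1 else 0)" for k j
  have ker': "(\<Sum>l = 0..<2*m. A k l * c l) = 0" if "k < 2*m" for k
  proof -
    have "(\<Sum>l = 0..<2*m. A k l * c l) = - (\<Sum>l = 0..<2*m. c l * A l k)"
      unfolding sum_negf[symmetric]
    proof (intro sum.cong refl)
      fix l assume "l \<in> {0..<2*m}"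
      then have "A k l = - A l k" using that by (intro skew) auto
      then show "A k l * c l = - (c l * A l k)" by (simp only: mult.commute[of "c l"] mult_minus_left)
    qed
    then show ?thesis using ker that by simp
  qed
  have "pfsum m (\<lambda>i j. \<Sum>k = 0..<2*m. \<Sum>l = 0..<2*m. B k i * A k l * B l j) = 0"
  proof (rule pfsum_zero_row[OF i(1)])
    fix j assume j: "j < 2*m"
    have "(\<Sum>k = 0..<2*m. \<Sum>l = 0..<2*m. B k i * A k l * B l j)
        = (\<Sum>l = 0..<2*m. (\<Sum>k = 0..<2*m. c k * A k l) * B l j)"
      by (subst sum.swap) (simp add: B_def sum_distrib_right)
    then show "(\<Sum>k = 0..<2*m. \<Sum>l = 0..<2*m. B k i * A k l * B l j) = 0"
      using ker by simp
    have "(\<Sum>k = 0..<2*m. \<Sum>l = 0..<2*m. B k j * A k l * B l i)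
        = (\<Sum>k = 0..<2*m. B k j * (\<Sum>l = 0..<2*m. A k l * c l))"
      by (simp add: B_def sum_distrib_left mult.assoc)
    then show "(\<Sum>k = 0..<2*m. \<Sum>l = 0..<2*m. B k j * A k l * B l i) = 0"
      using ker' by simp
  qed
  moreover have "det (mat (2*m) (2*m) (\<lambda>(i, j). B i j)) = c i"
  proof -
    have "det (mat (2*m) (2*m) (\<lambda>(i, j). B i j)) =
      (\<Sum>p | p permutes {0..<2*m}. signof p * (\<Prod>j = 0..<2*m. B j (p j)))"
      unfolding det_def using permutes_in_image
      by (auto intro!: sum.cong prod.cong arg_cong2[of _ _ _ _ "(*)"])
    also have "\<dots> = (\<Sum>p\<in>{id}. signof p * (\<Prod>j = 0..<2*m. B j (p j)))"
    proof (rule sum.mono_neutral_right)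
      show "\<forall>p\<in>{p. p permutes {0..<2*m}} - {id}. signof p * (\<Prod>j = 0..<2*m. B j (p j)) = 0"
      proof
        fix p assume p: "p \<in> {p. p permutes {0..<2*m}} - {id}"
        \<comment> \<open>Row \<open>j\<close> of \<open>B\<close> is supported in columns
          \<open>j\<close> and \<open>i\<close>. If every \<open>p j\<close> is \<open>j\<close> or
          \<open>i\<close>, then \<open>p i = i\<close>, and injectivity makes \<open>p\<close> the
          identity.\<close>
        have "\<exists>j<2*m. p j \<noteq> j \<and> p j \<noteq> i"
        proof (rule ccontr)
          assume "\<not> ?thesis"
          then have *: "p j = j \<or> p j = i" for j using p by (metis DiffD1 atLeast0LessThan lessThan_iff mem_Collect_eq permutes_not_in)
          then have "p j = j" if "j \<noteq> i" for j
            using p that by (metis DiffD1 injD mem_Collect_eq permutes_inj)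
          then have "p = id" using * by (metis eq_id_iff)
          then show False using p by simp
        qed
        then obtain j where "j < 2*m" "B j (p j) = 0" by (auto simp: B_def)
        then have "(\<Prod>j = 0..<2*m. B j (p j)) = 0" by (intro prod_zero) auto
        then show "signof p * (\<Prod>j = 0..<2*m. B j (p j)) = 0" by simp
      qed
    qed (auto simp: finite_permutations permutes_id)
    also have "\<dots> = (\<Prod>j = 0..<2*m. B j j)" by simp
    also have "\<dots> = (\<Prod>j = 0..<2*m. if j = i then c j else 1)"
      by (intro prod.cong) (auto simp: B_def)
    also have "\<dots> = c i" using i by simp
    finally show ?thesis .
  qed
  ultimately show ?thesis using i(2) pfsum_congruence[of m B A] by simp
qed

section \<open>The Pfaffian of the standard symplectic form\<close>

definition symplectic :: "nat \<Rightarrow> nat \<Rightarrow> nat \<Rightarrow> 'a::comm_ring_1" where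
  "symplectic m i j = (if j = i + m then 1 else if i = j + m then - 1 else 0)"

text \<open>With \<open>t\<close> the action of \<open>p\<close> on the lower half and
  \<open>s\<close> the exchange of the two halves, \<open>p\<close> is \<open>t\<close> after
  \<open>s\<close> after \<open>t\<close> after \<open>s\<close>, so its sign is a product of
  squares.\<close>

lemma sign_doubled_permutation:
  fixes p :: "nat \<Rightarrow> nat"
  assumes p: "p permutes {0..<2*m}" and sh: "\<And>r. r < m \<Longrightarrow> p (r + m) = p r + m"
  shows "sign p = 1"
proof -
  define t where "t i = (if i < m then p i else i)" for i :: nat
  define s where "s i = (if i < m then i + m else if i < 2*m then i - m else i)" for i :: nat
  have im: "p r < 2*m" if "r < 2*m" for r
    using that permutes_in_image[OF p, of r] by auto
  have low: "p r < m" if "r < m" for r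
    using im[of "r + m"] sh[OF that] that by auto
  have "inj_on p {0..<m}" using permutes_inj[OF p] by (auto simp: inj_on_def inj_def)
  moreover have "p ` {0..<m} \<subseteq> {0..<m}" using low by auto
  ultimately have "bij_betw p {0..<m} {0..<m}"
    by (simp add: bij_betw_def endo_inj_surj)
  then have "bij_betw t {0..<m} {0..<m}"
    by (subst bij_betw_cong[of _ _ p]) (auto simp: t_def)
  then have t: "t permutes {0..<m}" by (rule bij_imp_permutes) (auto simp: t_def)
  have s2: "s \<circ> s = id" by (auto simp: s_def fun_eq_iff)
  have "bij_betw s {0..<2*m} {0..<2*m}"
    by (rule bij_betw_byWitness[where f' = s]) (auto simp: s_def)
  then have s: "s permutes {0..<2*m}" by (rule bij_imp_permutes) (auto simp: s_def)
  have perm: "permutation t" "permutation s"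
    using t s by (auto simp: permutation_permutes)
  have "p i = (t \<circ> (s \<circ> (t \<circ> s))) i" for i
  proof -
    consider "i < m" | "m \<le> i" "i < 2*m" | "2*m \<le> i" by linarith
    then show ?thesis
    proof cases
      case 2
      then have "i - m < m" "i - m + m = i" by auto
      then show ?thesis using sh[of "i - m"] low[of "i - m"] 2 by (simp add: s_def t_def)
    next
      case 3
      then show ?thesis using p by (auto simp: s_def t_def permutes_def)
    qed (auto simp: s_def t_def)
  qed
  then have "p = t \<circ> (s \<circ> (t \<circ> s))" by blast
  then have "sign p = (sign t * sign t) * (sign s * sign s)"
    using perm by (simp add: sign_compose permutation_compose mult_ac)
  then show ?thesis by (simp only: sign_idempotent mult_1)
qed

text \<open>Exchanging \<open>p s\<close> and \<open>p (s + m)\<close> reverses both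
  \<open>sign p\<close> and the factor at \<open>s\<close>. Correcting all pairs in the wrong order
  leads to a doubled permutation, whose sign is 1. Hence nothing cancels in
  \<open>pfsum m (symplectic m)\<close>.\<close>

lemma symplectic_term:
  assumes p: "p permutes {0..<2*m}" and nz: "(\<Prod>r<m. symplectic m (p r) (p (r + m))) \<noteq> (0::int)"
  shows "sign p * (\<Prod>r<m. symplectic m (p r) (p (r + m))) = 1"
  using assms
proof (induction "card {r. r < m \<and> p r = p (r + m) + m}" arbitrary: p rule: less_induct)
  case less
  have nz: "symplectic m (p r) (p (r + m)) \<noteq> (0::int)" if "r < m" for r
    using less.prems(2) that by auto
  show ?case
  proof (cases "{r. r < m \<and> p r = p (r + m) + m} = {}")
    case True
    have *: "p (r + m) = p r + m" if "r < m" for r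
      using nz[OF that] True that by (auto simp: symplectic_def split: if_splits)
    then have "(\<Prod>r<m. symplectic m (p r) (p (r + m))) = (1::int)"
      by (intro prod.neutral) (auto simp: symplectic_def)
    then show ?thesis using sign_doubled_permutation[OF less.prems(1)] * by simp
  next
    case False
    then obtain s where s: "s < m" "p s = p (s + m) + m" by auto
    define q where "q = p \<circ> transpose s (s + m)"
    have q: "q permutes {0..<2*m}"
      unfolding q_def by (rule permutes_compose[OF permutes_swap_id less.prems(1)]) (use s in auto)
    have qs: "q s = p (s + m)" "q (s + m) = p s" by (auto simp: q_def)
    have qo: "q r = p r" "q (r + m) = p (r + m)" if "r < m" "r \<noteq> s" for r
      using that s by (auto simp: q_def transpose_def)
    have "{r. r < m \<and> q r = q (r + m) + m} \<subseteq> {r. r < m \<and> p r = p (r + m) + m} - {s}"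
      using qs qo s by auto metis+
    also have "\<dots> \<subset> {r. r < m \<and> p r = p (r + m) + m}" using s by auto
    finally have lt: "card {r. r < m \<and> q r = q (r + m) + m} < card {r. r < m \<and> p r = p (r + m) + m}"
      by (intro psubset_card_mono) auto
    have split: "(\<Prod>r<m. symplectic m (f r) (f (r + m))) = symplectic m (f s) (f (s + m)) * (\<Prod>r\<in>{..<m} - {s}. symplectic m (f r) (f (r + m)))"
      for f :: "nat \<Rightarrow> nat" using s by (intro prod.remove) auto
    have "symplectic m (q s) (q (s + m)) = - (symplectic m (p s) (p (s + m)) :: int)"
      using s by (auto simp: qs symplectic_def)
    moreover have "(\<Prod>r\<in>{..<m} - {s}. symplectic m (q r) (q (r + m))) = (\<Prod>r\<in>{..<m} - {s}. symplectic m (p r) (p (r + m)) :: int)"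
      using qo by (intro prod.cong) auto
    ultimately have pr: "(\<Prod>r<m. symplectic m (q r) (q (r + m))) = - (\<Prod>r<m. symplectic m (p r) (p (r + m)) :: int)"
      unfolding split[of q] split[of p] by simp
    have "sign q = - sign p"
      unfolding q_def using s permutation_permutes less.prems(1)
      by (subst sign_compose[OF _ permutation_swap_id]) (auto simp: sign_swap_id)
    then show ?thesis using less.hyps[OF lt q] less.prems(2) pr by simp
  qed
qed

lemma pfsum_symplectic_nonzero: "pfsum m (symplectic m) \<noteq> (0::'a::{comm_ring_1,ring_char_0})"
proof -
  let ?P = "{p. p permutes {0..<2*m}}"
  let ?t = "\<lambda>p. sign p * (\<Prod>r<m. symplectic m (p r) (p (r + m))) :: int"
  have symplectic: "of_int (symplectic m i j) = (symplectic m i j :: 'a)" for i j by (simp add: symplectic_def)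
  have "pfsum m (symplectic m) = (of_int (\<Sum>p\<in>?P. ?t p) :: 'a)"
    by (simp add: pfsum_def symplectic)
  moreover have "(\<Sum>p\<in>?P. ?t p) > 0"
  proof (rule sum_pos2[of _ id])
    have "(\<Prod>r<m. symplectic m (id r) (id (r + m))) = (1::int)"
      by (intro prod.neutral) (auto simp: symplectic_def)
    then show "?t id > 0" by simp
    show "?t p \<ge> 0" if p: "p \<in> ?P" for p
    proof (cases "(\<Prod>r<m. symplectic m (p r) (p (r + m))) = (0::int)")
      case False
      then have "?t p = 1" using p by (intro symplectic_term) simp_all
      then show ?thesis by linarith
    qed (simp only: mult_zero_right order_refl)
  qed (auto simp: finite_permutations permutes_id)
  ultimately show ?thesis by (simp only: of_int_eq_0_iff)
qed

lemma sum_halves: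
  fixes g :: "nat \<Rightarrow> 'a::comm_monoid_add"
  shows "(\<Sum>i = 0..<2*m. g i) = (\<Sum>r = 0..<m. g r) + (\<Sum>r = 0..<m. g (r + m))"
proof -
  have "{0..<2*m} = {0..<m} \<union> {0+m..<m+m}" by auto
  then have "(\<Sum>i = 0..<2*m. g i) = (\<Sum>i = 0..<m. g i) + (\<Sum>i = 0+m..<m+m. g i)"
    by (simp add: sum.union_disjoint)
  then show ?thesis by (simp only: sum.shift_bounds_nat_ivl)
qed

text \<open>Such a matrix arises from the symplectic form by congruence with the block-diagonal
  matrix made of the identity and \<open>W\<close>.\<close>

lemma pfsum_split:
  fixes A W :: "nat \<Rightarrow> nat \<Rightarrow> 'a::idom"
  assumes "\<And>i j. i < m \<Longrightarrow> j < m \<Longrightarrow> A i j = 0"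
    and "\<And>i j. i < m \<Longrightarrow> j < m \<Longrightarrow> A (i + m) (j + m) = 0"
    and "\<And>i j. i < m \<Longrightarrow> j < m \<Longrightarrow> A i (j + m) = W i j"
    and "\<And>i j. i < m \<Longrightarrow> j < m \<Longrightarrow> A (j + m) i = - W i j"
  shows "pfsum m A = det (mat m m (\<lambda>(i, j). W i j)) * pfsum m (symplectic m)"
proof -
  define B where "B k j = (if j < m then if k = j then 1 else 0
    else if k < m then 0 else W (k - m) (j - m))" for k j
  have "A i j = (\<Sum>k = 0..<2*m. \<Sum>l = 0..<2*m. B k i * symplectic m k l * B l j)"
    if "i < 2*m" "j < 2*m" for i j
  proof -
    have *: "(\<Sum>k = 0..<2*m. \<Sum>l = 0..<2*m. B k i * symplectic m k l * B l j)
      = (\<Sum>k = 0..<m. B k i * B (k + m) j) - (\<Sum>k = 0..<m. B (k + m) i * B k j)"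
      unfolding sum_halves sum_subtractf[symmetric] sum.distrib[symmetric]
      by (intro sum.cong) (auto simp: symplectic_def if_distrib[of "\<lambda>x. _ * x"] if_distrib[of "\<lambda>x. x * _"] sum.distrib cong: if_cong)
    show ?thesis
    proof (cases "i < m"; cases "j < m")
      assume "i < m" "j < m"
      then show ?thesis unfolding * using assms(1)[of i j] by (simp add: B_def)
    next
      assume "i < m" "\<not> j < m"
      then show ?thesis unfolding * using assms(3)[of i "j - m"] that
        by (simp add: B_def if_distrib[of "\<lambda>x. x * _"] if_distrib[of "\<lambda>x. _ * x"] cong: if_cong)
    next
      assume "\<not> i < m" "j < m"
      then show ?thesis unfolding * using assms(4)[of j "i - m"] that
        by (simp add: B_def if_distrib[of "\<lambda>x. x * _"] if_distrib[of "\<lambda>x. _ * x"] cong: if_cong)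
    next
      assume "\<not> i < m" "\<not> j < m"
      then show ?thesis unfolding * using assms(2)[of "i - m" "j - m"] that
        by (simp add: B_def if_distrib[of "\<lambda>x. x * _"] if_distrib[of "\<lambda>x. _ * x"] cong: if_cong)
    qed
  qed
  then have "pfsum m A = pfsum m (\<lambda>i j. \<Sum>k = 0..<2*m. \<Sum>l = 0..<2*m. B k i * symplectic m k l * B l j)"
    by (intro pfsum_cong)
  also have "\<dots> = det (mat (2*m) (2*m) (\<lambda>(i, j). B i j)) * pfsum m (symplectic m)"
    by (rule pfsum_congruence)
  also have "mat (2*m) (2*m) (\<lambda>(i, j). B i j)
      = four_block_mat (1\<^sub>m m) (0\<^sub>m m m) (0\<^sub>m m m) (mat m m (\<lambda>(i, j). W i j))"
    by (rule eq_matI) (auto simp: B_def)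
  also have "det \<dots> = det (1\<^sub>m m) * det (mat m m (\<lambda>(i, j). W i j))"
    by (rule det_four_block_mat_lower_left_zero) auto
  finally show ?thesis by simp
qed

section \<open>Walks and exponential generating functions\<close>

lemma antimono_le:
  fixes lam :: "nat \<Rightarrow> nat"
  assumes "\<And>i. lam (Suc i) \<le> lam i" "i \<le> j"
  shows "lam j \<le> lam i"
  using assms(2) by (rule lift_Suc_antimono_le[of lam, rotated]) (rule assms(1))

text \<open>A partition in \<open>Par(a, b)\<close>, as a sequence indexed from 0 that vanishes from
  index \<open>a\<close> on.\<close>

definition in_alcove :: "nat \<Rightarrow> nat \<Rightarrow> (nat \<Rightarrow> nat) \<Rightarrow> bool" where
  "in_alcove a b lam \<longleftrightarrow> (\<forall>i. lam (Suc i) \<le> lam i) \<and> lam a = 0 \<and> lam 0 \<le> lam (a - 1) + b"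

fun alcove_walks :: "nat \<Rightarrow> nat \<Rightarrow> nat \<Rightarrow> (nat \<Rightarrow> nat) \<Rightarrow> nat" where
  "alcove_walks a b 0 lam = 1"
| "alcove_walks a b (Suc n) lam = (\<Sum>i | i < a \<and> in_alcove a b (lam(i := Suc (lam i))).
     alcove_walks a b n (lam(i := Suc (lam i))))"

definition in_box :: "nat \<Rightarrow> nat \<Rightarrow> (nat \<Rightarrow> nat) \<Rightarrow> bool" where
  "in_box h w lam \<longleftrightarrow> (\<forall>i. lam (Suc i) \<le> lam i) \<and> lam h = 0 \<and> lam 0 \<le> w"

fun box_walks :: "nat \<Rightarrow> nat \<Rightarrow> ((nat \<Rightarrow> nat) \<Rightarrow> int) \<Rightarrow> nat \<Rightarrow> (nat \<Rightarrow> nat) \<Rightarrow> int" where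
  "box_walks h w st 0 lam = of_bool (lam = (\<lambda>_. 0))"
| "box_walks h w st (Suc n) lam = st lam * box_walks h w st n lam
     + (\<Sum>i | i < h \<and> in_box h w (lam(i := Suc (lam i))). box_walks h w st n (lam(i := Suc (lam i))))
     + (\<Sum>i | i < h \<and> 0 < lam i \<and> in_box h w (lam(i := lam i - 1)).
          box_walks h w st n (lam(i := lam i - 1)))"

section \<open>Hopping on the integers and its generating functions\<close>

fun hop :: "(int \<Rightarrow> rat) \<Rightarrow> nat \<Rightarrow> int \<Rightarrow> rat" where
  "hop c 0 k = c k"
| "hop c (Suc n) k = hop c n (k - 1) + hop c n (k + 1)"

text \<open>\<open>hop c n k\<close> sums \<open>c\<close> over the ends of all
  \<open>n\<close>-step walks from \<open>k\<close>. Division by \<open>n!\<close> makes the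
  derivative shift the argument in both directions; when \<open>k\<close> is a difference of two
  positions, this says that either particle moves up.\<close>

definition hop_fps :: "(int \<Rightarrow> rat) \<Rightarrow> int \<Rightarrow> rat fps" where
  "hop_fps c k = Abs_fps (\<lambda>n. hop c n k / fact n)"

lemma hop_fps_nth_0 [simp]: "fps_nth (hop_fps c k) 0 = c k"
  by (simp add: hop_fps_def)

lemma hop_fps_deriv: "fps_deriv (hop_fps c k) = hop_fps c (k - 1) + hop_fps c (k + 1)"
proof (rule fps_ext)
  fix n
  have "fps_nth (fps_deriv (hop_fps c k)) n = of_nat (Suc n) * (hop c n (k - 1) + hop c n (k + 1)) / (of_nat (Suc n) * fact n)"
    by (simp add: hop_fps_def)
  also have "\<dots> = hop c n (k - 1) / fact n + hop c n (k + 1) / fact n"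
    by (subst mult_divide_mult_cancel_left) (auto simp: add_divide_distrib simp del: of_nat_Suc)
  finally show "fps_nth (fps_deriv (hop_fps c k)) n = fps_nth (hop_fps c (k - 1) + hop_fps c (k + 1)) n"
    by (simp add: hop_fps_def)
qed

lemma hop_fps_odd:
  assumes "\<And>k. c (- k) = - c k"
  shows "hop_fps c (- k) = - hop_fps c k"
proof -
  have "hop c n (- k) = - hop c n k" for n
  proof (induction n arbitrary: k)
    case (Suc n)
    have "- k - 1 = - (k + 1)" "- k + 1 = - (k - 1)" by auto
    then show ?case by (simp only: hop.simps Suc)
  qed (use assms in simp)
  then show ?thesis by (simp add: hop_fps_def fps_eq_iff)
qed

lemma hop_fps_antiperiodic:
  assumes "\<And>k. c (k + L) = - c k"
  shows "hop_fps c (k + L) = - hop_fps c k"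
proof -
  have "hop c n (k + L) = - hop c n k" for n
  proof (induction n arbitrary: k)
    case (Suc n)
    show ?case using Suc[of "k + 1"] Suc[of "k - 1"] by (simp add: algebra_simps)
  qed (use assms in simp)
  then show ?thesis by (simp add: hop_fps_def fps_eq_iff)
qed

text \<open>The offset 2 is collected at the end of each of the \<open>2 ^ n\<close> walks, which
  sums to \<open>2 * fps_exp 2\<close>. It is written as a product because one factor
  \<open>fps_exp 1\<close> will be a pairing with the point at infinity.\<close>

lemma hop_fps_quasiperiodic:
  assumes "\<And>k. c (k + L) = c k + 2"
  shows "hop_fps c (k + L) = hop_fps c k + 2 * fps_exp 1 * fps_exp 1"
proof -
  have "hop c n (k + L) = hop c n k + 2 * 2 ^ n" for n
  proof (induction n arbitrary: k)
    case (Suc n)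
    show ?case using Suc[of "k + 1"] Suc[of "k - 1"] by (simp add: algebra_simps)
  qed (use assms in simp)
  then have "hop_fps c (k + L) = hop_fps c k + fps_const 2 * fps_exp 2"
    by (simp add: hop_fps_def fps_eq_iff add_divide_distrib)
  moreover have "fps_exp 2 = fps_exp 1 * (fps_exp 1 :: rat fps)"
    by (simp add: fps_exp_add_mult[symmetric])
  ultimately show ?thesis by (simp add: mult.assoc numeral_fps_const)
qed

text \<open>The initial values of the kernel: all differences of positions of an admissible configuration lie
  strictly between \<open>- L\<close> and \<open>L\<close>, where both functions are the sign. The wave suits an even number of
  particles on the ring and the stair an odd number.\<close>

definition square_wave :: "nat \<Rightarrow> int \<Rightarrow> rat" where
  "square_wave L k = (if int L dvd k then 0 else if even (k div int L) then 1 else - 1)"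

definition stair :: "nat \<Rightarrow> int \<Rightarrow> rat" where
  "stair L k = of_int (k div int L) - of_int ((- k) div int L)"

lemma square_wave_odd: "L > 0 \<Longrightarrow> square_wave L (- k) = - square_wave L k"
proof (cases "int L dvd k")
  case False
  then have "(- k) div int L = - (k div int L) - 1"
    if "L > 0" using that by (simp add: zdiv_zminus1_eq_if dvd_eq_mod_eq_0)
  then show "L > 0 \<Longrightarrow> ?thesis" using False by (simp add: square_wave_def)
qed (simp add: square_wave_def)

lemma square_wave_shift: "L > 0 \<Longrightarrow> square_wave L (k + int L) = - square_wave L k"
  by (simp add: square_wave_def)

lemma square_wave_1: "0 < k \<Longrightarrow> k < int L \<Longrightarrow> square_wave L k = 1"
  by (auto simp: square_wave_def zdvd_not_zless)

lemma stair_odd: "stair L (- k) = - stair L k"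
  by (simp add: stair_def)

lemma stair_shift: 
  assumes "L > 0"
  shows "stair L (k + int L) = stair L k + 2"
proof -
  have "(- (k + int L)) div int L = (- k + (- 1) * int L) div int L" by simp
  also have "\<dots> = (- k) div int L - 1"
    using assms by (subst div_mult_self1) auto
  finally show ?thesis using assms by (simp add: stair_def)
qed

lemma stair_1:
  assumes "0 < k" and "k < int L"
  shows "stair L k = 1"
proof -
  have "k div int L = 0" "(- k) div int L = - 1"
    using assms by (auto simp: div_pos_pos_trivial div_eq_minus1 zdiv_zminus1_eq_if)
  then show ?thesis by (simp add: stair_def)
qed

section \<open>Leibniz rules for products, Pfaffian sums and determinants\<close>

lemma fps_deriv_prod:
  fixes f :: "'i \<Rightarrow> 'a::comm_ring_1 fps"
  assumes "finite S"
  shows "fps_deriv (\<Prod>i\<in>S. f i) = (\<Sum>i\<in>S. fps_deriv (f i) * (\<Prod>j\<in>S - {i}. f j))"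
  using assms
proof (induction S)
  case (insert x S)
  have "(\<Sum>i\<in>S. fps_deriv (f i) * (\<Prod>j\<in>insert x S - {i}. f j))
      = (\<Sum>i\<in>S. f x * (fps_deriv (f i) * (\<Prod>j\<in>S - {i}. f j)))"
  proof (intro sum.cong refl)
    fix i assume i: "i \<in> S"
    then have "insert x S - {i} = insert x (S - {i})" using insert by auto
    then show "fps_deriv (f i) * (\<Prod>j\<in>insert x S - {i}. f j) = f x * (fps_deriv (f i) * (\<Prod>j\<in>S - {i}. f j))"
      using insert by (simp add: algebra_simps)
  qed
  then show ?case
    using insert by (simp add: sum_distrib_left algebra_simps)
qed simp

lemma fps_nth_0_prod:
  "fps_nth (\<Prod>i\<in>S. f i) 0 = (\<Prod>i\<in>S. fps_nth (f i) 0 :: 'a::comm_ring_1)"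
  by (induction S rule: infinite_finite_induct) auto

lemma fps_deriv_of_int_mult:
  "fps_deriv (of_int c * F) = of_int c * fps_deriv (F :: 'a::comm_ring_1 fps)"
  by (simp flip: fps_of_int)

lemma fps_nth_of_int_mult: "fps_nth (of_int c * F) n = of_int c * fps_nth (F :: 'a::comm_ring_1 fps) n"
  by (simp flip: fps_of_int)

lemma pfsum_nth_0:
  "fps_nth (pfsum m A) 0 = pfsum m (\<lambda>i j. fps_nth (A i j) 0 :: 'a::comm_ring_1)"
  unfolding pfsum_def by (simp add: fps_sum_nth fps_nth_of_int_mult fps_nth_0_prod del: fps_mult_nth_0)

text \<open>\<open>A' k\<close> is the matrix after a move of particle \<open>k\<close>; indices
  from \<open>a\<close> on do not move. A permutation puts every index into exactly one factor, so
  the Leibniz rule moves one particle at a time. The two indices of a factor are distinct, whence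
  \<open>i \<noteq> j\<close> in the hypothesis.\<close>

lemma pfsum_deriv:
  fixes A :: "nat \<Rightarrow> nat \<Rightarrow> 'a::comm_ring_1 fps"
  assumes deriv: "\<And>i j. i < 2*m \<Longrightarrow> j < 2*m \<Longrightarrow> i \<noteq> j \<Longrightarrow> fps_deriv (A i j) =
      (if i < a then A' i i j else 0) + (if j < a then A' j i j else 0)"
    and other: "\<And>k i j. i \<noteq> k \<Longrightarrow> j \<noteq> k \<Longrightarrow> A' k i j = A i j"
    and a: "a \<le> 2*m"
  shows "fps_deriv (pfsum m A) = (\<Sum>k<a. pfsum m (A' k))"
proof -
  have "fps_deriv (\<Prod>r<m. A (p r) (p (r + m))) = (\<Sum>k<a. \<Prod>r<m. A' k (p r) (p (r + m)))"
    if p: "p permutes {0..<2*m}" for p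
  proof -
    have im: "p r < 2*m" if "r < 2*m" for r
      using that permutes_in_image[OF p, of r] by auto
    have inj: "p i = p j \<longleftrightarrow> i = j" for i j
      using permutes_inj[OF p] by (auto simp: inj_def)
    let ?t = "\<lambda>k. if k < a then \<Prod>r<m. A' k (p r) (p (r + m)) else 0"
    have *: "(\<Prod>r'<m. A' k (p r') (p (r' + m))) = A' k (p r) (p (r + m)) * (\<Prod>r'\<in>{..<m} - {r}. A (p r') (p (r' + m)))"
      if "r < m" "k = p r \<or> k = p (r + m)" for r k
    proof -
      have "(\<Prod>r'\<in>{..<m} - {r}. A' k (p r') (p (r' + m))) = (\<Prod>r'\<in>{..<m} - {r}. A (p r') (p (r' + m)))"
        using that by (intro prod.cong other) (auto simp: inj)
      then show ?thesis using that by (subst prod.remove[of _ r]) auto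
    qed
    have "fps_deriv (\<Prod>r<m. A (p r) (p (r + m)))
        = (\<Sum>r<m. fps_deriv (A (p r) (p (r + m))) * (\<Prod>j\<in>{..<m} - {r}. A (p j) (p (j + m))))"
      by (rule fps_deriv_prod) simp
    also have "\<dots> = (\<Sum>r = 0..<m. ?t (p r) + ?t (p (r + m)))"
    proof (rule sum.cong)
      show "{..<m} = {0..<m}" by auto
      fix r assume r: "r \<in> {0..<m}"
      then show "fps_deriv (A (p r) (p (r + m))) * (\<Prod>j\<in>{..<m} - {r}. A (p j) (p (j + m))) = ?t (p r) + ?t (p (r + m))"
        using *[of r "p r"] *[of r "p (r + m)"] im[of r] im[of "r + m"] deriv[of "p r" "p (r + m)"] inj[of r "r + m"]
        by (auto simp: algebra_simps)
    qed
    also have "\<dots> = (\<Sum>i = 0..<2*m. ?t (p i))"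
      by (simp only: sum_halves sum.distrib)
    also have "\<dots> = (\<Sum>k = 0..<2*m. ?t k)"
      using sum.permute[OF p, of ?t] by (simp add: o_def)
    also have "\<dots> = (\<Sum>k\<in>{..<a}. ?t k)"
      using a by (intro sum.mono_neutral_right) auto
    also have "\<dots> = (\<Sum>k<a. \<Prod>r<m. A' k (p r) (p (r + m)))"
      by simp
    finally show ?thesis .
  qed
  then have "fps_deriv (pfsum m A) = (\<Sum>p | p permutes {0..<2*m}. \<Sum>k<a. signof p * (\<Prod>r<m. A' k (p r) (p (r + m))))"
    by (simp add: pfsum_def fps_deriv_sum fps_deriv_of_int_mult sum_distrib_left del: fps_deriv_mult)
  also have "\<dots> = (\<Sum>k<a. pfsum m (A' k))"
    unfolding pfsum_def by (rule sum.swap)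
  finally show ?thesis .
qed

lemma det_mat: "det (mat n n (\<lambda>(i, j). F i j)) = (\<Sum>p | p permutes {0..<n}. signof p * (\<Prod>i = 0..<n. F i (p i)))"
  unfolding det_def using permutes_in_image
  by (auto intro!: sum.cong prod.cong arg_cong2[of _ _ _ _ "(*)"])

lemma det_mat_nth_0:
  "fps_nth (det (mat n n (\<lambda>(i, j). F i j))) 0 = det (mat n n (\<lambda>(i, j). fps_nth (F i j) 0 :: 'a::comm_ring_1))"
  unfolding det_mat by (simp add: fps_sum_nth fps_nth_of_int_mult fps_nth_0_prod del: fps_mult_nth_0)

lemma det_rows_deriv:
  fixes F :: "int \<Rightarrow> nat \<Rightarrow> 'a::comm_ring_1 fps"
  assumes "\<And>k j. fps_deriv (F k j) = F (k - 1) j + F (k + 1) j"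
  shows "fps_deriv (det (mat n n (\<lambda>(i, j). F (l i) j))) =
    (\<Sum>i<n. det (mat n n (\<lambda>(i', j). F ((l(i := l i + 1)) i') j)) + det (mat n n (\<lambda>(i', j). F ((l(i := l i - 1)) i') j)))"
proof -
  have *: "(\<Prod>i'=0..<n. F ((l(i := k)) i') (p i')) = F k (p i) * (\<Prod>i'\<in>{0..<n} - {i}. F (l i') (p i'))"
    if "i < n" for i k p
  proof -
    have "(\<Prod>i'\<in>{0..<n} - {i}. F ((l(i := k)) i') (p i')) = (\<Prod>i'\<in>{0..<n} - {i}. F (l i') (p i'))"
      by (intro prod.cong) auto
    then show ?thesis using that by (subst prod.remove[of _ i]) auto
  qed
  have "fps_deriv (\<Prod>i = 0..<n. F (l i) (p i)) = (\<Sum>i<n. (\<Prod>i'=0..<n. F ((l(i := l i + 1)) i') (p i')) + (\<Prod>i'=0..<n. F ((l(i := l i - 1)) i') (p i')))"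
    for p
    by (subst fps_deriv_prod) (auto simp: * assms lessThan_atLeast0 algebra_simps simp del: fun_upd_apply intro!: sum.cong)
  then have "fps_deriv (det (mat n n (\<lambda>(i, j). F (l i) j))) =
    (\<Sum>p | p permutes {0..<n}. \<Sum>i<n. signof p * (\<Prod>i'=0..<n. F ((l(i := l i + 1)) i') (p i')) + signof p * (\<Prod>i'=0..<n. F ((l(i := l i - 1)) i') (p i')))"
    by (simp add: det_mat fps_deriv_sum fps_deriv_of_int_mult sum_distrib_left distrib_left del: fps_deriv_mult fun_upd_apply)
  then show ?thesis
    by (subst (asm) sum.swap) (simp add: det_mat sum.distrib del: fun_upd_apply)
qed

section \<open>Walks in the alcove as a Pfaffian\<close>

locale alcove_box =
  fixes h w a b :: nat
  assumes hw: "0 < h" "0 < w"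
    and a_cases: "a = 2 * h \<or> a = 2 * h + 1"
    and b_cases: "b = 2 * w \<or> b = 2 * w + 1"
begin

definition kernel :: "int \<Rightarrow> rat fps" where
  "kernel = hop_fps (if odd a then stair (a + b) else square_wave (a + b))"

abbreviation (input) half :: nat where
  "half \<equiv> (a + 1) div 2"

lemma half: "2 * half = (if odd a then a + 1 else a)" "half = (if odd a then h + 1 else h)"
  using a_cases by auto

lemma kernel_deriv: "fps_deriv (kernel k) = kernel (k - 1) + kernel (k + 1)"
  by (simp add: kernel_def hop_fps_deriv)

lemma kernel_minus: "kernel (- k) = - kernel k"
  unfolding kernel_def using hw a_cases
  by (intro hop_fps_odd) (auto simp: stair_odd square_wave_odd)

lemma kernel_0 [simp]: "kernel 0 = 0"
  using kernel_minus[of 0] by simp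

lemma kernel_swap: "kernel (p - q) = - kernel (q - p)"
  using kernel_minus[of "q - p"] by simp

lemma kernel_shift_even: "even a \<Longrightarrow> kernel (k + int (a + b)) = - kernel k"
  using hop_fps_antiperiodic[of "square_wave (a + b)", OF square_wave_shift] hw a_cases
  by (auto simp: kernel_def simp del: of_nat_add)

lemma kernel_shift_odd: "odd a \<Longrightarrow> kernel (k + int (a + b)) = kernel k + 2 * fps_exp 1 * fps_exp 1"
  using hop_fps_quasiperiodic[of "stair (a + b)", OF stair_shift] hw a_cases
  by (auto simp: kernel_def simp del: of_nat_add)

lemma kernel_nth_0: "0 < k \<Longrightarrow> k < int (a + b) \<Longrightarrow> fps_nth (kernel k) 0 = 1"
  by (simp add: kernel_def square_wave_1 stair_1 del: of_nat_add)

lemma kernel_nth_0_neg: "k < 0 \<Longrightarrow> - k < int (a + b) \<Longrightarrow> fps_nth (kernel k) 0 = - 1"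
  using kernel_nth_0[of "- k"] kernel_minus[of "- k"] by simp

text \<open>The generator \<open>None\<close> is a point at infinity, needed to make the number of generators even
  when \<open>a\<close> is odd.\<close>

fun form :: "int option \<Rightarrow> int option \<Rightarrow> rat fps" where
  "form None None = 0"
| "form None (Some q) = fps_exp 1"
| "form (Some p) None = - fps_exp 1"
| "form (Some p) (Some q) = kernel (q - p)"

lemma form_skew: "form g g' = - form g' g"
  by (cases g; cases g') (auto intro: kernel_swap)

definition gens :: "(nat \<Rightarrow> int) \<Rightarrow> nat \<Rightarrow> int option" where
  "gens x i = (if i < a then Some (x i) else None)"

definition pf :: "(nat \<Rightarrow> int) \<Rightarrow> rat fps" where
  "pf x = pfsum half (\<lambda>i j. form (gens x i) (gens x j))"

text \<open>Moving either particle shifts the difference by one, matching the two terms of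
  \<open>kernel_deriv\<close>. The pairing with the point at infinity is independent of the
  position, and \<open>fps_exp 1\<close> is its own derivative, so it follows the same rule.\<close>

lemma pf_deriv: "fps_deriv (pf x) = (\<Sum>k<a. pf (x(k := x k + 1)))"
  unfolding pf_def
proof (rule pfsum_deriv)
  show "a \<le> 2 * half" by (auto simp: half)
  fix i j :: nat
  assume "i \<noteq> j"
  then show "fps_deriv (form (gens x i) (gens x j)) =
      (if i < a then form (gens (x(i := x i + 1)) i) (gens (x(i := x i + 1)) j) else 0)
    + (if j < a then form (gens (x(j := x j + 1)) i) (gens (x(j := x j + 1)) j) else 0)"
    by (auto simp: gens_def kernel_deriv algebra_simps)
qed (auto simp: gens_def)

lemma sum_two:
  fixes F :: "nat \<Rightarrow> rat fps"
  assumes "i < n" "j < n" "i \<noteq> j"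
  shows "(\<Sum>k = 0..<n. (if k = i then c else if k = j then d else 0) * F k) = c * F i + d * F j"
proof -
  have "(\<Sum>k = 0..<n. (if k = i then c else if k = j then d else 0) * F k) = (\<Sum>k = 0..<n. (if k = i then c * F k else 0) + (if k = j then d * F k else 0))"
    using assms by (intro sum.cong) auto
  then show ?thesis using assms by (simp add: sum.distrib)
qed

text \<open>The Gram matrix has a kernel vector. For equal positions it is generator
  \<open>i\<close> minus generator \<open>j\<close>. After a full turn with \<open>a\<close> even,
  \<open>kernel\<close> changes sign and the sum of the two generators works. With \<open>a\<close>
  odd the difference leaves the offset \<open>2 * fps_exp 1 * fps_exp 1\<close>, which is cancelled
  by \<open>2 * fps_exp 1\<close> times the point at infinity, the generator of index
  \<open>a\<close>.\<close>

lemma pf_coincide: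
  assumes "i < a" "j < a" "i \<noteq> j" and eq: "x i = x j \<or> x i = x j + int (a + b)"
  shows "pf x = 0"
proof -
  have ij: "i < 2 * half" "j < 2 * half" using assms by (auto simp: half)
  define d :: "rat fps" where "d = (if x i = x j \<or> odd a then - 1 else 1)"
  define e :: "rat fps" where "e = (if x i \<noteq> x j \<and> odd a then 2 * fps_exp 1 else 0)"
  define c where "c k = (if k = i then 1 else if k = j then d else 0) + (if k = a then e else 0)" for k
  show ?thesis unfolding pf_def
  proof (rule pfsum_kernel[of i _ c])
    fix l assume l: "l < 2 * half"
    let ?F = "\<lambda>k. form (gens x k) (gens x l)"
    have "(\<Sum>k = 0..<2 * half. c k * ?F k) =
        (\<Sum>k = 0..<2 * half. (if k = i then 1 else if k = j then d else 0) * ?F k)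
      + (\<Sum>k = 0..<2 * half. if k = a then e * ?F k else 0)"
      unfolding sum.distrib[symmetric] by (intro sum.cong) (auto simp: c_def algebra_simps)
    also have "(\<Sum>k = 0..<2 * half. if k = a then e * ?F k else 0) = e * ?F a"
      using half(1) by (cases "odd a") (auto simp: e_def)
    also have "(\<Sum>k = 0..<2 * half. (if k = i then 1 else if k = j then d else 0) * ?F k) = ?F i + d * ?F j"
      by (subst sum_two[OF ij assms(3)]) simp
    also have "?F i + d * ?F j + e * ?F a = 0"
    proof (cases "x i = x j")
      case True
      then show ?thesis using assms by (simp add: gens_def d_def e_def)
    next
      case False
      then have xi: "x i = x j + int (a + b)" using eq by simp
      have k: "kernel (x l - x j) = kernel (x l - x i + int (a + b))" by (simp add: xi algebra_simps)
      show ?thesis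
      proof (cases "odd a")
        case True
        then show ?thesis using assms(1-2) False k
          by (auto simp: gens_def d_def e_def kernel_shift_odd simp del: of_nat_add)
      next
        case False
        have "l < a" using l False by (simp add: half)
        then show ?thesis using assms(1-2) False \<open>x i \<noteq> x j\<close> k
          by (auto simp: gens_def d_def e_def kernel_shift_even simp del: of_nat_add)
      qed
    qed
    finally show "(\<Sum>k = 0..<2 * half. c k * ?F k) = 0" .
  next
    show "c i \<noteq> 0" using assms(1) by (simp add: c_def)
  qed (rule ij(1), rule form_skew)
qed

text \<open>The constant centres the initial configuration: it occupies the sites from
  \<open>-h\<close> to \<open>h\<close> for odd \<open>a\<close> and from \<open>-h\<close> to
  \<open>h - 1\<close> for even \<open>a\<close>, hence is stable under the reflection
  \<open>p \<mapsto> -p\<close> or \<open>p \<mapsto> -p - 1\<close>.\<close>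

definition pos :: "(nat \<Rightarrow> nat) \<Rightarrow> nat \<Rightarrow> int" where
  "pos lam i = int (lam i) - int i + (if odd a then int h else int h - 1)"

text \<open>In the alcove the positions strictly decrease and differ by less than
  \<open>a + b\<close>. On this range the constant term of \<open>kernel\<close> is the sign, so
  only the order of the indices matters.\<close>

lemma pf_nth_0:
  assumes "in_alcove a b lam"
  shows "fps_nth (pf (pos lam)) 0 = fps_nth (pf (pos (\<lambda>_. 0))) 0"
proof -
  have gen: "fps_nth (form (gens (pos lam) i) (gens (pos lam) j)) 0 =
      (if i < a \<and> j < a then if i < j then - 1 else if i = j then 0 else 1
       else if i < a then - 1 else if j < a then 1 else 0)"
    if lam: "in_alcove a b lam" for i j lam
  proof -
    have dec: "lam q \<le> lam p" "lam p \<le> lam q + b" if "p \<le> q" "q < a" for p q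
    proof -
      have mono: "lam j \<le> lam i" if "i \<le> j" for i j
        using antimono_le[of lam, OF _ that] lam by (auto simp: in_alcove_def)
      show "lam q \<le> lam p" using mono that by simp
      have "lam p \<le> lam 0" "lam (a - 1) \<le> lam q" using mono that by auto
      then show "lam p \<le> lam q + b" using lam by (auto simp: in_alcove_def)
    qed
    have "fps_nth (kernel (pos lam j - pos lam i)) 0 = - 1" if "i < j" "j < a" for i j
      using dec[of i j] that by (intro kernel_nth_0_neg) (auto simp: pos_def)
    moreover have "fps_nth (kernel (pos lam j - pos lam i)) 0 = 1" if "j < i" "i < a" for i j
      using dec[of j i] that by (intro kernel_nth_0) (auto simp: pos_def)
    ultimately show ?thesis
      by (auto simp: gens_def not_less dest: le_neq_implies_less)
  qed
  have "in_alcove a b (\<lambda>_. 0)" by (simp add: in_alcove_def)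
  then show ?thesis
    unfolding pf_def pfsum_nth_0 using assms by (intro pfsum_cong) (simp add: gen)
qed

text \<open>A forbidden move puts a particle onto its predecessor, or puts the first particle
  exactly one turn \<open>a + b\<close> above the last one.\<close>

lemma alcove_exit:
  assumes lam: "in_alcove a b lam" and i: "i < a" and exit: "\<not> in_alcove a b (lam(i := Suc (lam i)))"
  shows "pf ((pos lam)(i := pos lam i + 1)) = 0"
proof (cases "i = 0")
  case False
  have "lam i = lam (i - 1)"
  proof (rule ccontr)
    assume "lam i \<noteq> lam (i - 1)"
    then have "lam i < lam (i - 1)"
      using lam False by (metis Suc_pred' bot_nat_0.not_eq_extremum in_alcove_def le_neq_implies_less)
    then have "Suc (lam i) \<le> lam k" if "Suc k = i" for k
      using that by auto
    then have "in_alcove a b (lam(i := Suc (lam i)))"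
      using lam i False unfolding in_alcove_def by (cases "a - 1 = i") (auto simp: le_SucI)
    then show False using exit by simp
  qed
  moreover have "int (i - 1) = int i - 1" using False by simp
  ultimately have "pos lam i + 1 = pos lam (i - 1)" by (simp add: pos_def)
  then show ?thesis using i False by (intro pf_coincide[of i "i - 1"]) simp_all
next
  case True
  have "lam 0 = lam (a - 1) + b"
  proof (rule ccontr)
    assume "lam 0 \<noteq> lam (a - 1) + b"
    then have "in_alcove a b (lam(i := Suc (lam i)))"
      using lam i True a_cases hw by (auto simp: in_alcove_def le_SucI)
    then show False using exit by simp
  qed
  moreover have "int (a - 1) = int a - 1" "0 < a" "a - 1 \<noteq> 0" using i a_cases hw by auto
  ultimately have "pos lam 0 + 1 = pos lam (a - 1) + int (a + b)" by (simp add: pos_def)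
  then show ?thesis using \<open>0 < a\<close> \<open>a - 1 \<noteq> 0\<close> True
    by (intro pf_coincide[of 0 "a - 1"]) simp_all
qed

lemma fps_nth_Suc_fact:
  "fps_nth F (Suc n) * fact (Suc n) = fps_nth (fps_deriv F) n * (fact n :: rat)"
  by (simp add: algebra_simps)

text \<open>Moves out of the alcove contribute 0, and the constant term does not depend on the
  configuration reached; this is what leaves the end point of the walks free.\<close>

lemma pf_alcove_walks:
  assumes "in_alcove a b lam"
  shows "fps_nth (pf (pos lam)) n * fact n = fps_nth (pf (pos (\<lambda>_. 0))) 0 * of_nat (alcove_walks a b n lam)"
  using assms
proof (induction n arbitrary: lam)
  case 0
  then show ?case by (simp add: pf_nth_0)
next
  case (Suc n)
  let ?up = "\<lambda>i. lam(i := Suc (lam i))"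
  have pos: "(pos lam)(i := pos lam i + 1) = pos (?up i)" for i
    by (auto simp: pos_def fun_eq_iff)
  have "fps_nth (pf (pos lam)) (Suc n) * fact (Suc n) = (\<Sum>i<a. fps_nth (pf ((pos lam)(i := pos lam i + 1))) n * fact n)"
    unfolding fps_nth_Suc_fact by (simp add: pf_deriv fps_sum_nth sum_distrib_right)
  also have "\<dots> = (\<Sum>i | i < a \<and> in_alcove a b (?up i). fps_nth (pf ((pos lam)(i := pos lam i + 1))) n * fact n)"
    using alcove_exit[OF Suc.prems] by (intro sum.mono_neutral_right) auto
  also have "\<dots> = (\<Sum>i | i < a \<and> in_alcove a b (?up i). fps_nth (pf (pos (\<lambda>_. 0))) 0 * of_nat (alcove_walks a b n (?up i)))"
    using Suc.IH by (intro sum.cong) (auto simp: pos)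
  finally show ?case by (simp add: sum_distrib_left)
qed

end

section \<open>Walks in the box as a determinant\<close>

lemma det_row_scale:
  fixes F G :: "nat \<Rightarrow> nat \<Rightarrow> 'a::comm_ring_1"
  assumes "i < n" "\<And>j. j < n \<Longrightarrow> F i j = c * G i j" "\<And>k j. k \<noteq> i \<Longrightarrow> F k j = G k j"
  shows "det (mat n n (\<lambda>(i, j). F i j)) = c * det (mat n n (\<lambda>(i, j). G i j))"
  unfolding det_mat sum_distrib_left
proof (intro sum.cong refl)
  fix p assume p: "p \<in> {p. p permutes {0..<n}}"
  then have "p i < n" using permutes_in_image[of p "{0..<n}" i] assms(1) by auto
  then have "(\<Prod>k = 0..<n. F k (p k)) = c * G i (p i) * (\<Prod>k\<in>{0..<n} - {i}. G k (p k))"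
    using assms by (subst prod.remove[of _ i]) auto
  also have "\<dots> = c * (\<Prod>k = 0..<n. G k (p k))"
    using assms(1) by (subst prod.remove[of "{0..<n}" i]) (auto simp: mult.assoc)
  finally show "signof p * (\<Prod>k = 0..<n. F k (p k)) = c * (signof p * (\<Prod>k = 0..<n. G k (p k)))"
    by (simp add: algebra_simps)
qed

lemma pfsum_symplectic_of_int: "pfsum m (symplectic m) = (of_int (pfsum m (symplectic m)) :: 'a::comm_ring_1)"
proof -
  have "of_int (symplectic m i j) = (symplectic m i j :: 'a)" for i j by (simp add: symplectic_def)
  then show ?thesis by (simp add: pfsum_def)
qed

text \<open>Vectors are formal integer combinations of generators, stored as lists in which a
  generator may recur.\<close>

definition coeff_at :: "(int \<times> 'g) list \<Rightarrow> 'g \<Rightarrow> int" where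
  "coeff_at vs g = (\<Sum>(c, g')\<leftarrow>vs. if g' = g then c else 0)"

lemma sum_coeff_at:
  fixes F :: "'g \<Rightarrow> 'a::comm_ring_1" and gen :: "nat \<Rightarrow> 'g"
  assumes inj: "inj_on gen {0..<n}" and vs: "snd ` set vs \<subseteq> gen ` {0..<n}"
  shows "(\<Sum>k = 0..<n. of_int (coeff_at vs (gen k)) * F (gen k)) = (\<Sum>(c, g)\<leftarrow>vs. of_int c * F g)"
  using vs
proof (induction vs)
  case (Cons v vs)
  obtain c g where v: "v = (c, g)" by (cases v)
  obtain k0 where k0: "k0 < n" "gen k0 = g" using Cons.prems v by auto
  have eq: "g = gen k \<longleftrightarrow> k = k0" if "k < n" for k
    using inj_on_eq_iff[OF inj, of k k0] k0 that by auto
  have "(\<Sum>k = 0..<n. of_int (coeff_at (v # vs) (gen k)) * F (gen k))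
    = (\<Sum>k = 0..<n. (if k = k0 then of_int c * F g else 0) + of_int (coeff_at vs (gen k)) * F (gen k))"
    using k0 by (intro sum.cong) (auto simp: coeff_at_def v eq algebra_simps)
  then show ?case using Cons k0 by (simp add: sum.distrib v)
qed (simp add: coeff_at_def)

context alcove_box
begin

text \<open>The pairing of the \<open>k\<close>-th moving vector with the \<open>j\<close>-th fixed vector, see
  \<open>pairing_moving_fixed\<close>. As a function of \<open>k\<close> it evolves by hopping on \<open>{1..h + w}\<close>; the reflections at
  the two ends are \<open>entry_0\<close> and \<open>entry_top\<close>.\<close>

definition entry :: "int \<Rightarrow> nat \<Rightarrow> rat fps" where
  "entry k j = 2 * (if odd a then kernel (int j - k) - kernel (int j + k) + 2 * kernel k
     else kernel (int j - k) + kernel (int j + k - 1))"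

lemma entry_deriv: "fps_deriv (entry k j) = entry (k - 1) j + entry (k + 1) j"
  by (simp add: entry_def kernel_deriv algebra_simps)

text \<open>The wall at the lower end: site 0 absorbs for odd \<open>a\<close>; for even
  \<open>a\<close> a particle stepping down from site 1 is put back, which amounts to a stationary
  step.\<close>

lemma entry_0: "entry 0 j = (if odd a then 0 else entry 1 j)"
  by (simp add: entry_def)

text \<open>The wall at the upper end: a step up from site \<open>h + w\<close> is absorbed for odd
  \<open>b\<close> and put back with sign -1 for even \<open>b\<close>. The source is the shift rule
  of \<open>kernel\<close> by \<open>a + b\<close>, which is twice \<open>h + w\<close> plus 0, 1 or
  2 according to the parities, together with oddness of \<open>kernel\<close> when \<open>a\<close>
  is odd.\<close>

lemma entry_top: "entry (int (h + w) + 1) j = - of_bool (even b) * entry (int (h + w)) j"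
proof -
  have m: "kernel (- k) = - kernel k" for k by (rule kernel_minus)
  consider "odd a" "odd b" | "odd a" "even b" | "even a" "odd b" | "even a" "even b" by blast
  then show ?thesis
  proof cases
    case 1
    then have L: "int (a + b) = 2 * int (h + w) + 2" using a_cases b_cases by auto
    have s: "kernel (k + (2 * int (h + w) + 2)) = kernel k + 2 * fps_exp 1 * fps_exp 1" for k
      using kernel_shift_odd[OF 1(1), of k] unfolding L .
    let ?N = "int (h + w)"
    have "int j - (?N + 1) + (2 * ?N + 2) = int j + (?N + 1)" "- (?N + 1) + (2 * ?N + 2) = ?N + 1" by simp_all
    then have s1: "kernel (int j + (?N + 1)) = kernel (int j - (?N + 1)) + 2 * fps_exp 1 * fps_exp 1"
      and s2: "kernel (?N + 1) = - kernel (?N + 1) + 2 * fps_exp 1 * fps_exp 1"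
      using s[of "int j - (?N + 1)"] s[of "- (?N + 1)"] by (simp_all only: m)
    have "2 * kernel (?N + 1) = 2 * fps_exp 1 * fps_exp 1"
      using s2 by (metis add_minus_cancel mult_2)
    then show ?thesis unfolding entry_def s1 using 1 by simp
  next
    case 2
    then have L: "int (a + b) = 2 * int (h + w) + 1" using a_cases b_cases by auto
    have s: "kernel (k + (2 * int (h + w) + 1)) = kernel k + 2 * fps_exp 1 * fps_exp 1" for k
      using kernel_shift_odd[OF 2(1), of k] unfolding L .
    let ?N = "int (h + w)"
    have "int j - (?N + 1) + (2 * ?N + 1) = int j + ?N" "int j - ?N + (2 * ?N + 1) = int j + (?N + 1)"
      "- ?N + (2 * ?N + 1) = ?N + 1" by simp_all
    then have "kernel (int j + ?N) = kernel (int j - (?N + 1)) + 2 * fps_exp 1 * fps_exp 1"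
      and "kernel (int j + (?N + 1)) = kernel (int j - ?N) + 2 * fps_exp 1 * fps_exp 1"
      and "kernel (?N + 1) = - kernel ?N + 2 * fps_exp 1 * fps_exp 1"
      using s[of "int j - (?N + 1)"] s[of "int j - ?N"] s[of "- ?N"] by (simp_all only: m)
    then show ?thesis unfolding entry_def using 2 by (simp only: algebra_simps) simp
  next
    case 3
    then have L: "int (a + b) = 2 * int (h + w) + 1" using a_cases b_cases by auto
    have s: "kernel (k + (2 * int (h + w) + 1)) = - kernel k" for k
      using kernel_shift_even[OF 3(1), of k] unfolding L .
    show ?thesis
      using s[of "int j - int (h + w) - 1"] 3
      by (simp add: entry_def algebra_simps)
  next
    case 4
    then have L: "int (a + b) = 2 * int (h + w)" using a_cases b_cases by auto
    have s: "kernel (k + (2 * int (h + w))) = - kernel k" for k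
      using kernel_shift_even[OF 4(1), of k] unfolding L .
    show ?thesis
      using s[of "int j - int (h + w) - 1"] s[of "int j - int (h + w)"] 4
      by (simp add: entry_def algebra_simps)
  qed
qed

text \<open>All arguments of \<open>kernel\<close> lie strictly between \<open>-(a + b)\<close> and
  \<open>a + b\<close>, so every constant term is a sign. The values 4, 2, 0 make the initial matrix
  triangular.\<close>

lemma entry_nth_0:
  assumes "0 < k" "k \<le> int (h + w)" "0 < j" "j \<le> h"
  shows "fps_nth (entry k j) 0 = (if k < int j then 4 else if k = int j then 2 else 0)"
proof -
  have "fps_nth (kernel (int j - k)) 0 = (if k < int j then 1 else if k = int j then 0 else - 1)"
    using assms kernel_nth_0[of "int j - k"] kernel_nth_0_neg[of "int j - k"] a_cases b_cases hw by auto
  moreover have "fps_nth (kernel (int j + k)) 0 = 1" if "odd a"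
    using assms that a_cases b_cases hw by (intro kernel_nth_0) auto
  moreover have "fps_nth (kernel (int j + k - 1)) 0 = 1" if "even a"
    using assms that a_cases b_cases hw by (intro kernel_nth_0) auto
  moreover have "fps_nth (kernel k) 0 = 1"
    using assms a_cases b_cases hw by (intro kernel_nth_0) auto
  ultimately show ?thesis by (auto simp: entry_def fps_mult_nth_0 numeral_fps_const)
qed

text \<open>Row \<open>i\<close> belongs to a particle at site \<open>l i\<close>, column
  \<open>j\<close> to the fixed vector of \<open>h - j\<close>. The factor \<open>fps_exp 1\<close>
  is the pairing of the point at infinity with \<open>Some 0\<close>; its derivative yields the
  stationary weight 1 for odd \<open>a\<close>.\<close>

definition rows_det :: "(nat \<Rightarrow> int) \<Rightarrow> rat fps" where
  "rows_det l = (if odd a then fps_exp 1 else 1) * det (mat h h (\<lambda>(i, j). entry (l i) (h - j)))"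

lemma rows_det_deriv:
  "fps_deriv (rows_det l) = of_bool (odd a) * rows_det l
     + (\<Sum>i<h. rows_det (l(i := l i + 1)) + rows_det (l(i := l i - 1)))"
  using det_rows_deriv[of "\<lambda>k j. entry k (h - j)" h l, OF entry_deriv]
  by (auto simp: rows_det_def sum_distrib_left distrib_left simp del: fun_upd_apply)

lemma rows_det_identical: "i < h \<Longrightarrow> k < h \<Longrightarrow> i \<noteq> k \<Longrightarrow> l i = l k \<Longrightarrow> rows_det l = 0"
  unfolding rows_det_def by (subst det_identical_rows[of _ h i k]) (auto simp: row_def)

lemma rows_det_replace:
  assumes "i < h" "\<And>j. entry (l i) j = c * entry k j"
  shows "rows_det l = c * rows_det (l(i := k))"
  unfolding rows_det_def using assms
  by (subst det_row_scale[of i h _ c "\<lambda>i' j. entry ((l(i := k)) i') (h - j)"]) auto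

definition part_pos :: "(nat \<Rightarrow> nat) \<Rightarrow> nat \<Rightarrow> int" where
  "part_pos lam i = int (lam i) + int h - int i"

definition stay_weight :: "(nat \<Rightarrow> nat) \<Rightarrow> int" where
  "stay_weight lam = 1 - of_bool (even a \<and> 0 < lam (h - 1)) - of_bool (even b \<and> lam 0 = w)"

text \<open>A step up that leaves the box is either a collision, which makes two rows equal, or a
  step of the first particle beyond site \<open>h + w\<close>, where \<open>entry_top\<close>
  applies.\<close>

lemma rows_det_up:
  assumes lam: "in_box h w lam" and i: "i < h"
  shows "rows_det ((part_pos lam)(i := part_pos lam i + 1)) =
    (if in_box h w (lam(i := Suc (lam i))) then rows_det (part_pos (lam(i := Suc (lam i)))) else 0)
    - (if i = 0 \<and> even b \<and> lam 0 = w then rows_det (part_pos lam) else 0)"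
proof (cases "in_box h w (lam(i := Suc (lam i)))")
  case True
  then have "\<not> (i = 0 \<and> lam 0 = w)" by (auto simp: in_box_def)
  moreover have "(part_pos lam)(i := part_pos lam i + 1) = part_pos (lam(i := Suc (lam i)))"
    by (auto simp: part_pos_def fun_eq_iff)
  ultimately show ?thesis using True by auto
next
  case False
  show ?thesis
  proof (cases "i = 0")
    case True
    have l0: "lam 0 = w"
    proof (rule ccontr)
      assume "lam 0 \<noteq> w"
      then have "in_box h w (lam(i := Suc (lam i)))"
        using lam True hw by (auto simp: in_box_def le_SucI)
      then show False using False by simp
    qed
    let ?l = "(part_pos lam)(0 := part_pos lam 0 + 1)"
    have p0: "part_pos lam 0 = int (h + w)" by (simp add: part_pos_def l0)
    have "rows_det ?l = - of_bool (even b) * rows_det (?l(0 := int (h + w)))"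
      by (rule rows_det_replace) (use hw p0 entry_top in auto)
    also have "?l(0 := int (h + w)) = part_pos lam" using p0 by auto
    finally show ?thesis using False True l0 by (simp del: fun_upd_apply)
  next
    case i0: False
    have "lam i = lam (i - 1)"
    proof (rule ccontr)
      assume "lam i \<noteq> lam (i - 1)"
      then have "lam i < lam (i - 1)"
        using lam i0 by (metis Suc_pred' bot_nat_0.not_eq_extremum in_box_def le_neq_implies_less)
      then have "Suc (lam i) \<le> lam k" if "Suc k = i" for k
        using that by auto
      then have "in_box h w (lam(i := Suc (lam i)))"
        using lam i i0 unfolding in_box_def by (simp add: le_SucI)
      then show False using False by simp
    qed
    moreover have "int (i - 1) = int i - 1" using i0 by simp
    ultimately have "part_pos lam i + 1 = part_pos lam (i - 1)" by (simp add: part_pos_def)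
    then have "rows_det ((part_pos lam)(i := part_pos lam i + 1)) = 0"
      using i i0 by (intro rows_det_identical[of i "i - 1"]) simp_all
    then show ?thesis using False i0 by simp
  qed
qed

lemma in_box_remove:
  assumes lam: "in_box h w lam" and lt: "lam (Suc i) < lam i"
  shows "in_box h w (lam(i := lam i - 1))"
proof -
  have 1: "(lam(i := lam i - 1)) k \<le> lam k" for k by simp
  have 2: "lam (Suc k) \<le> (lam(i := lam i - 1)) k" for k
    using lam lt by (auto simp: in_box_def)
  show ?thesis
    unfolding in_box_def
  proof (intro conjI allI)
    show "(lam(i := lam i - 1)) (Suc k) \<le> (lam(i := lam i - 1)) k" for k
      using 1[of "Suc k"] 2[of k] by (rule order_trans)
    show "(lam(i := lam i - 1)) h = 0" "(lam(i := lam i - 1)) 0 \<le> w"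
      using 1[of h] 1[of 0] lam by (auto simp: in_box_def simp del: fun_upd_apply)
  qed
qed

text \<open>The only step down that leaves the box without a collision is that of the last particle
  from site 1, where \<open>entry_0\<close> applies.\<close>

lemma rows_det_down:
  assumes lam: "in_box h w lam" and i: "i < h"
  shows "rows_det ((part_pos lam)(i := part_pos lam i - 1)) =
    (if 0 < lam i \<and> in_box h w (lam(i := lam i - 1)) then rows_det (part_pos (lam(i := lam i - 1))) else 0)
    + (if i = h - 1 \<and> even a \<and> lam (h - 1) = 0 then rows_det (part_pos lam) else 0)"
proof (cases "0 < lam i \<and> in_box h w (lam(i := lam i - 1))")
  case True
  then have "(part_pos lam)(i := part_pos lam i - 1) = part_pos (lam(i := lam i - 1))"
    by (auto simp: part_pos_def fun_eq_iff)
  then show ?thesis using True by auto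
next
  case False
  show ?thesis
  proof (cases "i = h - 1")
    case True
    have l0: "lam i = 0"
    proof (rule ccontr)
      assume l: "lam i \<noteq> 0"
      have "lam (Suc i) = 0" using True lam hw by (simp add: in_box_def)
      then have "in_box h w (lam(i := lam i - 1))"
        using lam l by (intro in_box_remove) auto
      then show False using False l by simp
    qed
    let ?l = "(part_pos lam)(i := part_pos lam i - 1)"
    have p1: "part_pos lam i = 1" using True l0 hw by (simp add: part_pos_def of_nat_diff)
    have "rows_det ?l = of_bool (even a) * rows_det (?l(i := 1))"
      by (rule rows_det_replace) (use i p1 entry_0 in auto)
    also have "?l(i := 1) = part_pos lam" using p1 by auto
    finally show ?thesis using False True l0 by (simp del: fun_upd_apply)
  next
    case ih: False
    have "lam (Suc i) = lam i"
    proof (rule ccontr)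
      assume "lam (Suc i) \<noteq> lam i"
      then have lt: "lam (Suc i) < lam i" using lam by (simp add: in_box_def le_neq_implies_less)
      then have "in_box h w (lam(i := lam i - 1))"
        using lam by (intro in_box_remove)
      then show False using False lt by simp
    qed
    then have "part_pos lam i - 1 = part_pos lam (Suc i)" by (simp add: part_pos_def)
    then have "rows_det ((part_pos lam)(i := part_pos lam i - 1)) = 0"
      using i ih by (intro rows_det_identical[of i "Suc i"]) simp_all
    then show ?thesis using False ih by (auto simp del: fun_upd_apply)
  qed
qed

text \<open>The stationary terms add up to \<open>[a odd] + [a even and lam (h - 1) = 0] -
  [b even and lam 0 = w]\<close>, from the exponential factor, the lower wall and the upper wall;
  this is \<open>stay_weight lam\<close>.\<close>

lemma rows_det_deriv_box:
  assumes lam: "in_box h w lam"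
  shows "fps_deriv (rows_det (part_pos lam)) = of_int (stay_weight lam) * rows_det (part_pos lam)
    + (\<Sum>i | i < h \<and> in_box h w (lam(i := Suc (lam i))). rows_det (part_pos (lam(i := Suc (lam i)))))
    + (\<Sum>i | i < h \<and> 0 < lam i \<and> in_box h w (lam(i := lam i - 1)). rows_det (part_pos (lam(i := lam i - 1))))"
proof -
  let ?l = "part_pos lam"
  have f: "(\<Sum>i<h. if P i then g i else 0) = (\<Sum>i | i < h \<and> P i. g i)" for P and g :: "nat \<Rightarrow> rat fps"
    by (simp add: sum.inter_filter[symmetric] lessThan_def)
  have up: "(\<Sum>i<h. rows_det (?l(i := ?l i + 1))) =
    (\<Sum>i | i < h \<and> in_box h w (lam(i := Suc (lam i))). rows_det (part_pos (lam(i := Suc (lam i)))))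
    - (if even b \<and> lam 0 = w then rows_det ?l else 0)"
  proof -
    have "(\<Sum>i<h. rows_det (?l(i := ?l i + 1))) =
      (\<Sum>i<h. (if in_box h w (lam(i := Suc (lam i))) then rows_det (part_pos (lam(i := Suc (lam i)))) else 0)
         - (if i = 0 then if even b \<and> lam 0 = w then rows_det ?l else 0 else 0))"
      using rows_det_up[OF lam] by (intro sum.cong) (auto simp del: fun_upd_apply)
    then show ?thesis
      unfolding sum_subtractf f[of "\<lambda>i. in_box h w (lam(i := Suc (lam i)))"] using hw by simp
  qed
  have down: "(\<Sum>i<h. rows_det (?l(i := ?l i - 1))) =
    (\<Sum>i | i < h \<and> 0 < lam i \<and> in_box h w (lam(i := lam i - 1)). rows_det (part_pos (lam(i := lam i - 1))))
    + (if even a \<and> lam (h - 1) = 0 then rows_det ?l else 0)"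
  proof -
    have "(\<Sum>i<h. rows_det (?l(i := ?l i - 1))) =
      (\<Sum>i<h. (if 0 < lam i \<and> in_box h w (lam(i := lam i - 1)) then rows_det (part_pos (lam(i := lam i - 1))) else 0)
         + (if i = h - 1 then if even a \<and> lam (h - 1) = 0 then rows_det ?l else 0 else 0))"
      using rows_det_down[OF lam] by (intro sum.cong) (auto simp del: fun_upd_apply)
    then show ?thesis
      unfolding sum.distrib f[of "\<lambda>i. 0 < lam i \<and> in_box h w (lam(i := lam i - 1))"] using hw by simp
  qed
  show ?thesis
    unfolding rows_det_deriv sum.distrib up down by (auto simp: stay_weight_def algebra_simps)
qed

text \<open>For the empty partition the matrix is lower triangular with 2 on the diagonal. Otherwise
  the first particle lies above site \<open>h\<close>, and its row vanishes.\<close>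

lemma rows_det_nth_0:
  assumes lam: "in_box h w lam"
  shows "fps_nth (rows_det (part_pos lam)) 0 = 2 ^ h * of_bool (lam = (\<lambda>_. 0))"
proof -
  have mono: "lam j \<le> lam i" if "i \<le> j" for i j
    using antimono_le[of lam, OF _ that] lam by (auto simp: in_box_def)
  have l: "0 < part_pos lam i" "part_pos lam i \<le> int (h + w)" if "i < h" for i
    using that mono[of 0 i] lam by (auto simp: part_pos_def in_box_def)
  have "fps_nth (rows_det (part_pos lam)) 0 = det (mat h h (\<lambda>(i, j). fps_nth (entry (part_pos lam i) (h - j)) 0))"
    by (simp add: rows_det_def det_mat_nth_0)
  also have "mat h h (\<lambda>(i, j). fps_nth (entry (part_pos lam i) (h - j)) 0) = mat h h (\<lambda>(i, j).
      (if part_pos lam i < int (h - j) then 4 else if part_pos lam i = int (h - j) then 2 else 0))"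
    using l by (intro eq_matI) (auto simp: entry_nth_0)
  also have "det \<dots> = 2 ^ h * of_bool (lam = (\<lambda>_. 0))"
  proof (cases "lam = (\<lambda>_. 0)")
    case True
    have "det (mat h h (\<lambda>(i, j). (if part_pos lam i < int (h - j) then 4 else if part_pos lam i = int (h - j) then 2 else 0)))
        = (\<Prod>i = 0..<h. 2 :: rat)"
      by (subst det_lower_triangular[of h]) (auto simp: True part_pos_def prod_list_diag_prod of_nat_diff)
    then show ?thesis using True by simp
  next
    case False
    have "lam 0 \<noteq> 0"
    proof
      assume "lam 0 = 0"
      then have "lam = (\<lambda>_. 0)" using mono[of 0] by (auto simp: fun_eq_iff)
      then show False using False by simp
    qed
    then have *: "int h < part_pos lam 0" by (simp add: part_pos_def)
    have "det (mat h h (\<lambda>(i, j). (if part_pos lam i < int (h - j) then 4 else if part_pos lam i = int (h - j) then 2 else 0))) = (0 :: rat)"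
      unfolding det_mat
    proof (intro sum.neutral ballI)
      fix p
      have "(\<Prod>i = 0..<h. if part_pos lam i < int (h - p i) then 4 else if part_pos lam i = int (h - p i) then 2 else 0) = (0 :: rat)"
        by (rule prod_zero) (use hw * in \<open>auto intro!: bexI[of _ 0]\<close>)
      then show "signof p * (\<Prod>i = 0..<h. if part_pos lam i < int (h - p i) then 4 else if part_pos lam i = int (h - p i) then 2 else 0) = (0 :: rat)"
        by simp
    qed
    then show ?thesis using False by simp
  qed
  finally show ?thesis .
qed

lemma rows_det_box_walks:
  assumes "in_box h w lam"
  shows "fps_nth (rows_det (part_pos lam)) n * fact n = 2 ^ h * of_int (box_walks h w stay_weight n lam)"
  using assms
proof (induction n arbitrary: lam)
  case 0
  then show ?case by (simp add: rows_det_nth_0)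
next
  case (Suc n)
  show ?case unfolding fps_nth_Suc_fact rows_det_deriv_box[OF Suc.prems]
    using Suc.IH Suc.prems
    by (simp add: fps_sum_nth fps_nth_of_int_mult distrib_left distrib_right sum_distrib_left sum_distrib_right mult.assoc
        del: fps_mult_nth fun_upd_apply)
qed

end

section \<open>Comparison of the two kinds of walks\<close>

context alcove_box
begin

definition pairing :: "(int \<times> int option) list \<Rightarrow> (int \<times> int option) list \<Rightarrow> rat fps" where
  "pairing vs us = (\<Sum>(c, g)\<leftarrow>vs. of_int c * (\<Sum>(d, g')\<leftarrow>us. of_int d * form g g'))"

text \<open>The vectors \<open>moving p\<close> span one isotropic subspace, the vectors \<open>fixed q\<close> another one.\<close>

definition moving :: "int \<Rightarrow> (int \<times> int option) list" where
  "moving p = (if even a then [(1, Some (p - 1)), (1, Some (- p))] else [(1, Some p), (- 1, Some (- p))])"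

text \<open>For odd \<open>a\<close> the term at 0 makes the coefficients sum to 0, so that the
  vector is orthogonal to the point at infinity.\<close>

definition fixed :: "int \<Rightarrow> (int \<times> int option) list" where
  "fixed q = (if even a then [(1, Some (q - 1)), (- 1, Some (- q))]
     else [(1, Some q), (1, Some (- q)), (- 2, Some 0)])"

text \<open>The first \<open>half\<close> vectors span one isotropic subspace and the last
  \<open>half\<close> the other. For odd \<open>a\<close> the point at infinity completes the moving
  vectors and the centre \<open>Some 0\<close> the fixed ones.\<close>

definition basis :: "nat \<Rightarrow> (int \<times> int option) list" where
  "basis j = (if j < h then moving (int (h - j)) else if j < half then [(1, None)]
     else if j < half + h then fixed (int (h - (j - half))) else [(1, Some 0)])"

lemma kernel_differences:
  "kernel (q - 1 - (p - 1)) = kernel (q - p)"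
  "kernel (- q - (p - 1)) = - kernel (q + p - 1)"
  "kernel (q - 1 - (- p)) = kernel (q + p - 1)"
  "kernel (- q - (- p)) = - kernel (q - p)"
  "kernel (- q - p) = - kernel (q + p)"
  "kernel (q - (- p)) = kernel (q + p)"
  "kernel (0 - p) = - kernel p"
  "kernel (q - 0) = kernel q"
proof -
  have "q - 1 - (p - 1) = q - p" "- q - (p - 1) = - (q + p - 1)" "q - 1 - (- p) = q + p - 1"
    "- q - (- p) = - (q - p)" "- q - p = - (q + p)" "q - (- p) = q + p" "0 - p = - p" by simp_all
  then show "kernel (q - 1 - (p - 1)) = kernel (q - p)"
    "kernel (- q - (p - 1)) = - kernel (q + p - 1)"
    "kernel (q - 1 - (- p)) = kernel (q + p - 1)"
    "kernel (- q - (- p)) = - kernel (q - p)"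
    "kernel (- q - p) = - kernel (q + p)"
    "kernel (q - (- p)) = kernel (q + p)"
    "kernel (0 - p) = - kernel p"
    "kernel (q - 0) = kernel q"
    by (simp_all only: kernel_minus diff_zero)
qed

text \<open>Reflecting the positions reverses all differences, and \<open>kernel\<close> is odd, so
  the reflection changes the sign of \<open>form\<close> on finite generators. Two vectors of the
  same parity under the reflection must then pair to 0; the same holds for the fixed
  vectors.\<close>

lemma pairing_moving_moving: "pairing (moving p) (moving q) = 0"
  by (auto simp only: pairing_def moving_def if_True if_False list.map sum_list.Cons sum_list.Nil prod.case
      form.simps kernel_differences split: if_split)
    (simp_all add: algebra_simps kernel_swap[of p q] kernel_minus)

lemma pairing_fixed_fixed: "pairing (fixed p) (fixed q) = 0"
  by (auto simp only: pairing_def fixed_def if_True if_False list.map sum_list.Cons sum_list.Nil prod.case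
      form.simps kernel_differences split: if_split)
    (simp_all add: algebra_simps kernel_swap[of p q] kernel_minus)

lemma pairing_moving_fixed: "pairing (moving p) (fixed (int q)) = entry p q"
  by (auto simp only: pairing_def moving_def fixed_def if_True if_False list.map sum_list.Cons sum_list.Nil prod.case
      form.simps kernel_differences entry_def split: if_split)
    (simp_all add: algebra_simps kernel_swap[of p "int q"] kernel_minus)

lemma pairing_extra:
  "odd a \<Longrightarrow> pairing (moving p) [(1, None)] = 0"
  "odd a \<Longrightarrow> pairing [(1, None)] (moving p) = 0"
  "pairing [(1, None)] [(1, None)] = 0"
  "odd a \<Longrightarrow> pairing (fixed p) [(1, Some 0)] = 0"
  "odd a \<Longrightarrow> pairing [(1, Some 0)] (fixed p) = 0"
  "pairing [(1, Some 0)] [(1, Some 0)] = 0"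
  "odd a \<Longrightarrow> pairing [(1, None)] (fixed p) = 0"
  "pairing [(1, None)] [(1, Some 0)] = fps_exp 1"
  by (simp_all add: pairing_def moving_def fixed_def kernel_minus)

text \<open>Every generator that occurs in \<open>basis\<close> is an initial position or the point
  at infinity, and the coefficients are integers. The change of basis therefore costs only an
  integer determinant.\<close>

lemma pf_basis:
  "pfsum half (\<lambda>i j. pairing (basis i) (basis j))
     = of_int (det (mat (2 * half) (2 * half) (\<lambda>(i, j). coeff_at (basis j) (gens (pos (\<lambda>_. 0)) i)))) * pf (pos (\<lambda>_. 0))"
proof -
  let ?g = "gens (pos (\<lambda>_. 0))"
  have inj: "inj_on ?g {0..<2 * half}"
    by (rule inj_onI) (auto simp: gens_def pos_def half split: if_splits)
  have Some: "Some p \<in> ?g ` {0..<2 * half}"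
    if "p \<le> (if odd a then int h else int h - 1)" "- int h \<le> p" for p
  proof (rule image_eqI)
    let ?i = "nat ((if odd a then int h else int h - 1) - p)"
    show "?i \<in> {0..<2 * half}" "Some p = ?g ?i"
      using that a_cases by (auto simp: gens_def pos_def)
  qed
  have None: "None \<in> ?g ` {0..<2 * half}" if "odd a"
    by (rule image_eqI[of _ _ a]) (use that in \<open>auto simp: gens_def half\<close>)
  have img: "snd ` set (basis j) \<subseteq> ?g ` {0..<2 * half}" for j
  proof (cases "j < h \<or> half \<le> j")
    case True
    then have "\<exists>p. g = Some p \<and> p \<le> (if odd a then int h else int h - 1) \<and> - int h \<le> p"
      if "g \<in> snd ` set (basis j)" for g
      using that hw by (auto simp: basis_def moving_def fixed_def split: if_splits)
    then show ?thesis using Some by (intro subsetI) metis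
  next
    case False
    then have "odd a" "basis j = [(1, None)]" using half(2) by (auto simp: basis_def split: if_splits)
    then show ?thesis using None by simp
  qed
  let ?B = "\<lambda>i j. of_int (coeff_at (basis j) (?g i)) :: rat fps"
  have "pairing (basis i) (basis j) = (\<Sum>k = 0..<2 * half. \<Sum>l = 0..<2 * half. ?B k i * form (?g k) (?g l) * ?B l j)"
    for i j
  proof -
    have "pairing (basis i) (basis j) = (\<Sum>(c, g)\<leftarrow>basis i. of_int c * (\<Sum>l = 0..<2 * half. ?B l j * form g (?g l)))"
      unfolding pairing_def sum_coeff_at[OF inj img] ..
    also have "\<dots> = (\<Sum>k = 0..<2 * half. ?B k i * (\<Sum>l = 0..<2 * half. ?B l j * form (?g k) (?g l)))"
      by (rule sum_coeff_at[OF inj img, symmetric])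
    finally show ?thesis by (simp add: sum_distrib_left mult_ac)
  qed
  then have "pfsum half (\<lambda>i j. pairing (basis i) (basis j))
      = pfsum half (\<lambda>i j. \<Sum>k = 0..<2 * half. \<Sum>l = 0..<2 * half. ?B k i * form (?g k) (?g l) * ?B l j)"
    by (intro pfsum_cong)
  also have "\<dots> = det (mat (2 * half) (2 * half) (\<lambda>(i, j). ?B i j)) * pf (pos (\<lambda>_. 0))"
    unfolding pf_def by (rule pfsum_congruence)
  also have "det (mat (2 * half) (2 * half) (\<lambda>(i, j). ?B i j)) =
      of_int (det (mat (2 * half) (2 * half) (\<lambda>(i, j). coeff_at (basis j) (?g i))))"
    by (simp add: det_mat)
  finally show ?thesis .
qed

lemma pairing_skew: "pairing vs us = - pairing us vs"
proof -
  have list: "(\<Sum>(c, g)\<leftarrow>vs. of_int c * F g + G c g) = (\<Sum>(c, g)\<leftarrow>vs. of_int c * F g) + (\<Sum>(c, g)\<leftarrow>vs. G c g)"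
    for vs :: "(int \<times> int option) list" and F and G :: "_ \<Rightarrow> _ \<Rightarrow> rat fps"
    by (induction vs) (auto simp: algebra_simps)
  have one: "(\<Sum>(d, g')\<leftarrow>us. of_int d * (of_int c * form g' g)) = - (of_int c * (\<Sum>(d, g')\<leftarrow>us. of_int d * form g g'))"
    for c g us
  proof (induction us)
    case (Cons u us)
    then show ?case using form_skew[of "snd u" g] by (cases u) (simp add: algebra_simps)
  qed simp
  show ?thesis
  proof (induction vs)
    case Nil
    have "pairing us [] = 0" by (induction us) (auto simp: pairing_def)
    then show ?case by (simp add: pairing_def)
  next
    case (Cons v vs)
    obtain c g where v: "v = (c, g)" by (cases v)
    have "pairing us (v # vs) = (\<Sum>(d, g')\<leftarrow>us. of_int d * (of_int c * form g' g)) + pairing us vs"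
      unfolding pairing_def v by (induction us) (auto simp: algebra_simps)
    moreover have "pairing (v # vs) us = of_int c * (\<Sum>(d, g')\<leftarrow>us. of_int d * form g g') + pairing vs us"
      by (simp add: pairing_def v)
    ultimately show ?case using Cons one[where c = c and g = g and us = us] by simp
  qed
qed

text \<open>For odd \<open>a\<close> the off-diagonal block has one more row and column. The point
  at infinity is orthogonal to the fixed vectors, so this block is triangular and its corner
  contributes the factor \<open>fps_exp 1\<close> of \<open>rows_det\<close>.\<close>

lemma pf_basis_split:
  "pfsum half (\<lambda>i j. pairing (basis i) (basis j)) = rows_det (part_pos (\<lambda>_. 0)) * pfsum half (symplectic half)"
proof -
  let ?W = "\<lambda>i j. pairing (basis i) (basis (j + half))"
  have "pfsum half (\<lambda>i j. pairing (basis i) (basis j)) = det (mat half half (\<lambda>(i, j). ?W i j)) * pfsum half (symplectic half)"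
  proof (rule pfsum_split)
    fix i j assume ij: "i < half" "j < half"
    show "pairing (basis i) (basis j) = 0"
      using ij half(2) by (auto simp: basis_def pairing_moving_moving pairing_extra split: if_splits)
    show "pairing (basis (i + half)) (basis (j + half)) = 0"
      using ij half(2) by (auto simp: basis_def pairing_fixed_fixed pairing_extra split: if_splits)
  qed (rule refl pairing_skew)+
  moreover have W: "?W i j = entry (part_pos (\<lambda>_. 0) i) (h - j)" if "i < h" "j < h" for i j
  proof -
    have "int (h - i) = part_pos (\<lambda>_. 0) i" using that by (simp add: part_pos_def)
    then show ?thesis
      using that half(2) by (simp add: basis_def pairing_moving_fixed del: of_nat_diff)
  qed
  have "det (mat half half (\<lambda>(i, j). ?W i j)) = rows_det (part_pos (\<lambda>_. 0))"
  proof (cases "odd a")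
    case False
    have "mat h h (\<lambda>(i, j). ?W i j) = mat h h (\<lambda>(i, j). entry (part_pos (\<lambda>_. 0) i) (h - j))"
      using W by (intro eq_matI) auto
    then show ?thesis using False half(2) by (simp add: rows_det_def)
  next
    case True
    let ?M = "mat h h (\<lambda>(i, j). entry (part_pos (\<lambda>_. 0) i) (h - j))"
    let ?F = "four_block_mat ?M (mat h 1 (\<lambda>(i, j). ?W i h)) (0\<^sub>m 1 h) (mat 1 1 (\<lambda>_. fps_exp 1))"
    have "?W h j = (if j < h then 0 else fps_exp 1)" if "j < h + 1" for j
      using that True half(2) by (auto simp: basis_def pairing_extra)
    then have "mat half half (\<lambda>(i, j). ?W i j) = ?F"
      using True half(2) W by (intro eq_matI) (auto simp: less_Suc_eq)
    moreover have "det ?F = det ?M * det (mat 1 1 (\<lambda>_. fps_exp 1 :: rat fps))"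
      by (rule det_four_block_mat_lower_left_zero) auto
    ultimately show ?thesis using True by (simp add: rows_det_def det_single)
  qed
  ultimately show ?thesis by simp
qed

theorem alcove_walks_eq_box_walks:
  "int (alcove_walks a b n (\<lambda>_. 0)) = box_walks h w stay_weight n (\<lambda>_. 0)"
proof -
  let ?z = "\<lambda>_::nat. 0::nat"
  define d where "d = det (mat (2 * half) (2 * half) (\<lambda>(i, j). coeff_at (basis j) (gens (pos ?z) i)))"
  define s :: int where "s = pfsum half (symplectic half)"
  define k where "k = fps_nth (pf (pos ?z)) 0"
  \<comment> \<open>The constants \<open>d\<close>, \<open>k\<close> and \<open>s\<close> need not be computed: comparing constant terms gives \<open>d k = s 2\<^sup>h\<close>.\<close>
  have eq: "of_int d * pf (pos ?z) = of_int s * rows_det (part_pos ?z)"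
    using pf_basis pf_basis_split pfsum_symplectic_of_int[of half, where 'a = "rat fps"]
    by (simp add: d_def s_def mult.commute)
  have coeffs: "of_int d * (k * of_nat (alcove_walks a b n ?z)) = of_int s * (2 ^ h * of_int (box_walks h w stay_weight n ?z))" for n
  proof -
    have "in_alcove a b ?z" "in_box h w ?z" by (auto simp: in_alcove_def in_box_def)
    then have "of_int d * (k * of_nat (alcove_walks a b n ?z)) = fps_nth (of_int d * pf (pos ?z)) n * fact n"
      "of_int s * (2 ^ h * of_int (box_walks h w stay_weight n ?z)) = fps_nth (of_int s * rows_det (part_pos ?z)) n * fact n"
      unfolding k_def by (simp_all only: pf_alcove_walks[symmetric] rows_det_box_walks[symmetric] fps_nth_of_int_mult mult.assoc)
    then show ?thesis by (simp only: eq)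
  qed
  have "s \<noteq> 0" unfolding s_def by (rule pfsum_symplectic_nonzero)
  moreover have dk: "of_int d * k = of_int s * 2 ^ h"
    using coeffs[of 0] by simp
  ultimately have "(of_int (int (alcove_walks a b n ?z)) :: rat) = of_int (box_walks h w stay_weight n ?z)"
    using coeffs[of n] unfolding mult.assoc[symmetric] dk by simp
  then show ?thesis by (simp only: of_int_eq_iff)
qed

end

section \<open>Row insertion\<close>

abbreviation below :: "nat set \<Rightarrow> nat \<Rightarrow> nat" where
  "below R v \<equiv> card (R \<inter> {..<v})"

definition dominates :: "nat set \<Rightarrow> nat set \<Rightarrow> bool" where
  "dominates R S \<longleftrightarrow> (\<forall>v. below S v \<le> below R v)"

definition first_row :: "nat set list \<Rightarrow> nat set" where
  "first_row T = (case T of [] \<Rightarrow> {} | R # Rs \<Rightarrow> R)"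

lemma first_row_simps [simp]: "first_row [] = {}" "first_row (R # Rs) = R"
  by (simp_all add: first_row_def)

text \<open>A standard tableau is the list of its rows. The entries of a row are increasing, so that a row
  may be given as a set, and strict increase along columns becomes \<open>dominates\<close>.\<close>

fun tableau :: "nat set list \<Rightarrow> bool" where
  "tableau [] \<longleftrightarrow> True"
| "tableau (R # Rs) \<longleftrightarrow> finite R \<and> R \<noteq> {} \<and> R \<inter> \<Union>(set Rs) = {} \<and> dominates R (first_row Rs) \<and> tableau Rs"

definition bumped :: "nat \<Rightarrow> nat set \<Rightarrow> nat" where
  "bumped x R = Min {y \<in> R. x < y}"

definition bump_row :: "nat \<Rightarrow> nat set \<Rightarrow> nat set" where
  "bump_row x R = insert x (if \<exists>y\<in>R. x < y then R - {bumped x R} else R)"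

fun row_insert :: "nat \<Rightarrow> nat set list \<Rightarrow> nat set list" where
  "row_insert x [] = [{x}]"
| "row_insert x (R # Rs) = bump_row x R # (if \<exists>y\<in>R. x < y then row_insert (bumped x R) Rs else Rs)"

lemma bumped:
  assumes "finite R" "\<exists>y\<in>R. x < y"
  shows "bumped x R \<in> R" "x < bumped x R" "\<And>z. z \<in> R \<Longrightarrow> x < z \<Longrightarrow> bumped x R \<le> z"
proof -
  have "finite {y \<in> R. x < y}" "{y \<in> R. x < y} \<noteq> {}" using assms by auto
  from Min_in[OF this] show "bumped x R \<in> R" "x < bumped x R" by (auto simp: bumped_def)
  show "bumped x R \<le> z" if "z \<in> R" "x < z" for z
    using that assms by (auto simp: bumped_def intro!: Min_le)
qed

lemma bumped_eq:
  assumes "finite R" "y \<in> R" "x < y" "\<And>z. z \<in> R \<Longrightarrow> x < z \<Longrightarrow> y \<le> z"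
  shows "bumped x R = y"
  unfolding bumped_def using assms by (intro Min_eqI) auto

lemma first_row_insert: "first_row (row_insert x T) = bump_row x (first_row T)"
  by (cases T) (auto simp: bump_row_def)

lemma finite_first_row: "tableau T \<Longrightarrow> finite (first_row T)"
  by (cases T) auto

lemma first_row_subset: "first_row T \<subseteq> \<Union>(set T)"
  by (cases T) auto

lemma below_insert: "finite R \<Longrightarrow> x \<notin> R \<Longrightarrow> below (insert x R) v = below R v + of_bool (x < v)"
  by (simp add: Int_insert_left)

lemma below_remove: "finite R \<Longrightarrow> x \<in> R \<Longrightarrow> below R v = below (R - {x}) v + of_bool (x < v)"
  using below_insert[of "R - {x}" x v] by (simp add: insert_absorb)

lemma below_mono: "finite R \<Longrightarrow> u \<le> v \<Longrightarrow> below R u \<le> below R v"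
  by (rule card_mono) auto

lemma below_gap: "(\<And>z. z \<in> R \<Longrightarrow> u \<le> z \<Longrightarrow> v \<le> z) \<Longrightarrow> u \<le> v \<Longrightarrow> below R v = below R u"
  by (rule arg_cong[of _ _ card]) (auto, meson leD leI)

text \<open>The count rises by one exactly for thresholds above \<open>x\<close> and up to the
  bumped entry. Domination arguments then reduce to comparing such increments.\<close>

lemma below_bump_row:
  assumes "finite R" "x \<notin> R"
  shows "below (bump_row x R) v = below R v + of_bool (x < v \<and> \<not> (\<exists>y\<in>R. x < y \<and> y < v))"
proof (cases "\<exists>y\<in>R. x < y")
  case True
  note b = bumped[OF assms(1) True]
  have "bumped x R < v \<longleftrightarrow> (\<exists>y\<in>R. x < y \<and> y < v)"
    using b by (meson le_less_trans)
  then show ?thesis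
    using True assms b below_insert[of "R - {bumped x R}" x v] below_remove[of R "bumped x R" v]
    by (auto simp: bump_row_def)
next
  case False
  then show ?thesis using assms by (auto simp: bump_row_def below_insert)
qed

lemma below_large: "finite R \<Longrightarrow> (\<And>z. z \<in> R \<Longrightarrow> z < v) \<Longrightarrow> below R v = card R"
  by (rule arg_cong[of _ _ card]) auto

lemma dominates_card:
  assumes "dominates R S" "finite R" "finite S"
  shows "card S \<le> card R"
proof -
  define v where "v = Suc (Max (insert 0 (R \<union> S)))"
  have "z < v" if "z \<in> R \<union> S" for z
    using that assms by (auto simp: v_def less_Suc_eq_le intro!: Max_ge)
  then have "below R v = card R" "below S v = card S"
    using assms by (auto intro!: below_large)
  then show ?thesis using assms(1) by (metis dominates_def)
qed

text \<open>The lower row gains only at thresholds above the bumped entry \<open>y\<close> and up to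
  the next entry of \<open>S\<close>. There \<open>S\<close> has no more entries than it has below
  \<open>y\<close>, whereas \<open>R\<close> also counts \<open>y\<close> itself, which leaves room
  for one more.\<close>

lemma dominates_bump:
  assumes "finite R" "finite S" "x \<notin> R" "bumped x R \<notin> S" "\<exists>y\<in>R. x < y" "dominates R S"
  shows "dominates (bump_row x R) (bump_row (bumped x R) S)"
  unfolding dominates_def
proof
  fix v
  let ?y = "bumped x R"
  note b = bumped[OF assms(1,5)]
  have "below S v + 1 \<le> below R v" if "?y < v" "\<not> (\<exists>y\<in>S. ?y < y \<and> y < v)"
  proof -
    have "below S v = below S ?y"
      using that assms(4) by (intro below_gap) (metis le_neq_implies_less not_less, simp)
    also have "\<dots> \<le> below R ?y" using assms(6) by (simp add: dominates_def)
    also have "\<dots> = below (R - {?y}) ?y" using below_remove[OF assms(1) b(1), of ?y] by simp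
    also have "\<dots> \<le> below (R - {?y}) v" using that assms(1) by (intro below_mono) auto
    finally show ?thesis using below_remove[OF assms(1) b(1), of v] that by simp
  qed
  then show "below (bump_row ?y S) v \<le> below (bump_row x R) v"
    using assms(6) unfolding below_bump_row[OF assms(1,3)] below_bump_row[OF assms(2,4)] dominates_def
    by (auto simp: of_bool_def intro: le_SucI)
qed

lemma entries_insert:
  "tableau T \<Longrightarrow> x \<notin> \<Union>(set T) \<Longrightarrow> \<Union>(set (row_insert x T)) = insert x (\<Union>(set T))"
proof (induction T arbitrary: x)
  case (Cons R Rs)
  show ?case
  proof (cases "\<exists>y\<in>R. x < y")
    case True
    note b = bumped[of R x, OF _ True]
    have "\<Union>(set (row_insert (bumped x R) Rs)) = insert (bumped x R) (\<Union>(set Rs))"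
      using Cons b(1) by (intro Cons.IH) auto
    then show ?thesis using True Cons.prems b(1) by (auto simp: bump_row_def)
  qed (auto simp: bump_row_def)
qed simp

lemma tableau_insert: "tableau T \<Longrightarrow> x \<notin> \<Union>(set T) \<Longrightarrow> tableau (row_insert x T)"
proof (induction T arbitrary: x)
  case Nil
  show ?case by (simp add: dominates_def)
next
  case (Cons R Rs)
  then have fin: "finite R" "finite (first_row Rs)" "x \<notin> R" by (auto simp: finite_first_row)
  show ?case
  proof (cases "\<exists>y\<in>R. x < y")
    case True
    let ?y = "bumped x R"
    note b = bumped[OF fin(1) True]
    have y: "?y \<notin> \<Union>(set Rs)" using Cons.prems b(1) by auto
    then have "?y \<notin> first_row Rs" using first_row_subset by blast
    then have "dominates (bump_row x R) (first_row (row_insert ?y Rs))"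
      unfolding first_row_insert using fin True Cons.prems by (intro dominates_bump) auto
    moreover have "bump_row x R \<inter> \<Union>(set (row_insert ?y Rs)) = {}"
      using entries_insert[OF _ y] Cons.prems b True by (auto simp: bump_row_def)
    ultimately show ?thesis using Cons.IH[OF _ y] True fin Cons.prems by (auto simp: bump_row_def)
  next
    case False
    have "below R v \<le> below (insert x R) v" for v using fin by (intro card_mono) auto
    moreover have "dominates R (first_row Rs)" using Cons.prems by simp
    ultimately have "dominates (insert x R) (first_row Rs)"
      unfolding dominates_def by (meson order_trans)
    then show ?thesis using False fin Cons.prems by (auto simp: bump_row_def)
  qed
qed

section \<open>Shapes, and the inversion of row insertion\<close>

definition shape :: "nat set list \<Rightarrow> nat \<Rightarrow> nat" where
  "shape T i = (if i < length T then card (T ! i) else 0)"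

lemma shape_simps [simp]:
  "shape [] = (\<lambda>_. 0)" "shape (R # Rs) 0 = card R" "shape (R # Rs) (Suc i) = shape Rs i"
  by (auto simp: shape_def)

lemma shape_0: "shape T 0 = card (first_row T)"
  by (cases T) auto

lemma shape_Cons_eq_iff: "shape (R # Rs) = lam \<longleftrightarrow> card R = lam 0 \<and> shape Rs = (\<lambda>i. lam (Suc i))"
proof
  assume "card R = lam 0 \<and> shape Rs = (\<lambda>i. lam (Suc i))"
  then have "shape (R # Rs) i = lam i" for i by (cases i) auto
  then show "shape (R # Rs) = lam" by blast
next
  assume "shape (R # Rs) = lam"
  then show "card R = lam 0 \<and> shape Rs = (\<lambda>i. lam (Suc i))" by auto
qed

lemma shape_decreasing: "tableau T \<Longrightarrow> shape T (Suc i) \<le> shape T i"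
proof (induction T arbitrary: i)
  case (Cons R Rs)
  then show ?case
    by (cases i) (auto simp: shape_0 finite_first_row intro!: dominates_card)
qed simp

lemma shape_eq_0_iff: "tableau T \<Longrightarrow> shape T i = 0 \<longleftrightarrow> length T \<le> i"
proof (induction T arbitrary: i)
  case (Cons R Rs)
  then show ?case by (cases i) auto
qed simp

lemma card_bump_row:
  assumes "finite R" "x \<notin> R"
  shows "card (bump_row x R) = (if \<exists>y\<in>R. x < y then card R else Suc (card R))"
proof (cases "\<exists>y\<in>R. x < y")
  case True
  then show ?thesis
    using assms bumped(1)[OF assms(1) True] card_Suc_Diff1[OF assms(1), of "bumped x R"]
    by (simp add: bump_row_def)
qed (use assms in \<open>simp add: bump_row_def\<close>)

lemma shape_insert:
  "tableau T \<Longrightarrow> x \<notin> \<Union>(set T) \<Longrightarrow> \<exists>r. shape (row_insert x T) = (shape T)(r := Suc (shape T r))"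
proof (induction T arbitrary: x)
  case Nil
  show ?case by (rule exI[of _ 0]) (auto simp: shape_Cons_eq_iff)
next
  case (Cons R Rs)
  then have fin: "finite R" "x \<notin> R" by auto
  show ?case
  proof (cases "\<exists>y\<in>R. x < y")
    case True
    note b = bumped[OF fin(1) True]
    have y: "bumped x R \<notin> \<Union>(set Rs)" using Cons.prems b(1) by auto
    have "tableau Rs" using Cons.prems by simp
    from Cons.IH[OF this y] obtain r
      where "shape (row_insert (bumped x R) Rs) = (shape Rs)(r := Suc (shape Rs r))" by blast
    then show ?thesis using True fin
      by (intro exI[of _ "Suc r"]) (auto simp: shape_Cons_eq_iff card_bump_row)
  next
    case False
    then show ?thesis using fin
      by (intro exI[of _ 0]) (auto simp: shape_Cons_eq_iff card_bump_row)
  qed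
qed

text \<open>Reverse bumping: the inserted entry is the largest element of the new row that is
  smaller than the bumped one.\<close>

lemma bump_row_inj:
  assumes "finite R" "finite R2" "x \<notin> R" "x2 \<notin> R2" "bump_row x R = bump_row x2 R2"
    and bump: "\<exists>y\<in>R. x < y" "\<exists>y\<in>R2. x2 < y" and eq: "bumped x R = bumped x2 R2"
  shows "x = x2 \<and> R = R2"
proof -
  let ?y = "bumped x R"
  note b = bumped[OF assms(1) bump(1)] and b2 = bumped[OF assms(2) bump(2)]
  have 1: "bump_row x R = insert x (R - {?y})" "bump_row x R = insert x2 (R2 - {?y})"
    using assms by (auto simp: bump_row_def)
  have x2: "x2 \<in> insert x (R - {?y})" and x: "x \<in> insert x2 (R2 - {?y})" using 1 by auto
  have "x = x2"
  proof (rule ccontr)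
    assume "x \<noteq> x2"
    then have "x2 \<in> R" "x \<in> R2" "x2 < ?y" "x < ?y" using x x2 b(2) b2(2) eq by auto
    then have "\<not> x < x2" "\<not> x2 < x" using b(3)[of x2] b2(3)[of x] eq by auto
    then show False using \<open>x \<noteq> x2\<close> by simp
  qed
  moreover have "R = insert ?y (bump_row x R - {x})" "R2 = insert ?y (bump_row x R - {x2})"
    using 1 assms(3,4) b(1,2) b2(1,2) eq by auto
  ultimately show ?thesis by simp
qed

text \<open>As the shapes before insertion agree, the size of the new first row tells whether both
  insertions stopped there or both went on.\<close>

lemma row_insert_inj:
  assumes "tableau T" "tableau U" "x \<notin> \<Union>(set T)" "y \<notin> \<Union>(set U)" "shape T = shape U"
    and "row_insert x T = row_insert y U"
  shows "T = U \<and> x = y"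
  using assms
proof (induction T arbitrary: U x y)
  case Nil
  then have "shape U 0 = 0" by (metis shape_simps(1))
  then have "U = []" using shape_eq_0_iff[OF Nil.prems(2), of 0] by simp
  then show ?case using Nil by simp
next
  case (Cons R Rs)
  have "U \<noteq> []" using Cons.prems(1,5) shape_0[of "R # Rs"] by auto
  then obtain S Ss where U: "U = S # Ss" by (cases U) auto
  have fin: "finite R" "finite S" "x \<notin> R" "y \<notin> S" using Cons.prems U by auto
  have sh: "card R = card S" "shape Rs = shape Ss"
    using Cons.prems(5) unfolding U shape_Cons_eq_iff by auto
  have rows: "bump_row x R = bump_row y S" using Cons.prems(6) U by simp
  then have "card (bump_row x R) = card (bump_row y S)" by simp
  then consider (bump) "\<exists>z\<in>R. x < z" "\<exists>z\<in>S. y < z" | (append) "\<not> (\<exists>z\<in>R. x < z)" "\<not> (\<exists>z\<in>S. y < z)"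
    using sh(1) fin by (auto simp: card_bump_row split: if_splits)
  then show ?case
  proof cases
    case bump
    have "Rs = Ss \<and> bumped x R = bumped y S"
      using Cons.prems bump U sh bumped(1)[OF fin(1) bump(1)] bumped(1)[OF fin(2) bump(2)]
      by (intro Cons.IH) auto
    then show ?thesis using bump_row_inj[OF fin rows bump] U by simp
  next
    case append
    have rows': "insert x R = insert y S" using rows append by (simp add: bump_row_def)
    have "\<not> x < y" "\<not> y < x" using append rows' by auto
    then have "x = y" by simp
    then show ?thesis using rows' append fin U Cons.prems(6) by auto
  qed
qed

text \<open>Reverse insertion from the corner in row \<open>r\<close>: its last entry is taken out,
  and in each row above, the entry \<open>y\<close> coming from below replaces the largest smaller
  entry \<open>x\<close>, which moves on.\<close>

lemma row_insert_surj:
  assumes "tableau T" "shape T (Suc r) < shape T r"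
  shows "\<exists>U x. tableau U \<and> x \<notin> \<Union>(set U) \<and> row_insert x U = T \<and> shape U = (shape T)(r := shape T r - 1)"
  using assms
proof (induction T arbitrary: r)
  case Nil
  then show ?case by simp
next
  case (Cons R Rs)
  then have fin: "finite R" "R \<noteq> {}" "tableau Rs" "R \<inter> \<Union>(set Rs) = {}" and dom: "dominates R (first_row Rs)"
    by auto
  show ?case
  proof (cases r)
    case 0
    define x where "x = Max R"
    have x: "x \<in> R" "\<And>z. z \<in> R \<Longrightarrow> z \<le> x" using fin by (auto simp: x_def)
    have lt: "card (first_row Rs) < card R" using Cons.prems(2) 0 by (simp add: shape_0)
    show ?thesis
    proof (cases "R = {x}")
      case True
      then have "Rs = []" using lt fin(3) finite_first_row[OF fin(3)] by (cases Rs) auto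
      moreover have "shape [{x}] i = (if i = 0 then 1 else 0)" for i by (cases i) auto
      ultimately show ?thesis using True 0
        by (intro exI[of _ "[]"] exI[of _ x]) (auto simp: fun_eq_iff)
    next
      case False
      have "below (first_row Rs) v \<le> below (R - {x}) v" for v
      proof (cases "x < v")
        case True
        then have "below (R - {x}) v = card (R - {x})"
          using fin x by (intro below_large) (auto intro: le_less_trans)
        also have "\<dots> = card R - 1" using fin x by simp
        moreover have "below (first_row Rs) v \<le> card (first_row Rs)"
          using finite_first_row[OF fin(3)] by (intro card_mono) auto
        ultimately show ?thesis using lt by linarith
      next
        case False
        then have "below (R - {x}) v = below R v" using below_remove[OF fin(1) x(1), of v] by simp
        then show ?thesis using dom by (simp add: dominates_def)
      qed
      then have tab: "tableau ((R - {x}) # Rs)" using fin x False by (auto simp: dominates_def)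
      have nb: "\<not> (\<exists>y\<in>R - {x}. x < y)" using x by (auto simp: not_less)
      then have "row_insert x ((R - {x}) # Rs) = R # Rs" using x by (auto simp: bump_row_def)
      moreover have "shape ((R - {x}) # Rs) = (shape (R # Rs))(r := shape (R # Rs) r - 1)"
        using 0 fin x by (auto simp: shape_Cons_eq_iff)
      ultimately show ?thesis using tab x fin
        by (intro exI[of _ "(R - {x}) # Rs"] exI[of _ x]) auto
    qed
  next
    case (Suc q)
    obtain Us y where IH: "tableau Us" "y \<notin> \<Union>(set Us)" "row_insert y Us = Rs"
      "shape Us = (shape Rs)(q := shape Rs q - 1)"
      using Cons.IH[OF fin(3), of q] Cons.prems(2) Suc by (metis shape_simps(3))
    let ?S = "first_row Us"
    have ent: "\<Union>(set Rs) = insert y (\<Union>(set Us))" using entries_insert[OF IH(1,2)] IH(3) by simp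
    have yR: "y \<notin> R" using fin(4) ent by auto
    have S: "first_row Rs = bump_row y ?S" using first_row_insert[of y Us] IH(3) by simp
    have finS: "finite ?S" "y \<notin> ?S"
      using finite_first_row[OF IH(1)] IH(2) first_row_subset[of Us] by auto
    have bS: "below (first_row Rs) v = below ?S v + of_bool (y < v \<and> \<not> (\<exists>z\<in>?S. y < z \<and> z < v))" for v
      unfolding S by (rule below_bump_row[OF finS])
    \<comment> \<open>At threshold \<open>Suc y\<close> the second row counts \<open>y\<close> in
      addition to \<open>?S\<close>. So \<open>R\<close> has strictly more entries up to
      \<open>y\<close> than \<open>?S\<close>: this yields an entry of \<open>R\<close> smaller than
      \<open>y\<close>, and later the slack for domination.\<close>
    have "\<not> (\<exists>z\<in>?S. y < z \<and> z < Suc y)" by auto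
    then have "below (first_row Rs) (Suc y) = below ?S (Suc y) + 1" using bS[of "Suc y"] by simp
    moreover have "below (first_row Rs) (Suc y) \<le> below R (Suc y)"
      using dom by (simp add: dominates_def)
    ultimately have bRy: "below ?S (Suc y) + 1 \<le> below R (Suc y)" by simp
    then have "1 \<le> below R (Suc y)" by simp
    then have "R \<inter> {..<Suc y} \<noteq> {}" by (metis card.empty not_one_le_zero)
    then have ne: "{z \<in> R. z < y} \<noteq> {}" using yR by (auto simp: less_Suc_eq)
    define x where "x = Max {z \<in> R. z < y}"
    have x: "x \<in> R" "x < y" "\<And>z. z \<in> R \<Longrightarrow> z < y \<Longrightarrow> z \<le> x"
      using Max_in[OF _ ne] fin(1) by (auto simp: x_def)
    define Q where "Q = insert y (R - {x})"
    have Q: "finite Q" "x \<notin> Q" "y \<in> Q" using fin x by (auto simp: Q_def)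
    have bQ: "bumped x Q = y" using Q x by (intro bumped_eq) (auto simp: Q_def, meson leI leD le_neq_implies_less)
    have ex: "\<exists>z\<in>Q. x < z" using Q x by blast
    have RQ: "bump_row x Q = R" using ex bQ x yR by (auto simp: bump_row_def Q_def)
    \<comment> \<open>Trading \<open>x\<close> for \<open>y\<close> lowers the count of the upper
      row only for \<open>x < v \<le> y\<close>. No entry of \<open>R\<close> lies strictly between
      \<open>x\<close> and \<open>y\<close>, so the count of \<open>R\<close> there is that at
      \<open>Suc y\<close>, where the slack is available.\<close>
    have "below ?S v \<le> below Q v" for v
    proof (cases "x < v \<and> v \<le> y")
      case True
      have "\<not> (\<exists>z\<in>Q. x < z \<and> z < v)" using True bumped(3)[OF Q(1) ex] bQ by (metis leD order.strict_trans2)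
      then have "below R v = below Q v + 1"
        using below_bump_row[OF Q(1,2), of v] RQ True by simp
      moreover have "below R (Suc y) = below R v"
        using True x yR by (intro below_gap) (auto, metis leD le_less_trans le_neq_implies_less not_less_eq_eq)
      moreover have "below ?S v \<le> below ?S (Suc y)" using True finS by (intro below_mono) auto
      ultimately show ?thesis using bRy by linarith
    next
      case False
      have "below R v = below Q v"
        using below_bump_row[OF Q(1,2), of v] RQ False Q(3) x by auto
      moreover have "below ?S v \<le> below (first_row Rs) v" using bS by simp
      ultimately show ?thesis using dom unfolding dominates_def by (metis order_trans)
    qed
    then have "tableau (Q # Us)"
      using Q IH(1,2) ent fin(4) by (auto simp: dominates_def Q_def)
    moreover have "x \<notin> \<Union>(set (Q # Us))" using Q x fin(4) ent by auto
    moreover have "row_insert x (Q # Us) = R # Rs" using ex bQ RQ IH(3) by simp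
    moreover have "card Q = card R" using card_bump_row[OF Q(1,2)] ex RQ by simp
    then have "shape (Q # Us) = (shape (R # Rs))(r := shape (R # Rs) r - 1)"
      using IH(4) Suc by (auto simp: shape_Cons_eq_iff)
    ultimately show ?thesis by blast
  qed
qed

section \<open>Summing over tableaux\<close>

text \<open>Using \<open>first_row\<close> and \<open>tl\<close> allows row \<open>r\<close> to be
  the first empty one, in which case a new row is created.\<close>

fun add_max :: "nat \<Rightarrow> nat \<Rightarrow> nat set list \<Rightarrow> nat set list" where
  "add_max m 0 T = insert m (first_row T) # tl T"
| "add_max m (Suc r) T = first_row T # add_max m r (tl T)"

definition remove_entry :: "nat \<Rightarrow> nat set list \<Rightarrow> nat set list" where
  "remove_entry m T = filter (\<lambda>R. R \<noteq> {}) (map (\<lambda>R. R - {m}) T)"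

lemma remove_entry_simps [simp]:
  "remove_entry m [] = []"
  "remove_entry m (R # Rs) = (if R \<subseteq> {m} then remove_entry m Rs else (R - {m}) # remove_entry m Rs)"
  by (auto simp: remove_entry_def)

lemma remove_entry_notin: "tableau T \<Longrightarrow> m \<notin> \<Union>(set T) \<Longrightarrow> remove_entry m T = T"
  by (induction T) auto

lemma first_row_nonempty: "tableau T \<Longrightarrow> first_row T = {} \<Longrightarrow> T = []"
  by (cases T) auto

text \<open>Only thresholds beyond \<open>m\<close> are affected, and these see both rows
  completely, so the sizes decide.\<close>

lemma dominates_insert_max:
  assumes "finite S" "S \<subseteq> {..<m}" "finite R" "R \<subseteq> {..<m}" "dominates R S" "card S < card R"
  shows "dominates R (insert m S)"
  unfolding dominates_def
proof
  fix v
  have "m \<notin> S" using assms(2) by auto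
  note b = below_insert[OF assms(1) this, of v]
  show "below (insert m S) v \<le> below R v"
  proof (cases "m < v")
    case True
    then have "below R v = card R" "below S v = card S"
      using assms by (auto intro!: below_large)
    then show ?thesis unfolding b using assms(6) by simp
  next
    case False
    then show ?thesis unfolding b using assms(5) by (simp add: dominates_def)
  qed
qed

lemma dominates_remove_max:
  assumes "finite R" "S \<subseteq> {..<m}" "dominates R S"
  shows "dominates (R - {m}) S"
  unfolding dominates_def
proof
  fix v
  show "below S v \<le> below (R - {m}) v"
  proof (cases "m < v")
    case True
    have "below S v = below S m" using assms True by (intro below_gap) auto
    also have "\<dots> \<le> below R m" using assms(3) by (simp add: dominates_def)
    also have "R \<inter> {..<m} = (R - {m}) \<inter> {..<m}" by auto
    also have "below (R - {m}) m \<le> below (R - {m}) v" using True assms by (intro below_mono) auto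
    finally show ?thesis .
  next
    case False
    then have "(R - {m}) \<inter> {..<v} = R \<inter> {..<v}" by auto
    then show ?thesis using assms(3) by (simp add: dominates_def)
  qed
qed

lemma add_max:
  assumes "tableau T" "\<Union>(set T) \<subseteq> {..<m}" "r = 0 \<or> shape T r < shape T (r - 1)"
  shows "tableau (add_max m r T) \<and> \<Union>(set (add_max m r T)) = insert m (\<Union>(set T))
    \<and> shape (add_max m r T) = (shape T)(r := Suc (shape T r)) \<and> remove_entry m (add_max m r T) = T"
  using assms
proof (induction r arbitrary: T)
  case 0
  show ?case
  proof (cases T)
    case Nil
    then show ?thesis by (auto simp: dominates_def shape_Cons_eq_iff)
  next
    case (Cons R Rs)
    have m: "m \<notin> \<Union>(set Rs)" "m \<notin> R" "tableau Rs" "finite R" using 0 Cons by auto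
    have "below R v \<le> below (insert m R) v" for v using m by (intro card_mono) auto
    moreover have "dominates R (first_row Rs)" using 0 Cons by simp
    ultimately have "dominates (insert m R) (first_row Rs)"
      unfolding dominates_def by (meson order_trans)
    moreover have "remove_entry m Rs = Rs" using m by (intro remove_entry_notin)
    moreover have "insert m R - {m} = R" "\<not> R \<subseteq> {m}" using m 0 Cons by auto
    ultimately show ?thesis using 0 Cons m by (auto simp: shape_Cons_eq_iff)
  qed
next
  case (Suc r)
  then obtain R Rs where T: "T = R # Rs" by (cases T) auto
  have cond: "r = 0 \<or> shape Rs r < shape Rs (r - 1)" using Suc.prems(3) T by (cases r) auto
  have IH: "tableau (add_max m r Rs)" "\<Union>(set (add_max m r Rs)) = insert m (\<Union>(set Rs))"
    "shape (add_max m r Rs) = (shape Rs)(r := Suc (shape Rs r))" "remove_entry m (add_max m r Rs) = Rs"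
    using Suc.IH[OF _ _ cond] Suc.prems T by auto
  have "dominates R (first_row (add_max m r Rs))"
  proof (cases r)
    case 0
    have "card (first_row Rs) < card R" using Suc.prems(3) T 0 by (simp add: shape_0)
    then have "dominates R (insert m (first_row Rs))"
      using Suc.prems T finite_first_row[of Rs] first_row_subset[of Rs] by (intro dominates_insert_max) auto
    then show ?thesis using 0 by simp
  next
    case (Suc q)
    then show ?thesis using \<open>tableau T\<close> T by simp
  qed
  moreover have m: "m \<notin> R" "\<not> R \<subseteq> {m}" "R - {m} = R" using Suc.prems T by auto
  ultimately show ?case using IH Suc.prems T by (auto simp: shape_Cons_eq_iff)
qed

text \<open>The inclusion of the first rows is carried through the induction so that the row above
  still dominates once \<open>m\<close> has been removed.\<close>

lemma add_max_surj:
  assumes "tableau T" "m \<in> \<Union>(set T)" "\<Union>(set T) \<subseteq> {..m}"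
  shows "\<exists>r U. tableau U \<and> \<Union>(set U) \<subseteq> {..<m} \<and> first_row U \<subseteq> first_row T
    \<and> T = add_max m r U \<and> shape T = (shape U)(r := Suc (shape U r))"
  using assms
proof (induction T)
  case (Cons R Rs)
  have fin: "finite R" "finite (first_row Rs)" using Cons.prems by (auto simp: finite_first_row)
  show ?case
  proof (cases "m \<in> R")
    case True
    have sub: "\<Union>(set Rs) \<subseteq> {..<m}"
    proof
      fix z assume z: "z \<in> \<Union>(set Rs)"
      then have "z \<noteq> m" "z \<le> m" using Cons.prems True by auto
      then show "z \<in> {..<m}" by simp
    qed
    then have "dominates (R - {m}) (first_row Rs)"
      using Cons.prems fin first_row_subset[of Rs] by (intro dominates_remove_max) auto
    then have c: "card (first_row Rs) \<le> card (R - {m})" and d: "dominates (R - {m}) (first_row Rs)"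
      using fin by (auto intro!: dominates_card)
    show ?thesis
    proof (cases "R = {m}")
      case R: True
      then have "first_row Rs = {}" using c fin by simp
      then have "Rs = []" using Cons.prems first_row_nonempty[of Rs] by simp
      then show ?thesis using R
        by (intro exI[of _ 0] exI[of _ "[]"]) (auto simp: shape_Cons_eq_iff)
    next
      case False
      have "tableau ((R - {m}) # Rs)" using Cons.prems True False d by auto
      moreover have "\<Union>(set ((R - {m}) # Rs)) \<subseteq> {..<m}" using sub Cons.prems by (auto intro: le_neq_implies_less)
      moreover have "R # Rs = add_max m 0 ((R - {m}) # Rs)" using True by auto
      moreover have "Suc (card (R - {m})) = card R" using fin(1) True by (rule card_Suc_Diff1)
      then have "shape (R # Rs) = (shape ((R - {m}) # Rs))(0 := Suc (shape ((R - {m}) # Rs) 0))"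
        by (auto simp: shape_Cons_eq_iff)
      moreover have "first_row ((R - {m}) # Rs) \<subseteq> first_row (R # Rs)" by auto
      ultimately show ?thesis by blast
    qed
  next
    case False
    have "tableau Rs" "m \<in> \<Union>(set Rs)" "\<Union>(set Rs) \<subseteq> {..m}" using Cons.prems False by auto
    from Cons.IH[OF this] obtain r U where U: "tableau U" "\<Union>(set U) \<subseteq> {..<m}" "first_row U \<subseteq> first_row Rs"
      "Rs = add_max m r U" "shape Rs = (shape U)(r := Suc (shape U r))"
      by blast
    have "below (first_row U) v \<le> below (first_row Rs) v" for v
      using U(3) fin by (intro card_mono) auto
    moreover have "dominates R (first_row Rs)" using Cons.prems by simp
    ultimately have "dominates R (first_row U)"
      unfolding dominates_def by (meson order_trans)
    moreover have "\<Union>(set U) \<subseteq> \<Union>(set Rs)"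
    proof -
      have "\<Union>(set U) \<subseteq> \<Union>(set (add_max m r U))"
      proof (induction r arbitrary: U)
        case 0
        show ?case by (cases U) auto
      next
        case (Suc r)
        show ?case using Suc[of "tl U"] by (cases U) auto
      qed
      then show ?thesis using U(4) by simp
    qed
    moreover have "R \<inter> \<Union>(set Rs) = {}" using Cons.prems(1) by simp
    ultimately have "dominates R (first_row U) \<and> R \<inter> \<Union>(set U) = {}" by blast
    then have "tableau (R # U)" using U(1) Cons.prems(1) by simp
    moreover have "\<Union>(set (R # U)) \<subseteq> {..<m}" using U(2) False Cons.prems(3) by (auto intro: le_neq_implies_less)
    moreover have "R # Rs = add_max m (Suc r) (R # U)" using U(4) by simp
    moreover have "shape (R # Rs) = (shape (R # U))(Suc r := Suc (shape (R # U) (Suc r)))"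
      using U(5) by (auto simp: shape_Cons_eq_iff)
    moreover have "first_row (R # U) \<subseteq> first_row (R # Rs)" by simp
    ultimately show ?thesis by blast
  qed
qed simp

text \<open>The entries need not exhaust \<open>{1..t}\<close>: they stand for the openers of the
  arcs that are open at time \<open>t\<close>.\<close>

definition tableaux :: "nat \<Rightarrow> (nat \<Rightarrow> nat) \<Rightarrow> nat set list set" where
  "tableaux t lam = {T. tableau T \<and> \<Union>(set T) \<subseteq> {1..t} \<and> shape T = lam}"

lemma tableau_distinct: "tableau T \<Longrightarrow> distinct T"
  by (induction T) auto

lemma finite_tableau: "finite {T. tableau T \<and> \<Union>(set T) \<subseteq> {1..t}}"
proof (rule finite_subset)
  show "{T. tableau T \<and> \<Union>(set T) \<subseteq> {1..t}} \<subseteq> {T. set T \<subseteq> Pow {1..t} \<and> distinct T}"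
    using tableau_distinct by auto
  show "finite {T. set T \<subseteq> Pow {1..t} \<and> distinct T}"
    by (rule finite_subset_distinct) simp
qed

lemma finite_tableaux: "finite (tableaux t lam)"
  by (rule finite_subset[OF _ finite_tableau[of t]]) (auto simp: tableaux_def)

text \<open>Weighted number of ways to unwind the tableau \<open>T\<close> of open arcs at time \<open>t\<close>, going back to
  time 0.\<close>

fun unwind :: "nat \<Rightarrow> nat \<Rightarrow> ((nat \<Rightarrow> nat) \<Rightarrow> int) \<Rightarrow> nat \<Rightarrow> nat set list \<Rightarrow> int" where
  "unwind h w st 0 T = 1"
| "unwind h w st (Suc t) T = (if Suc t \<in> \<Union>(set T) then unwind h w st t (remove_entry (Suc t) T)
     else st (shape T) * unwind h w st t T + (\<Sum>x\<in>{1..t} - \<Union>(set T).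
       if in_box h w (shape (row_insert x T)) then unwind h w st t (row_insert x T) else 0))"

text \<open>A tableau containing \<open>Suc t\<close> amounts to a tableau with entries up to
  \<open>t\<close> together with the corner at which \<open>Suc t\<close> is added.\<close>

lemma sum_remove_max:
  fixes F :: "nat set list \<Rightarrow> int"
  assumes lam: "in_box h w lam"
  shows "(\<Sum>T | T \<in> tableaux (Suc t) lam \<and> Suc t \<in> \<Union>(set T). F (remove_entry (Suc t) T))
    = (\<Sum>r | r < h \<and> 0 < lam r \<and> in_box h w (lam(r := lam r - 1)). \<Sum>U\<in>tableaux t (lam(r := lam r - 1)). F U)"
proof -
  let ?I = "{r. r < h \<and> 0 < lam r \<and> in_box h w (lam(r := lam r - 1))}"
  let ?S = "SIGMA r:?I. tableaux t (lam(r := lam r - 1))"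
  let ?B = "{T. T \<in> tableaux (Suc t) lam \<and> Suc t \<in> \<Union>(set T)}"
  let ?f = "\<lambda>(r, U). add_max (Suc t) r U"
  have f: "tableau (add_max (Suc t) r U) \<and> \<Union>(set (add_max (Suc t) r U)) = insert (Suc t) (\<Union>(set U))
    \<and> shape (add_max (Suc t) r U) = lam \<and> remove_entry (Suc t) (add_max (Suc t) r U) = U"
    if "r \<in> ?I" "U \<in> tableaux t (lam(r := lam r - 1))" for r U
  proof -
    have "lam (Suc (r - 1)) \<le> lam (r - 1)" using lam by (simp add: in_box_def)
    then have cond: "r = 0 \<or> shape U r < shape U (r - 1)"
      using that by (cases r) (auto simp: tableaux_def)
    have "\<Union>(set U) \<subseteq> {..<Suc t}" using that by (auto simp: tableaux_def)
    then show ?thesis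
      using add_max[of U "Suc t" r, OF _ _ cond] that by (auto simp: tableaux_def)
  qed
  have "bij_betw ?f ?S ?B"
  proof (rule bij_betwI')
    fix p q assume p: "p \<in> ?S" and q: "q \<in> ?S"
    obtain r U r' U' where pq: "p = (r, U)" "q = (r', U')" by (cases p; cases q)
    show "(?f p = ?f q) = (p = q)"
    proof
      assume "?f p = ?f q"
      then have "add_max (Suc t) r U = add_max (Suc t) r' U'" by (simp add: pq)
      then have "U = U'" using f[of r U] f[of r' U'] p q pq by (metis (no_types, lifting) SigmaD1 SigmaD2)
      then have eq: "lam(r := lam r - 1) = lam(r' := lam r' - 1)"
        using p q pq by (auto simp: tableaux_def)
      have "r = r'"
        using fun_cong[OF eq, of r] p pq by (auto split: if_splits)
      then show "p = q" using \<open>U = U'\<close> pq by simp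
    qed simp
  next
    fix p assume "p \<in> ?S"
    then obtain r U where p: "p = (r, U)" "r \<in> ?I" "U \<in> tableaux t (lam(r := lam r - 1))" by blast
    then have "insert (Suc t) (\<Union>(set U)) \<subseteq> {1..Suc t}" by (auto simp: tableaux_def)
    then show "?f p \<in> ?B" using f[OF p(2,3)] by (simp add: tableaux_def p(1) del: Union_iff)
  next
    fix T assume T: "T \<in> ?B"
    then have "\<Union>(set T) \<subseteq> {..Suc t}" by (auto simp: tableaux_def)
    then obtain r U where U: "tableau U" "\<Union>(set U) \<subseteq> {..<Suc t}" "T = add_max (Suc t) r U"
      "shape T = (shape U)(r := Suc (shape U r))"
      using add_max_surj[of T "Suc t"] T by (auto simp: tableaux_def)
    have lamU: "lam = (shape U)(r := Suc (shape U r))" using U(4) T by (simp add: tableaux_def)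
    then have sU: "shape U = lam(r := lam r - 1)" by auto
    have "\<not> h \<le> r"
    proof
      assume "h \<le> r"
      then have "lam r \<le> lam h" using lam lift_Suc_antimono_le[of lam h r] by (auto simp: in_box_def)
      then show False using lam lamU by (simp add: in_box_def)
    qed
    have le: "shape U i \<le> lam i" for i by (simp add: sU)
    have pos: "0 < lam r" using fun_cong[OF lamU, of r] by simp
    have "in_box h w (shape U)"
      using shape_decreasing[OF U(1)] le[of h] le[of 0] lam by (auto simp: in_box_def)
    then have "in_box h w (lam(r := lam r - 1))" by (simp only: sU)
    then have r: "r \<in> ?I" using pos \<open>\<not> h \<le> r\<close> by simp
    have "\<Union>(set U) \<subseteq> \<Union>(set T)"
    proof -
      have "lam (Suc (r - 1)) \<le> lam (r - 1)" using lam by (simp add: in_box_def)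
      then have "r = 0 \<or> shape U r < shape U (r - 1)"
        using pos by (cases r) (simp_all add: sU)
      then show ?thesis using add_max[OF U(1,2)] U(3) by auto
    qed
    then have "\<Union>(set U) \<subseteq> {1..t}" using T U(2) by (force simp: tableaux_def)
    then have "U \<in> tableaux t (lam(r := lam r - 1))" using U(1) sU by (simp add: tableaux_def)
    then show "\<exists>p\<in>?S. T = ?f p" using r U(3) by (intro bexI[of _ "(r, U)"]) auto
  qed
  then have "(\<Sum>T\<in>?B. F (remove_entry (Suc t) T)) = (\<Sum>p\<in>?S. F (remove_entry (Suc t) (?f p)))"
    by (rule sum.reindex_bij_betw[symmetric])
  also have "\<dots> = (\<Sum>(r, U)\<in>?S. F U)"
    using f by (intro sum.cong) auto
  also have "\<dots> = (\<Sum>r\<in>?I. \<Sum>U\<in>tableaux t (lam(r := lam r - 1)). F U)"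
    by (rule sum.Sigma[symmetric]) (auto intro: finite_tableaux)
  finally show ?thesis .
qed

lemma sum_row_insert:
  fixes F :: "nat set list \<Rightarrow> int"
  assumes lam: "in_box h w lam"
  shows "(\<Sum>T\<in>tableaux t lam. \<Sum>x\<in>{1..t} - \<Union>(set T).
      if in_box h w (shape (row_insert x T)) then F (row_insert x T) else 0)
    = (\<Sum>r | r < h \<and> in_box h w (lam(r := Suc (lam r))). \<Sum>U\<in>tableaux t (lam(r := Suc (lam r))). F U)"
proof -
  let ?I = "{r. r < h \<and> in_box h w (lam(r := Suc (lam r)))}"
  let ?S = "SIGMA T:tableaux t lam. {1..t} - \<Union>(set T)"
  let ?C = "{U. tableau U \<and> \<Union>(set U) \<subseteq> {1..t} \<and> (\<exists>r. shape U = lam(r := Suc (lam r)))}"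
  let ?F = "\<lambda>U. if in_box h w (shape U) then F U else 0"
  have "bij_betw (\<lambda>(T, x). row_insert x T) ?S ?C"
  proof (rule bij_betwI')
    fix p q assume pq: "p \<in> ?S" "q \<in> ?S"
    obtain T x U y where eq: "p = (T, x)" "q = (U, y)" by (cases p; cases q)
    have "tableau T" "tableau U" "x \<notin> \<Union>(set T)" "y \<notin> \<Union>(set U)" "shape T = shape U"
      using pq by (simp_all add: eq tableaux_def)
    from row_insert_inj[OF this]
    show "((case p of (T, x) \<Rightarrow> row_insert x T) = (case q of (T, x) \<Rightarrow> row_insert x T)) = (p = q)"
      unfolding eq by auto
  next
    fix p assume p: "p \<in> ?S"
    obtain T x where eq: "p = (T, x)" by (cases p)
    have T: "tableau T" "x \<notin> \<Union>(set T)" "insert x (\<Union>(set T)) \<subseteq> {1..t}" "shape T = lam"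
      using p by (simp_all add: eq tableaux_def)
    show "(case p of (T, x) \<Rightarrow> row_insert x T) \<in> ?C"
      using tableau_insert[OF T(1,2)] entries_insert[OF T(1,2)] shape_insert[OF T(1,2)] T(3)
      by (simp add: eq T(4) del: Union_iff)
  next
    fix U assume U: "U \<in> ?C"
    then obtain r where r: "shape U = lam(r := Suc (lam r))" by auto
    have "lam (Suc r) \<le> lam r" using lam by (simp add: in_box_def)
    then have "shape U (Suc r) < shape U r" using r by simp
    then obtain T x where T: "tableau T" "x \<notin> \<Union>(set T)" "row_insert x T = U" "shape T = (shape U)(r := shape U r - 1)"
      using row_insert_surj[of U r] U by auto
    have "\<Union>(set U) = insert x (\<Union>(set T))" using entries_insert[OF T(1,2)] T(3) by simp
    then have "\<Union>(set T) \<subseteq> {1..t}" "x \<in> {1..t}" using U by auto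
    moreover have "shape T = lam" using T(4) r by auto
    ultimately have "(T, x) \<in> ?S" using T(1,2) by (simp add: tableaux_def)
    then show "\<exists>p\<in>?S. U = (case p of (T, x) \<Rightarrow> row_insert x T)" using T(3) by (intro bexI[of _ "(T, x)"]) auto
  qed
  note bij = this
  have "(\<Sum>T\<in>tableaux t lam. \<Sum>x\<in>{1..t} - \<Union>(set T). ?F (row_insert x T)) = (\<Sum>p\<in>?S. ?F (case p of (T, x) \<Rightarrow> row_insert x T))"
    by (subst sum.Sigma) (auto simp: finite_tableaux intro!: sum.cong)
  also have "\<dots> = (\<Sum>U\<in>?C. ?F U)"
    by (rule sum.reindex_bij_betw[OF bij])
  also have "\<dots> = (\<Sum>U | U \<in> ?C \<and> in_box h w (shape U). F U)"
    by (rule sum.inter_filter[symmetric]) (rule finite_subset[OF _ finite_tableau[of t]], auto)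
  also have "{U. U \<in> ?C \<and> in_box h w (shape U)} = (\<Union>r\<in>?I. tableaux t (lam(r := Suc (lam r))))"
  proof -
    have "r < h" if "in_box h w (lam(r := Suc (lam r)))" for r
    proof (rule ccontr)
      assume "\<not> r < h"
      then have "(lam(r := Suc (lam r))) r \<le> (lam(r := Suc (lam r))) h"
        using that lift_Suc_antimono_le[of "lam(r := Suc (lam r))" h r] by (auto simp: in_box_def simp del: fun_upd_apply)
      then show False using that by (simp add: in_box_def)
    qed
    then show ?thesis by (auto simp: tableaux_def) blast+
  qed
  also have "(\<Sum>U\<in>(\<Union>r\<in>?I. tableaux t (lam(r := Suc (lam r)))). F U) = (\<Sum>r\<in>?I. \<Sum>U\<in>tableaux t (lam(r := Suc (lam r))). F U)"
  proof (rule sum.UNION_disjoint)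
    show "\<forall>i\<in>?I. \<forall>j\<in>?I. i \<noteq> j \<longrightarrow> tableaux t (lam(i := Suc (lam i))) \<inter> tableaux t (lam(j := Suc (lam j))) = {}"
      by (auto simp: tableaux_def fun_upd_def fun_eq_iff)
  qed (auto intro: finite_tableaux)
  finally show ?thesis .
qed

text \<open>Once all tableaux of a shape are summed over, both removal and insertion become
  bijections onto tableaux of neighbouring shapes. The entries disappear and only a walk of shapes
  remains.\<close>

theorem sum_unwind:
  assumes "in_box h w lam"
  shows "(\<Sum>T\<in>tableaux t lam. unwind h w st t T) = box_walks h w st t lam"
  using assms
proof (induction t arbitrary: lam)
  case 0
  have "T = []" if "tableau T" "\<Union>(set T) \<subseteq> {}" for T
    using that by (cases T) auto
  then have "T \<in> tableaux 0 lam \<longleftrightarrow> T = [] \<and> lam = (\<lambda>_. 0)" for T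
    by (cases "T = []") (auto simp: tableaux_def)
  then have "tableaux 0 lam = (if lam = (\<lambda>_. 0) then {[]} else {})"
    by auto
  then show ?case by simp
next
  case (Suc t)
  let ?u = "unwind h w st t"
  let ?B = "{T. T \<in> tableaux (Suc t) lam \<and> Suc t \<in> \<Union>(set T)}"
  have split: "tableaux (Suc t) lam = tableaux t lam \<union> ?B"
    by (auto simp: tableaux_def atLeastAtMostSuc_conv)
  have nB: "Suc t \<notin> \<Union>(set T)" if "T \<in> tableaux t lam" for T
    using that by (auto simp: tableaux_def)
  have "(\<Sum>T\<in>tableaux (Suc t) lam. unwind h w st (Suc t) T) = (\<Sum>T\<in>tableaux t lam \<union> ?B. unwind h w st (Suc t) T)"
    by (rule sum.cong[OF split refl])
  also have "\<dots> = (\<Sum>T\<in>tableaux t lam. unwind h w st (Suc t) T) + (\<Sum>T\<in>?B. unwind h w st (Suc t) T)"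
  proof (rule sum.union_disjoint)
    show "tableaux t lam \<inter> ?B = {}" using nB by blast
  qed (simp_all add: finite_tableaux)
  also have "(\<Sum>T\<in>?B. unwind h w st (Suc t) T) = (\<Sum>T\<in>?B. ?u (remove_entry (Suc t) T))"
    by (intro sum.cong) auto
  also have "(\<Sum>T\<in>tableaux t lam. unwind h w st (Suc t) T) = st lam * (\<Sum>T\<in>tableaux t lam. ?u T)
      + (\<Sum>T\<in>tableaux t lam. \<Sum>x\<in>{1..t} - \<Union>(set T).
          if in_box h w (shape (row_insert x T)) then ?u (row_insert x T) else 0)"
    unfolding sum_distrib_left sum.distrib[symmetric]
  proof (intro sum.cong refl)
    fix T assume T: "T \<in> tableaux t lam"
    then have "shape T = lam" by (simp add: tableaux_def)
    then show "unwind h w st (Suc t) T = st lam * ?u T + (\<Sum>x\<in>{1..t} - \<Union>(set T).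
          if in_box h w (shape (row_insert x T)) then ?u (row_insert x T) else 0)"
      using nB[OF T] by simp
  qed
  finally have eq: "(\<Sum>T\<in>tableaux (Suc t) lam. unwind h w st (Suc t) T) = st lam * box_walks h w st t lam
     + (\<Sum>r | r < h \<and> in_box h w (lam(r := Suc (lam r))). \<Sum>U\<in>tableaux t (lam(r := Suc (lam r))). ?u U)
     + (\<Sum>r | r < h \<and> 0 < lam r \<and> in_box h w (lam(r := lam r - 1)). \<Sum>U\<in>tableaux t (lam(r := lam r - 1)). ?u U)"
    unfolding sum_remove_max[OF Suc.prems] sum_row_insert[OF Suc.prems] Suc.IH[OF Suc.prems] .
  show ?case
    unfolding eq box_walks.simps
    by (intro arg_cong2[of _ _ _ _ "(+)"] sum.cong refl Suc.IH) (simp_all del: fun_upd_apply)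
qed

section \<open>Schensted's theorem\<close>

text \<open>Words are written in reverse: the head of the list is the letter inserted last.\<close>

definition insertion_tableau :: "nat list \<Rightarrow> nat set list" where
  "insertion_tableau W = foldr row_insert W []"

lemma insertion_tableau_simps [simp]:
  "insertion_tableau [] = []"
  "insertion_tableau (x # W) = row_insert x (insertion_tableau W)"
  by (simp_all add: insertion_tableau_def)

lemma insertion_tableau:
  "distinct W \<Longrightarrow> tableau (insertion_tableau W) \<and> \<Union>(set (insertion_tableau W)) = set W"
  by (induction W) (simp_all add: tableau_insert entries_insert del: Union_iff)

text \<open>The largest entry \<open>m\<close> ends its row and matters only if it is bumped. It
  then moves to the end of the next row and bumps nothing, so all other entries move as if it were
  absent.\<close>

lemma remove_entry_insert:
  assumes "tableau T" "x \<notin> \<Union>(set T)" "x < m" "\<Union>(set T) \<subseteq> {..m}"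
  shows "remove_entry m (row_insert x T) = row_insert x (remove_entry m T)"
  using assms
proof (induction T arbitrary: x)
  case (Cons R Rs)
  then have fin: "finite R" "tableau Rs" "R \<noteq> {}" "R \<inter> \<Union>(set Rs) = {}" "x \<notin> R" "\<Union>(set Rs) \<subseteq> {..m}"
    by auto
  show ?case
  proof (cases "\<exists>y\<in>R. x < y")
    case True
    note b = bumped[OF fin(1) True]
    let ?y = "bumped x R"
    have y: "?y \<notin> \<Union>(set Rs)" using fin(4) b(1) by auto
    show ?thesis
    proof (cases "?y = m")
      case False
      then have lt: "?y < m" using b(1) Cons.prems(4) by (simp add: le_neq_implies_less subset_iff)
      have "?y \<in> R - {m}" using b(1) lt by simp
      then have ex: "\<exists>y\<in>R - {m}. x < y" "\<not> R \<subseteq> {m}" using b(2) by auto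
      have by': "bumped x (R - {m}) = ?y"
        using fin(1) b lt by (intro bumped_eq) auto
      have "bump_row x R - {m} = bump_row x (R - {m})" "\<not> bump_row x R \<subseteq> {m}"
        using True ex(1) by' Cons.prems(3) by (auto simp: bump_row_def)
      then show ?thesis
        using True ex by' Cons.IH[OF fin(2) y lt fin(6)] by simp
    next
      case m: True
      have only: "z = m" if "z \<in> R" "x < z" for z
        using b(3)[OF that] that Cons.prems(4) m by (auto intro: le_antisym)
      have nex: "\<not> (\<exists>y\<in>R - {m}. x < y)" using only by auto
      have mRs: "m \<notin> \<Union>(set Rs)" using y m by simp
      have row: "bump_row x R - {m} = insert x (R - {m})" "\<not> bump_row x R \<subseteq> {m}"
        using True m Cons.prems(3) by (auto simp: bump_row_def)
      have Rs: "\<Union>(set Rs) \<subseteq> {..<m}"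
      proof
        fix z assume "z \<in> \<Union>(set Rs)"
        then have "z \<noteq> m" "z \<le> m" using mRs fin(6) by auto
        then show "z \<in> {..<m}" by simp
      qed
      have remRs: "remove_entry m Rs = Rs" using fin(2) mRs by (rule remove_entry_notin)
      have "remove_entry m (row_insert m Rs) = Rs"
      proof (cases Rs)
        case (Cons S Ss)
        have "m \<notin> S" "S \<noteq> {}" "tableau Ss" "m \<notin> \<Union>(set Ss)" "\<not> (\<exists>y\<in>S. m < y)"
          using Rs mRs fin(2) Cons by auto
        then show ?thesis using Cons remove_entry_notin[of Ss m] by (auto simp: bump_row_def)
      qed simp
      then have lhs: "remove_entry m (row_insert x (R # Rs)) = insert x (R - {m}) # Rs"
        using True row m by simp
      show ?thesis
      proof (cases "R \<subseteq> {m}")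
        case R: True
        \<comment> \<open>A row consisting of \<open>m\<close> alone dominates only an empty row,
          because all entries further down are smaller than \<open>m\<close>.\<close>
        have "first_row Rs = {}"
        proof (rule ccontr)
          assume "first_row Rs \<noteq> {}"
          then obtain s where s: "s \<in> first_row Rs" by auto
          then have "s \<in> {..<m}" using Rs first_row_subset[of Rs] by blast
          then have "s < m" by simp
          have "R \<inter> {..<Suc s} = {}" using R \<open>s < m\<close> by auto
          moreover have "below (first_row Rs) (Suc s) \<le> below R (Suc s)"
            using Cons.prems(1) by (simp add: dominates_def)
          ultimately have "below (first_row Rs) (Suc s) = 0" by simp
          then show False using s finite_first_row[OF fin(2)] by (auto simp: card_eq_0_iff)
        qed
        then have "Rs = []" using fin(2) by (rule first_row_nonempty[rotated])
        then show ?thesis using lhs R by auto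
      next
        case False
        then show ?thesis using lhs nex remRs by (simp add: bump_row_def)
      qed
    qed
  next
    case False
    then have "m \<notin> R" using Cons.prems(3) by auto
    moreover have "\<not> R \<subseteq> {m}" using fin(3) \<open>m \<notin> R\<close> by auto
    moreover have "bump_row x R = insert x R" "m \<notin> insert x R"
      using False \<open>m \<notin> R\<close> Cons.prems(3) by (auto simp: bump_row_def)
    ultimately show ?thesis using False by auto
  qed
qed auto

lemma remove_entry_insert_max:
  assumes "tableau T" "\<Union>(set T) \<subseteq> {..<m}"
  shows "remove_entry m (row_insert m T) = T"
proof (cases T)
  case (Cons S Ss)
  have "m \<notin> S" "S \<noteq> {}" "tableau Ss" "m \<notin> \<Union>(set Ss)" "\<not> (\<exists>y\<in>S. m < y)"
    using assms Cons by auto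
  then show ?thesis using Cons remove_entry_notin[of Ss m] by (auto simp: bump_row_def)
qed simp

lemma insertion_tableau_remove_max:
  assumes "distinct W" "m \<in> set W" "set W \<subseteq> {..m}"
  shows "insertion_tableau (remove1 m W) = remove_entry m (insertion_tableau W)"
  using assms
proof (induction W)
  case (Cons x W)
  note T = insertion_tableau[of W]
  show ?case
  proof (cases "x = m")
    case True
    then have "set W \<subseteq> {..<m}" using Cons.prems by (auto intro: le_neq_implies_less)
    then show ?thesis using True Cons.prems T by (simp add: remove_entry_insert_max del: Union_iff)
  next
    case False
    then have "x < m" using Cons.prems by auto
    then have "remove_entry m (row_insert x (insertion_tableau W)) = row_insert x (remove_entry m (insertion_tableau W))"
      using Cons.prems T by (intro remove_entry_insert) auto
    then show ?thesis using False Cons by auto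
  qed
qed simp

section \<open>Longest monotone subsequences and the insertion tableau\<close>

fun longest :: "(nat \<Rightarrow> nat \<Rightarrow> bool) \<Rightarrow> nat list \<Rightarrow> nat \<Rightarrow> nat" where
  "longest R [] v = 0"
| "longest R (x # W) v = max (longest R W v) (if R v x then Suc (longest R W x) else 0)"

text \<open>The head of the list is inserted last, so descending along the list means increasing in
  the order of insertion; \<open>v\<close> bounds the last letter of the subsequence from
  above.\<close>

abbreviation longest_inc :: "nat list \<Rightarrow> nat \<Rightarrow> nat" where
  "longest_inc \<equiv> longest (>)"

abbreviation longest_dec :: "nat list \<Rightarrow> nat \<Rightarrow> nat" where
  "longest_dec \<equiv> longest (<)"

text \<open>Both sides are updated by the rule of \<open>below_bump_row\<close>: inserting
  \<open>x\<close> adds one exactly if \<open>x < v\<close> and no first-row entry lies strictly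
  between, which is when a sequence ending in \<open>x\<close> beats the old maximum.\<close>

lemma longest_inc_below: "distinct W \<Longrightarrow> longest_inc W v = below (first_row (insertion_tableau W)) v"
proof (induction W arbitrary: v)
  case (Cons x W)
  let ?R = "first_row (insertion_tableau W)"
  have T: "tableau (insertion_tableau W)" "\<Union>(set (insertion_tableau W)) = set W"
    using insertion_tableau[of W] Cons.prems by auto
  have R: "finite ?R" "x \<notin> ?R"
    using finite_first_row[OF T(1)] first_row_subset[of "insertion_tableau W"] T(2) Cons.prems by auto
  have IH: "longest_inc W u = below ?R u" for u using Cons by simp
  have "longest_inc (x # W) v = below ?R v + of_bool (x < v \<and> \<not> (\<exists>y\<in>?R. x < y \<and> y < v))"
  proof (cases "x < v")
    case True
    have mono: "below ?R x \<le> below ?R v" using R True by (intro below_mono) auto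
    show ?thesis
    proof (cases "\<exists>y\<in>?R. x < y \<and> y < v")
      case ex: True
      then obtain y where y: "y \<in> ?R" "x < y" "y < v" by auto
      then have "y \<in> ?R \<inter> {..<v}" "y \<notin> ?R \<inter> {..<x}" "?R \<inter> {..<x} \<subseteq> ?R \<inter> {..<v}" by simp_all (blast intro: less_trans)
      then have "?R \<inter> {..<x} \<subset> ?R \<inter> {..<v}" by blast
      then have "below ?R x < below ?R v" using R by (intro psubset_card_mono) auto
      then show ?thesis using True ex IH by (simp only: longest.simps) simp
    next
      case False
      have "below ?R v = below ?R x"
        using False True R by (intro below_gap) (metis le_neq_implies_less not_less, simp)
      then show ?thesis using True False IH by (simp only: longest.simps) simp
    qed
  qed (simp add: IH)
  then show ?case by (simp add: first_row_insert below_bump_row[OF R])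
qed simp

lemma longest_inc_shape:
  assumes "distinct W" "\<And>x. x \<in> set W \<Longrightarrow> x < v"
  shows "longest_inc W v = shape (insertion_tableau W) 0"
proof -
  have T: "tableau (insertion_tableau W)" "\<Union>(set (insertion_tableau W)) = set W"
    using insertion_tableau[of W] assms(1) by auto
  show ?thesis
    unfolding longest_inc_below[OF assms(1)] shape_0
    using finite_first_row[OF T(1)] first_row_subset[of "insertion_tableau W"] T(2) assms(2)
    by (intro below_large) auto
qed

text \<open>The letters leaving the first row, latest first: the word that is inserted into the
  remaining rows.\<close>

fun bumped_word :: "nat list \<Rightarrow> nat list" where
  "bumped_word [] = []"
| "bumped_word (x # W) = (let R = first_row (insertion_tableau W) in
     if \<exists>y\<in>R. x < y then bumped x R # bumped_word W else bumped_word W)"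

lemma insertion_tableau_bumped:
  "W \<noteq> [] \<Longrightarrow> insertion_tableau W = first_row (insertion_tableau W) # insertion_tableau (bumped_word W)"
proof (induction W)
  case (Cons x W)
  show ?case
  proof (cases "W = []")
    case True
    then show ?thesis by simp
  next
    case False
    define R where "R = first_row (insertion_tableau W)"
    define B where "B = insertion_tableau (bumped_word W)"
    have "insertion_tableau W = R # B" using Cons.IH[OF False] by (simp only: R_def B_def)
    then show ?thesis by (simp add: B_def[symmetric])
  qed
qed simp

lemma longest_dec_antimono: "u \<le> v \<Longrightarrow> longest_dec W v \<le> longest_dec W u"
proof (induction W)
  case (Cons x W)
  then show ?case by (auto simp: le_max_iff_disj)
qed simp

text \<open>Only \<open>v = 0\<close> is needed in the end, but the induction over the word needs all lower bounds \<open>v\<close>.\<close>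

lemma longest_dec_bumped:
  assumes "distinct W"
  shows "longest_dec W v = max (longest_dec (bumped_word W) v)
    (if \<exists>y\<in>first_row (insertion_tableau W). v < y
     then Suc (longest_dec (bumped_word W) (bumped v (first_row (insertion_tableau W)))) else 0)"
  using assms
proof (induction W arbitrary: v)
  case (Cons x W)
  let ?R = "first_row (insertion_tableau W)"
  let ?D = "longest_dec (bumped_word W)"
  have T: "tableau (insertion_tableau W)" "\<Union>(set (insertion_tableau W)) = set W"
    using insertion_tableau[of W] Cons.prems by auto
  have R: "finite ?R" "x \<notin> ?R"
    using finite_first_row[OF T(1)] first_row_subset[of "insertion_tableau W"] T(2) Cons.prems by auto
  have IH: "longest_dec W u = max (?D u) (if \<exists>y\<in>?R. u < y then Suc (?D (bumped u ?R)) else 0)" for u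
    using Cons by simp
  have anti: "?D v \<le> ?D u" if "u \<le> v" for u v using that by (rule longest_dec_antimono)
  have R': "first_row (insertion_tableau (x # W)) = bump_row x ?R" by (simp add: first_row_insert)
  show ?case
  proof (cases "\<exists>y\<in>?R. x < y")
    case False
    have W': "bumped_word (x # W) = bumped_word W" using False by simp
    have R'': "bump_row x ?R = insert x ?R" using False by (simp add: bump_row_def)
    have Dx: "longest_dec W x = ?D x" using IH[of x] False by simp
    show ?thesis
    proof (cases "v < x")
      case vx: False
      then have "\<not> (\<exists>y\<in>?R. v < y)" using False by (meson le_less_trans not_less)
      then show ?thesis unfolding R' W' R'' using vx IH[of v] by simp
    next
      case vx: True
      show ?thesis
      proof (cases "\<exists>y\<in>?R. v < y")
        case True
        note b = bumped[OF R(1) True]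
        have "bumped v ?R < x" using b(1) False R(2) by (metis not_less_iff_gr_or_eq)
        then have "bumped v (insert x ?R) = bumped v ?R" "?D x \<le> ?D (bumped v ?R)"
          using R b by (auto intro!: bumped_eq anti)
        then show ?thesis unfolding R' W' R'' using vx True IH[of v] Dx by auto
      next
        case False
        then have "bumped v (insert x ?R) = x" using R vx by (intro bumped_eq) auto
        then show ?thesis unfolding R' W' R'' using vx False IH[of v] Dx by auto
      qed
    qed
  next
    case True
    let ?y = "bumped x ?R"
    note b = bumped[OF R(1) True]
    have W': "bumped_word (x # W) = ?y # bumped_word W" using True by simp
    have R'': "bump_row x ?R = insert x (?R - {?y})" using True by (simp add: bump_row_def)
    have Dx: "longest_dec W x = max (?D x) (Suc (?D ?y))" using IH[of x] True by simp
    \<comment> \<open>In the first row \<open>x\<close> replaces \<open>?y\<close>, and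
      \<open>?y\<close> becomes a letter of the bumped word. The cases distinguish whether none,
      only \<open>?y\<close>, or both of these exceed \<open>v\<close>.\<close>
    consider "?y \<le> v" | "x \<le> v" "v < ?y" | "v < x" by linarith
    then show ?thesis
    proof cases
      case 1
      have ex: "(\<exists>z\<in>insert x (?R - {?y}). v < z) \<longleftrightarrow> (\<exists>z\<in>?R. v < z)" using 1 b(2) by auto
      show ?thesis
      proof (cases "\<exists>z\<in>?R. v < z")
        case True
        note c = bumped[OF R(1) True]
        have "bumped v (insert x (?R - {?y})) = bumped v ?R"
          using c 1 b(2) R by (intro bumped_eq) auto
        moreover have "\<not> bumped v ?R < ?y" "\<not> v < ?y" "\<not> v < x" using c(2) 1 b(2) by auto
        ultimately show ?thesis unfolding R' W' R'' using ex True IH[of v] by simp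
      next
        case False
        then show ?thesis unfolding R' W' R'' using ex 1 b(2) IH[of v] by simp
      qed
    next
      case 2
      have exv: "\<exists>z\<in>?R. v < z" using b(1) 2 by auto
      have bv: "bumped v ?R = ?y"
        using R b 2 by (intro bumped_eq) (auto intro: le_less_trans)
      have next': "?y < bumped v (insert x (?R - {?y}))" if "\<exists>z\<in>insert x (?R - {?y}). v < z"
      proof -
        have f: "finite (insert x (?R - {?y}))" using R by simp
        note c = bumped[OF f that]
        have "bumped v (insert x (?R - {?y})) \<in> ?R" "bumped v (insert x (?R - {?y})) \<noteq> ?y"
          "x < bumped v (insert x (?R - {?y}))"
          using c(1,2) 2 by auto
        then show ?thesis using b(3) by (simp add: le_neq_implies_less)
      qed
      have lhs: "longest_dec (x # W) v = max (?D v) (Suc (?D ?y))" using 2 IH[of v] exv bv by simp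
      show ?thesis
      proof (cases "\<exists>z\<in>insert x (?R - {?y}). v < z")
        case True
        have "\<not> bumped v (insert x (?R - {?y})) < ?y" "?D (bumped v (insert x (?R - {?y}))) \<le> ?D ?y"
          using next'[OF True] by (auto intro: anti)
        then show ?thesis unfolding R' W' R'' lhs using True 2 by (simp add: max.assoc max.absorb1)
      next
        case False
        then show ?thesis unfolding R' W' R'' lhs if_not_P[OF False] using 2 by simp
      qed
    next
      case 3
      have exv: "\<exists>z\<in>?R. v < z" using b(1) less_trans[OF 3 b(2)] by blast
      note c = bumped[OF R(1) exv]
      have exv': "\<exists>z\<in>insert x (?R - {?y}). v < z" using 3 by blast
      have vy: "v < ?y" using b(2) 3 by simp
      have cy: "bumped v ?R \<le> ?y" using c(3)[OF b(1) vy] .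
      have lhs: "longest_dec (x # W) v = max (max (?D v) (Suc (?D (bumped v ?R)))) (Suc (max (?D x) (Suc (?D ?y))))"
        using 3 IH[of v] exv Dx by simp
      have rhs: "max (longest_dec (?y # bumped_word W) v) (Suc (longest_dec (?y # bumped_word W) d))
          = max (max (?D v) (Suc (?D ?y))) (Suc (max (?D d) (Suc (?D ?y))))" if "d < ?y" for d
        using vy that by simp
      \<comment> \<open>Either the first-row entry following \<open>v\<close> is smaller than
        \<open>x\<close> and stays, or it is \<open>?y\<close> itself and is replaced by
        \<open>x\<close>.\<close>
      show ?thesis
      proof (cases "bumped v ?R < x")
        case True
        then have eq: "bumped v (insert x (?R - {?y})) = bumped v ?R"
          using R c b(2) by (intro bumped_eq) auto
        have "?D x \<le> ?D (bumped v ?R)" "?D ?y \<le> ?D (bumped v ?R)" using True cy by (auto intro: anti)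
        moreover have "bumped v ?R < ?y" using True b(2) by simp
        ultimately show ?thesis
          unfolding R' W' R'' lhs if_P[OF exv'] eq by (subst rhs) (simp_all add: max_def)
      next
        case False
        then have "x < bumped v ?R" using c(1) R(2) by (metis linorder_neqE_nat)
        then have eqy: "bumped v ?R = ?y" using b(3)[OF c(1)] cy by simp
        have "x \<le> z" if "z \<in> ?R" "v < z" for z
          using c(3)[OF that] eqy b(2) by simp
        then have eq: "bumped v (insert x (?R - {?y})) = x"
          using R 3 by (intro bumped_eq) auto
        have "?D ?y \<le> ?D x" using b(2) by (intro anti) simp
        then show ?thesis
          unfolding R' W' R'' lhs if_P[OF exv'] eq eqy using b(2) by (subst rhs) (simp_all add: max_def)
      qed
    qed
  qed
qed simp

text \<open>A bumped letter leaves a smaller entry in its place, and any later bump of that entry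
  puts a still smaller one there.\<close>

lemma bumped_word_gt: "distinct W \<Longrightarrow> y \<in> set (bumped_word W) \<Longrightarrow> \<exists>r\<in>first_row (insertion_tableau W). r < y"
proof (induction W)
  case (Cons x W)
  let ?R = "first_row (insertion_tableau W)"
  have R: "finite ?R" using insertion_tableau[of W] Cons.prems by (simp add: finite_first_row)
  show ?case
  proof (cases "\<exists>y\<in>?R. x < y")
    case True
    note b = bumped[OF R True]
    show ?thesis
    proof (cases "y = bumped x ?R")
      case False
      then obtain r where r: "r \<in> ?R" "r < y" using Cons True by (auto simp: Let_def)
      show ?thesis
        using r b(2) True by (cases "r = bumped x ?R") (auto simp: first_row_insert bump_row_def)
    qed (use b(2) True in \<open>auto simp: first_row_insert bump_row_def\<close>)
  next
    case False
    then show ?thesis using Cons by (auto simp: first_row_insert bump_row_def)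
  qed
qed simp

lemma distinct_bumped_word: "distinct W \<Longrightarrow> distinct (bumped_word W) \<and> set (bumped_word W) \<subseteq> set W - first_row (insertion_tableau W)"
proof (induction W)
  case (Cons x W)
  let ?R = "first_row (insertion_tableau W)"
  have T: "tableau (insertion_tableau W)" "\<Union>(set (insertion_tableau W)) = set W"
    using insertion_tableau[of W] Cons.prems by auto
  have R: "finite ?R" "?R \<subseteq> set W" using T first_row_subset[of "insertion_tableau W"] by (auto simp: finite_first_row)
  show ?case
  proof (cases "\<exists>y\<in>?R. x < y")
    case True
    note b = bumped[OF R(1) True]
    then show ?thesis using Cons True R by (auto simp: first_row_insert bump_row_def Let_def)
  next
    case False
    then show ?thesis using Cons by (auto simp: first_row_insert bump_row_def)
  qed
qed simp

lemma length_bumped_word: "W \<noteq> [] \<Longrightarrow> length (bumped_word W) < length W"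
proof (induction W)
  case (Cons x W)
  show ?case by (cases "W = []") (use Cons in \<open>auto simp: Let_def\<close>)
qed simp

lemma longest_dec_low: "(\<And>x. x \<in> set W \<Longrightarrow> v < x) \<Longrightarrow> u \<le> v \<Longrightarrow> longest_dec W u = longest_dec W v"
proof (induction W)
  case (Cons x W)
  then have "v < x" "u < x" by (auto intro: le_less_trans)
  then show ?case using Cons by simp
qed simp

text \<open>Passing to the bumped word removes the first row and shortens the longest decreasing
  subsequence by exactly one: all bumped letters exceed the smallest first-row entry, so both terms
  of \<open>longest_dec_bumped\<close> involve the same length and the successor wins.\<close>

theorem longest_dec_length:
  "distinct W \<Longrightarrow> 0 \<notin> set W \<Longrightarrow> longest_dec W 0 = length (insertion_tableau W)"
proof (induction "length W" arbitrary: W rule: less_induct)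
  case less
  show ?case
  proof (cases "W = []")
    case False
    let ?R = "first_row (insertion_tableau W)"
    let ?W = "bumped_word W"
    have T: "tableau (insertion_tableau W)" "\<Union>(set (insertion_tableau W)) = set W"
      using insertion_tableau[of W] less.prems by auto
    have R: "finite ?R" "0 \<notin> ?R" "?R \<noteq> {}"
      using T less.prems first_row_subset[of "insertion_tableau W"] first_row_nonempty[OF T(1)] False
      by (auto simp: finite_first_row)
    then have ex: "\<exists>y\<in>?R. 0 < y" by (metis all_not_in_conv bot_nat_0.not_eq_extremum)
    note b = bumped[OF R(1) ex]
    have "bumped 0 ?R < y" if y: "y \<in> set ?W" for y
    proof -
      obtain r where "r \<in> ?R" "r < y" using bumped_word_gt[OF less.prems(1) y] by auto
      then show ?thesis using b(3)[of r] R(2) by (metis bot_nat_0.not_eq_extremum le_less_trans)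
    qed
    then have "longest_dec ?W 0 = longest_dec ?W (bumped 0 ?R)" by (intro longest_dec_low) auto
    then have "longest_dec W 0 = Suc (longest_dec ?W 0)"
      using longest_dec_bumped[OF less.prems(1), of 0] ex by simp
    also have "longest_dec ?W 0 = length (insertion_tableau ?W)"
      using less length_bumped_word[OF False] distinct_bumped_word[OF less.prems(1)] by (intro less.hyps) auto
    finally show ?thesis by (subst insertion_tableau_bumped[OF False]) simp
  qed simp
qed

section \<open>Matchings and row insertion\<close>

text \<open>Arbitrary ground sets arise once the points whose partners have been read are set
  aside.\<close>

definition matchings :: "nat set \<Rightarrow> matching set" where
  "matchings S = {M. partition_on S M \<and> (\<forall>B\<in>M. card B = 1 \<or> card B = 2)}"

lemma is_matching_iff: "is_matching n M \<longleftrightarrow> M \<in> matchings {1..n}"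
  by (simp add: is_matching_def matchings_def)

lemma finite_matchings: "finite S \<Longrightarrow> finite (matchings S)"
  by (rule finite_subset[of _ "Pow (Pow S)"]) (auto simp: matchings_def partition_on_def)

lemma insert_matching:
  assumes "M \<in> matchings (S - B)" "B \<subseteq> S" "card B = 1 \<or> card B = 2"
  shows "insert B M \<in> matchings S" "B \<notin> M"
proof -
  have "B \<noteq> {}" using assms(3) by auto
  then show "insert B M \<in> matchings S" "B \<notin> M"
    using assms by (auto simp: matchings_def partition_on_def disjoint_def)
qed

lemma sum_matchings_split:
  fixes f :: "matching \<Rightarrow> int"
  assumes S: "finite S" and m: "m \<in> S"
  shows "(\<Sum>M\<in>matchings S. f M) = (\<Sum>M\<in>matchings (S - {m}). f (insert {m} M))
    + (\<Sum>x\<in>S - {m}. \<Sum>M\<in>matchings (S - {x, m}). f (insert {x, m} M))"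
proof -
  let ?Bs = "insert {m} ((\<lambda>x. {x, m}) ` (S - {m}))"
  let ?P = "SIGMA B:?Bs. matchings (S - B)"
  have Bs: "B \<subseteq> S \<and> m \<in> B \<and> (card B = 1 \<or> card B = 2)" if "B \<in> ?Bs" for B
    using that m by auto
  have block: "C = B" if "M \<in> matchings (S - B)" "B \<in> ?Bs" "C \<in> insert B M" "m \<in> C" for B C M
    using that Bs[OF that(2)] by (auto simp: matchings_def partition_on_def)
  have bij: "bij_betw (\<lambda>(B, M). insert B M) ?P (matchings S)"
  proof (rule bij_betwI')
    fix p q assume pq: "p \<in> ?P" "q \<in> ?P"
    obtain B M C N where eq: "p = (B, M)" "q = (C, N)" by (cases p; cases q)
    have B: "B \<in> ?Bs" "M \<in> matchings (S - B)" and C: "C \<in> ?Bs" "N \<in> matchings (S - C)"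
      using pq eq by auto
    have notin: "B \<notin> M" "C \<notin> N"
      using insert_matching(2)[OF B(2)] insert_matching(2)[OF C(2)] Bs[OF B(1)] Bs[OF C(1)] by auto
    have "(B, M) = (C, N)" if "insert B M = insert C N"
    proof -
      have "C \<in> insert B M" using that by auto
      then have "C = B" using block[OF B(2,1)] Bs[OF C(1)] by auto
      then show ?thesis using that notin by auto
    qed
    then show "((case p of (B, M) \<Rightarrow> insert B M) = (case q of (B, M) \<Rightarrow> insert B M)) = (p = q)"
      using eq by auto
  next
    fix p assume p: "p \<in> ?P"
    obtain B M where eq: "p = (B, M)" by (cases p)
    then have "M \<in> matchings (S - B)" "B \<in> ?Bs" using p by auto
    then show "(case p of (B, M) \<Rightarrow> insert B M) \<in> matchings S"
      using insert_matching(1)[of M S B] Bs[of B] by (simp add: eq)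
  next
    fix M assume M: "M \<in> matchings S"
    then obtain B where B: "B \<in> M" "m \<in> B" using m by (auto simp: matchings_def partition_on_def)
    have "card B = 1 \<or> card B = 2" "B \<subseteq> S" using M B by (auto simp: matchings_def partition_on_def)
    then have Bs: "B \<in> ?Bs"
    proof (elim disjE)
      assume "card B = 1"
      then show ?thesis using B(2) by (auto simp: card_1_singleton_iff)
    next
      assume "card B = 2" and sub: "B \<subseteq> S"
      then obtain y z where yz: "B = {y, z}" "y \<noteq> z" by (auto simp: card_2_iff)
      then have "B = {y, m} \<and> y \<noteq> m \<or> B = {z, m} \<and> z \<noteq> m" using B(2) by auto
      then show ?thesis using sub yz by auto
    qed
    have "M - {B} \<in> matchings (S - B)"
      using M B by (auto simp: matchings_def partition_on_def disjoint_def)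
    then show "\<exists>p\<in>?P. M = (case p of (B, M) \<Rightarrow> insert B M)"
      using Bs B(1) by (intro bexI[of _ "(B, M - {B})"]) auto
  qed
  have fin: "finite (matchings (S - B))" for B using S by (auto intro: finite_matchings)
  have "(\<Sum>M\<in>matchings S. f M) = (\<Sum>p\<in>?P. f (case p of (B, M) \<Rightarrow> insert B M))"
    by (rule sum.reindex_bij_betw[OF bij, symmetric])
  also have "\<dots> = (\<Sum>B\<in>?Bs. \<Sum>M\<in>matchings (S - B). f (insert B M))"
    using S fin by (subst sum.Sigma) (auto intro!: sum.cong)
  also have "\<dots> = (\<Sum>M\<in>matchings (S - {m}). f (insert {m} M))
      + (\<Sum>B\<in>(\<lambda>x. {x, m}) ` (S - {m}). \<Sum>M\<in>matchings (S - B). f (insert B M))"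
    using S by (intro sum.insert) (auto simp: doubleton_eq_iff)
  also have "(\<Sum>B\<in>(\<lambda>x. {x, m}) ` (S - {m}). \<Sum>M\<in>matchings (S - B). f (insert B M))
      = (\<Sum>x\<in>S - {m}. \<Sum>M\<in>matchings (S - {x, m}). f (insert {x, m} M))"
    by (subst sum.reindex) (auto simp: inj_on_def doubleton_eq_iff)
  finally show ?thesis .
qed

definition opener :: "matching \<Rightarrow> nat \<Rightarrow> nat" where
  "opener M j = (THE i. i < j \<and> {i, j} \<in> M)"

text \<open>Reading a matching from right to left, closing points insert the corresponding opener into the
  tableau and opening points remove the largest entry.\<close>

fun matching_weight :: "nat \<Rightarrow> nat \<Rightarrow> ((nat \<Rightarrow> nat) \<Rightarrow> int) \<Rightarrow> matching \<Rightarrow> nat \<Rightarrow> nat list \<Rightarrow> int" where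
  "matching_weight h w st M 0 W = 1"
| "matching_weight h w st M (Suc t) W =
    (if Suc t \<in> set W then matching_weight h w st M t (remove1 (Suc t) W)
     else if {Suc t} \<in> M then st (shape (insertion_tableau W)) * matching_weight h w st M t W
     else if in_box h w (shape (insertion_tableau (opener M (Suc t) # W)))
       then matching_weight h w st M t (opener M (Suc t) # W) else 0)"

lemma matching_weight_cong:
  "(\<And>B. B \<subseteq> {..t} \<Longrightarrow> B \<in> M \<longleftrightarrow> B \<in> N) \<Longrightarrow> matching_weight h w st M t W = matching_weight h w st N t W"
proof (induction t arbitrary: W)
  case (Suc t)
  have IH: "matching_weight h w st M t V = matching_weight h w st N t V" for V
    by (intro Suc.IH Suc.prems) (auto elim: order_trans)
  have "{Suc t} \<in> M \<longleftrightarrow> {Suc t} \<in> N" using Suc.prems[of "{Suc t}"] by simp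
  moreover have "i < Suc t \<and> {i, Suc t} \<in> M \<longleftrightarrow> i < Suc t \<and> {i, Suc t} \<in> N" for i
    using Suc.prems[of "{i, Suc t}"] by auto
  then have "opener M (Suc t) = opener N (Suc t)" by (simp add: opener_def)
  ultimately show ?case using IH by simp
qed simp

text \<open>\<open>W\<close> lists the openers of arcs whose closers have been read; these points
  are taken. If \<open>Suc t\<close> is not among them, splitting by its block gives a stationary
  step and one insertion for each free opener \<open>x\<close>, as in \<open>unwind\<close>.\<close>

lemma sum_matching_weight:
  assumes "distinct W" "set W \<subseteq> {1..t}"
  shows "(\<Sum>M\<in>matchings ({1..t} - set W). matching_weight h w st M t W) = unwind h w st t (insertion_tableau W)"
  using assms
proof (induction t arbitrary: W)
  case 0
  have "matchings {} = {{}}" by (auto simp: matchings_def partition_on_def)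
  then show ?case using 0 by simp
next
  case (Suc t)
  have ent: "\<Union>(set (insertion_tableau W)) = set W" using insertion_tableau[OF Suc.prems(1)] by simp
  show ?case
  proof (cases "Suc t \<in> set W")
    case True
    have rem: "insertion_tableau (remove1 (Suc t) W) = remove_entry (Suc t) (insertion_tableau W)"
      using Suc.prems True by (intro insertion_tableau_remove_max) auto
    have "{1..Suc t} - set W = {1..t} - set (remove1 (Suc t) W)"
      using Suc.prems True by (auto simp: atLeastAtMostSuc_conv)
    moreover have "distinct (remove1 (Suc t) W)" "set (remove1 (Suc t) W) \<subseteq> {1..t}"
      using Suc.prems by (auto simp: atLeastAtMostSuc_conv)
    ultimately show ?thesis
      using True Suc.IH[of "remove1 (Suc t) W"] by (simp add: ent rem del: Union_iff)
  next
    case False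
    let ?S = "{1..Suc t} - set W"
    let ?m = "Suc t"
    have S: "?S - {?m} = {1..t} - set W" "?S - {x, ?m} = {1..t} - set (x # W)" for x
      by (auto simp: atLeastAtMostSuc_conv)
    have sub: "set W \<subseteq> {1..t}" using Suc.prems False by (auto simp: atLeastAtMostSuc_conv)
    have cong: "matching_weight h w st (insert B M) t V = matching_weight h w st M t V" if "?m \<in> B" for B M V
      using that by (intro matching_weight_cong) auto
    have "matching_weight h w st (insert {?m} M) ?m W
        = st (shape (insertion_tableau W)) * matching_weight h w st M t W" for M
      using False by (simp add: cong)
    then have 1: "(\<Sum>M\<in>matchings (?S - {?m}). matching_weight h w st (insert {?m} M) ?m W)
        = st (shape (insertion_tableau W)) * unwind h w st t (insertion_tableau W)"
      unfolding S Suc.IH[OF Suc.prems(1) sub, symmetric] sum_distrib_left by simp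
    have "(\<Sum>M\<in>matchings (?S - {x, ?m}). matching_weight h w st (insert {x, ?m} M) ?m W)
        = (if in_box h w (shape (row_insert x (insertion_tableau W))) then unwind h w st t (row_insert x (insertion_tableau W)) else 0)"
      if x: "x \<in> {1..t} - set W" for x
    proof -
      have "matching_weight h w st (insert {x, ?m} M) ?m W
          = (if in_box h w (shape (insertion_tableau (x # W))) then matching_weight h w st M t (x # W) else 0)"
        if M: "M \<in> matchings (?S - {x, ?m})" for M
      proof -
        have m: "?m \<notin> B" if "B \<in> M" for B
          using that M by (auto simp: matchings_def partition_on_def)
        have "i < ?m \<and> {i, ?m} \<in> insert {x, ?m} M \<longleftrightarrow> i = x" for i
          using m[of "{i, ?m}"] x by (auto simp: doubleton_eq_iff)
        then have "opener (insert {x, ?m} M) ?m = x" by (simp add: opener_def)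
        moreover have "{?m} \<notin> insert {x, ?m} M" using m[of "{?m}"] x by (auto simp: doubleton_eq_iff)
        ultimately show ?thesis using False by (simp add: cong)
      qed
      then have "(\<Sum>M\<in>matchings (?S - {x, ?m}). matching_weight h w st (insert {x, ?m} M) ?m W)
        = (\<Sum>M\<in>matchings (?S - {x, ?m}). if in_box h w (shape (insertion_tableau (x # W))) then matching_weight h w st M t (x # W) else 0)"
        by (rule sum.cong[OF refl])
      also have "\<dots> = (if in_box h w (shape (insertion_tableau (x # W)))
          then \<Sum>M\<in>matchings ({1..t} - set (x # W)). matching_weight h w st M t (x # W) else 0)"
        unfolding S by simp
      also have "(\<Sum>M\<in>matchings ({1..t} - set (x # W)). matching_weight h w st M t (x # W))
          = unwind h w st t (insertion_tableau (x # W))"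
        using Suc.prems x sub by (intro Suc.IH) auto
      finally show ?thesis by simp
    qed
    then have "(\<Sum>x\<in>?S - {?m}. \<Sum>M\<in>matchings (?S - {x, ?m}). matching_weight h w st (insert {x, ?m} M) ?m W)
        = (\<Sum>x\<in>{1..t} - set W. if in_box h w (shape (row_insert x (insertion_tableau W)))
             then unwind h w st t (row_insert x (insertion_tableau W)) else 0)"
      unfolding S(1) by (intro sum.cong refl)
    then show ?thesis
      using False 1 by (subst sum_matchings_split[of _ ?m]) (simp_all add: ent del: Union_iff matching_weight.simps)
  qed
qed

text \<open>The reading starts with no open arc, and the empty tableau is the only one of empty
  shape, so the sum over tableaux has a single term.\<close>

theorem sum_matching_weight_eq_box_walks:
  "(\<Sum>M | is_matching n M. matching_weight h w st M n []) = box_walks h w st n (\<lambda>_. 0)"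
proof -
  have "tableaux n (\<lambda>_. 0) = {[]}"
    using shape_eq_0_iff[of _ 0] by (auto simp: tableaux_def) (metis le_zero_eq length_0_conv)
  moreover have "in_box h w (\<lambda>_. 0)" by (simp add: in_box_def)
  ultimately show ?thesis
    using sum_matching_weight[of "[]" n h w st] sum_unwind[of h w "\<lambda>_. 0" st n] by (simp add: is_matching_iff)
qed

section \<open>Subsequences of sorted words\<close>

lemma longest_iff:
  fixes R :: "nat \<Rightarrow> nat \<Rightarrow> bool"
  assumes trans: "transp R"
  shows "k \<le> longest R W v \<longleftrightarrow> (\<exists>ys. subseq ys W \<and> sorted_wrt R ys \<and> (\<forall>y\<in>set ys. R v y) \<and> length ys = k)"
proof (induction W arbitrary: v k)
  case (Cons x W)
  show ?case
  proof
    assume "k \<le> longest R (x # W) v"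
    then consider "k \<le> longest R W v" | "R v x" "k \<le> Suc (longest R W x)"
      by (auto simp: le_max_iff_disj split: if_splits)
    then show "\<exists>ys. subseq ys (x # W) \<and> sorted_wrt R ys \<and> (\<forall>y\<in>set ys. R v y) \<and> length ys = k"
    proof cases
      case 1
      then show ?thesis using Cons by (meson list_emb_Cons)
    next
      case 2
      show ?thesis
      proof (cases k)
        case 0
        then show ?thesis by (intro exI[of _ "[]"]) simp
      next
        case (Suc l)
        then have "l \<le> longest R W x" using 2 by simp
        then obtain ys where "subseq ys W" "sorted_wrt R ys" "\<forall>y\<in>set ys. R x y" "length ys = l"
          using Cons by meson
        then show ?thesis using Suc 2 by (intro exI[of _ "x # ys"]) (auto dest: transpD[OF trans])
      qed
    qed
  next
    assume "\<exists>ys. subseq ys (x # W) \<and> sorted_wrt R ys \<and> (\<forall>y\<in>set ys. R v y) \<and> length ys = k"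
    then obtain ys where ys: "subseq ys (x # W)" "sorted_wrt R ys" "\<forall>y\<in>set ys. R v y" "length ys = k" by blast
    show "k \<le> longest R (x # W) v"
    proof (cases "subseq ys W")
      case True
      then have "k \<le> longest R W v" unfolding Cons using ys by blast
      then show ?thesis by simp
    next
      case False
      then obtain zs where zs: "ys = x # zs" "subseq zs W"
        using ys(1) False by (cases ys) (auto split: if_splits)
      then have "length zs \<le> longest R W x" unfolding Cons using ys(2) by (intro exI[of _ zs]) simp
      then show ?thesis using zs ys by auto
    qed
  qed
qed auto

lemma subseq_of_sorted_by_key:
  fixes c :: "'a \<Rightarrow> nat"
  assumes "sorted_wrt (\<lambda>x y. c x < c y) W" "sorted_wrt (\<lambda>x y. c x < c y) ys" "set ys \<subseteq> set W"
  shows "subseq ys W"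
  using assms
proof (induction W arbitrary: ys)
  case (Cons x W)
  show ?case
  proof (cases ys)
    case ys: (Cons y zs)
    show ?thesis
    proof (cases "y = x")
      case True
      then have "set zs \<subseteq> set W" using Cons.prems ys by fastforce
      then show ?thesis using True ys Cons by auto
    next
      case False
      then have "c x < c y" using Cons.prems ys by auto
      then have "x \<notin> set ys" using Cons.prems(2) ys False by auto
      then have "subseq ys W" using Cons by auto
      then show ?thesis by (rule list_emb_Cons)
    qed
  qed simp
qed simp

lemma sorted_wrt_subseq: "subseq ys W \<Longrightarrow> sorted_wrt R W \<Longrightarrow> sorted_wrt R ys"
proof (induction W arbitrary: ys)
  case (Cons x W)
  show ?case
  proof (cases "subseq ys W")
    case True
    then show ?thesis using Cons by simp
  next
    case False
    then obtain zs where zs: "ys = x # zs" "subseq zs W"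
      using Cons.prems(1) False by (cases ys) (auto split: if_splits)
    then have "set zs \<subseteq> set W" by (auto elim!: list_emb_set)
    then have "\<forall>z\<in>set zs. R x z" using Cons.prems(2) by auto
    moreover have "sorted_wrt R zs" using Cons.IH[OF zs(2)] Cons.prems(2) by simp
    ultimately show ?thesis by (simp add: zs(1))
  qed
next
  case Nil
  then have "ys = []" by (cases ys) auto
  then show ?case by simp
qed

section \<open>Crossings and nestings\<close>

text \<open>The number \<open>s\<close> stands for the gap between \<open>s\<close> and
  \<open>s + 1\<close>; all arcs of the crossing pass over it.\<close>

definition crossing_at :: "matching \<Rightarrow> nat \<Rightarrow> nat \<Rightarrow> bool" where
  "crossing_at M s k \<longleftrightarrow> (\<exists>i j. crossing_arcs M k i j \<and> i k \<le> s \<and> s < j 1)"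

definition nesting_at :: "matching \<Rightarrow> nat \<Rightarrow> nat \<Rightarrow> bool" where
  "nesting_at M s k \<longleftrightarrow> (\<exists>i j. nesting_arcs M k i j \<and> i k \<le> s \<and> s < j k)"

definition closer :: "matching \<Rightarrow> nat \<Rightarrow> nat" where
  "closer M i = (THE j. i < j \<and> {i, j} \<in> M)"

text \<open>The openers of the arcs over the gap at \<open>s\<close>, nearest closer first: reading
  from right to left, the nearest closer is the one read last, so its opener heads the word.\<close>

definition open_word :: "matching \<Rightarrow> nat \<Rightarrow> nat list \<Rightarrow> bool" where
  "open_word M s W \<longleftrightarrow> set W = {i. i \<le> s \<and> (\<exists>j>s. {i, j} \<in> M)} \<and>
     sorted_wrt (\<lambda>x y. closer M x < closer M y) W"

lemma block_unique: "is_matching n M \<Longrightarrow> B \<in> M \<Longrightarrow> C \<in> M \<Longrightarrow> x \<in> B \<Longrightarrow> x \<in> C \<Longrightarrow> B = C"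
  by (auto simp: is_matching_def partition_on_def disjoint_def)

lemma block_subset: "is_matching n M \<Longrightarrow> B \<in> M \<Longrightarrow> B \<subseteq> {1..n}"
  by (auto simp: is_matching_def partition_on_def)

lemma partner_unique:
  assumes "is_matching n M" "{x, y} \<in> M" "{x, z} \<in> M" "x \<noteq> y" "x \<noteq> z"
  shows "y = z"
  using block_unique[OF assms(1-3), of x] assms(4,5) by (auto simp: doubleton_eq_iff)

lemma closer_eq:
  assumes "is_matching n M" "i < j" "{i, j} \<in> M"
  shows "closer M i = j"
  unfolding closer_def using assms partner_unique[OF assms(1), of i] by (intro the_equality) auto

lemma opener_eq:
  assumes "is_matching n M" "i < j" "{i, j} \<in> M"
  shows "opener M j = i"
  unfolding opener_def using assms partner_unique[OF assms(1), of j] by (intro the_equality) (auto simp: insert_commute)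

lemma open_word_closer:
  assumes "is_matching n M" "open_word M s W" "x \<in> set W"
  shows "0 < x" "x \<le> s" "s < closer M x" "(x, closer M x) \<in> arcs M"
proof -
  obtain j where j: "j > s" "{x, j} \<in> M" "x \<le> s" using assms by (auto simp: open_word_def)
  have "closer M x = j" using closer_eq[OF assms(1), of x j] j by simp
  then show "0 < x" "x \<le> s" "s < closer M x" "(x, closer M x) \<in> arcs M"
    using j block_subset[OF assms(1) j(2)] by (auto simp: arcs_def)
qed

lemma open_word_memI:
  "(i, j) \<in> arcs M \<Longrightarrow> i \<le> s \<Longrightarrow> s < j \<Longrightarrow> open_word M s W \<Longrightarrow> i \<in> set W"
  by (auto simp: open_word_def arcs_def)

lemma open_word_distinct: "open_word M s W \<Longrightarrow> distinct W"
  using sorted_wrt_map[of "(<)" "closer M" W] strict_sorted_iff[of "map (closer M) W"]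
  by (auto simp: open_word_def distinct_map)

text \<open>The word is ordered by closers, so crossing arcs are those whose openers increase along
  the list, that is, decrease in the order of insertion.\<close>

lemma crossing_at_iff:
  assumes M: "is_matching n M" and W: "open_word M s W" and k: "0 < k"
  shows "crossing_at M s k \<longleftrightarrow> k \<le> longest_dec W 0"
proof
  assume "crossing_at M s k"
  then obtain i j where ij: "crossing_arcs M k i j" "i k \<le> s" "s < j 1" by (auto simp: crossing_at_def)
  then have arc: "(i t, j t) \<in> arcs M" if "t \<in> {1..k}" for t
    using that by (auto simp: crossing_arcs_def)
  have imono: "i t < i u" and jmono: "j t < j u" if "1 \<le> t" "t < u" "u \<le> k" for t u
    using ij(1) that by (auto simp: crossing_arcs_def strict_mono_on_def)
  have mem: "i t \<in> set W" if t: "t \<in> {1..k}" for t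
  proof (rule open_word_memI[OF arc[OF t] _ _ W])
    show "i t \<le> s" using imono[of t k] ij(2) t by (cases "t = k") auto
    show "s < j t" using jmono[of 1 t] ij(3) t by (cases "t = 1") auto
  qed
  have clos: "closer M (i t) = j t" if "t \<in> {1..k}" for t
    using arc[OF that] closer_eq[OF M] by (auto simp: arcs_def)
  let ?ys = "map i [1..<Suc k]"
  have "subseq ?ys W"
  proof (rule subseq_of_sorted_by_key[of "closer M"])
    show "sorted_wrt (\<lambda>x y. closer M x < closer M y) W" using W by (simp add: open_word_def)
    show "sorted_wrt (\<lambda>x y. closer M x < closer M y) ?ys"
      using clos jmono by (auto simp: sorted_wrt_iff_nth_less simp del: upt_Suc)
    show "set ?ys \<subseteq> set W" using mem by auto
  qed
  moreover have "sorted_wrt (<) ?ys" using imono by (auto simp: sorted_wrt_iff_nth_less simp del: upt_Suc)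
  moreover have "\<forall>y\<in>set ?ys. 0 < y" using mem open_word_closer(1)[OF M W] by auto
  ultimately show "k \<le> longest_dec W 0" unfolding longest_iff[OF transp_on_less] by (intro exI[of _ ?ys]) simp
next
  assume "k \<le> longest_dec W 0"
  then obtain ys where ys: "subseq ys W" "sorted_wrt (<) ys" "length ys = k"
    unfolding longest_iff[OF transp_on_less] by blast
  have sub: "set ys \<subseteq> set W" using ys(1) by (auto elim!: list_emb_set)
  have sc: "sorted_wrt (\<lambda>x y. closer M x < closer M y) ys"
    using sorted_wrt_subseq[OF ys(1)] W by (simp add: open_word_def)
  define i where "i t = ys ! (t - 1)" for t
  have mem: "i t \<in> set W" if "t \<in> {1..k}" for t
    using that sub ys(3) by (auto simp: i_def intro!: subsetD[OF sub] nth_mem)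
  have "crossing_arcs M k i (closer M \<circ> i)"
    unfolding crossing_arcs_def
  proof (intro conjI ballI)
    fix t assume "t \<in> {1..k}"
    then show "(i t, (closer M \<circ> i) t) \<in> arcs M" using open_word_closer(4)[OF M W mem] by simp
  next
    show "strict_mono_on {1..k} i" "strict_mono_on {1..k} (closer M \<circ> i)"
      using ys sc by (auto simp: strict_mono_on_def i_def sorted_wrt_iff_nth_less)
    show "i k < (closer M \<circ> i) 1"
      using open_word_closer(2)[OF M W mem[of k]] open_word_closer(3)[OF M W mem[of 1]] k by simp
  qed
  then show "crossing_at M s k"
    unfolding crossing_at_def
    using open_word_closer(2)[OF M W mem[of k]] open_word_closer(3)[OF M W mem[of 1]] k
    by (intro exI[of _ i] exI[of _ "closer M \<circ> i"]) simp
qed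

text \<open>Nested arcs have openers that decrease while the closers increase along the list, hence
  openers that increase in the order of insertion.\<close>

lemma nesting_at_iff:
  assumes M: "is_matching n M" and W: "open_word M s W" and k: "0 < k"
  shows "nesting_at M s k \<longleftrightarrow> k \<le> longest_inc W (Suc s)"
proof
  assume "nesting_at M s k"
  then obtain i j where ij: "nesting_arcs M k i j" "i k \<le> s" "s < j k" by (auto simp: nesting_at_def)
  then have arc: "(i t, j t) \<in> arcs M" if "t \<in> {1..k}" for t
    using that by (auto simp: nesting_arcs_def)
  have imono: "i t < i u" and jmono: "j u < j t" if "1 \<le> t" "t < u" "u \<le> k" for t u
    using ij(1) that by (auto simp: nesting_arcs_def monotone_on_def)
  have mem: "i t \<in> set W" if t: "t \<in> {1..k}" for t
  proof (rule open_word_memI[OF arc[OF t] _ _ W])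
    show "i t \<le> s" using imono[of t k] ij(2) t by (cases "t = k") auto
    show "s < j t" using jmono[of t k] ij(3) t by (cases "t = k") auto
  qed
  have clos: "closer M (i t) = j t" if "t \<in> {1..k}" for t
    using arc[OF that] closer_eq[OF M] by (auto simp: arcs_def)
  \<comment> \<open>The arcs are taken from the innermost outwards, because the closers have to
    increase.\<close>
  let ?ys = "map (\<lambda>t. i (k - t)) [0..<k]"
  have "subseq ?ys W"
  proof (rule subseq_of_sorted_by_key[of "closer M"])
    show "sorted_wrt (\<lambda>x y. closer M x < closer M y) W" using W by (simp add: open_word_def)
    show "sorted_wrt (\<lambda>x y. closer M x < closer M y) ?ys"
      using clos jmono by (auto simp: sorted_wrt_iff_nth_less)
    show "set ?ys \<subseteq> set W" using mem by auto
  qed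
  moreover have "sorted_wrt (>) ?ys" using imono by (auto simp: sorted_wrt_iff_nth_less)
  moreover have "\<forall>y\<in>set ?ys. y < Suc s" using mem open_word_closer(2)[OF M W] by (auto simp: less_Suc_eq_le)
  ultimately show "k \<le> longest_inc W (Suc s)" unfolding longest_iff[OF transp_on_greater] by (intro exI[of _ ?ys]) simp
next
  assume "k \<le> longest_inc W (Suc s)"
  then obtain ys where ys: "subseq ys W" "sorted_wrt (>) ys" "length ys = k"
    unfolding longest_iff[OF transp_on_greater] by blast
  have sub: "set ys \<subseteq> set W" using ys(1) by (auto elim!: list_emb_set)
  have sc: "sorted_wrt (\<lambda>x y. closer M x < closer M y) ys"
    using sorted_wrt_subseq[OF ys(1)] W by (simp add: open_word_def)
  define i where "i t = ys ! (k - t)" for t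
  have mem: "i t \<in> set W" if "t \<in> {1..k}" for t
    using that sub ys(3) by (auto simp: i_def intro!: subsetD[OF sub] nth_mem)
  have "nesting_arcs M k i (closer M \<circ> i)"
    unfolding nesting_arcs_def
  proof (intro conjI ballI)
    fix t assume "t \<in> {1..k}"
    then show "(i t, (closer M \<circ> i) t) \<in> arcs M" using open_word_closer(4)[OF M W mem] by simp
  next
    show "strict_mono_on {1..k} i" "strict_antimono_on {1..k} (closer M \<circ> i)"
      using ys sc by (auto simp: monotone_on_def i_def sorted_wrt_iff_nth_less)
    show "i k < (closer M \<circ> i) k"
      using open_word_closer(2,3)[OF M W mem[of k]] k by simp
  qed
  then show "nesting_at M s k"
    unfolding nesting_at_def
    using open_word_closer(2,3)[OF M W mem[of k]] k
    by (intro exI[of _ i] exI[of _ "closer M \<circ> i"]) simp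
qed

lemma in_box_shape_iff:
  assumes M: "is_matching n M" and W: "open_word M s W"
  shows "in_box h w (shape (insertion_tableau W)) \<longleftrightarrow> \<not> crossing_at M s (h + 1) \<and> \<not> nesting_at M s (w + 1)"
    and "0 < h \<Longrightarrow> 0 < shape (insertion_tableau W) (h - 1) \<longleftrightarrow> crossing_at M s h"
    and "0 < w \<Longrightarrow> w \<le> shape (insertion_tableau W) 0 \<longleftrightarrow> nesting_at M s w"
proof -
  let ?T = "insertion_tableau W"
  have d: "distinct W" using W by (rule open_word_distinct)
  then have T: "tableau ?T" by (simp add: insertion_tableau)
  have len: "longest_dec W 0 = length ?T"
    using d open_word_closer(1)[OF M W] by (intro longest_dec_length) auto
  have inc: "longest_inc W (Suc s) = shape ?T 0"
    using d open_word_closer(2)[OF M W] by (intro longest_inc_shape) (auto simp: less_Suc_eq_le)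
  note cr = crossing_at_iff[OF M W] and ne = nesting_at_iff[OF M W]
  show "in_box h w (shape ?T) \<longleftrightarrow> \<not> crossing_at M s (h + 1) \<and> \<not> nesting_at M s (w + 1)"
    using shape_decreasing[OF T] shape_eq_0_iff[OF T, of h] by (auto simp: in_box_def cr ne len inc)
  show "0 < h \<Longrightarrow> 0 < shape ?T (h - 1) \<longleftrightarrow> crossing_at M s h"
    using shape_eq_0_iff[OF T, of "h - 1"] by (auto simp: cr len)
  show "0 < w \<Longrightarrow> w \<le> shape ?T 0 \<longleftrightarrow> nesting_at M s w"
    by (auto simp: ne inc)
qed

section \<open>From shapes of tableaux to weights of fixed points\<close>

definition fixed_point_weight :: "bool \<Rightarrow> bool \<Rightarrow> nat \<Rightarrow> nat \<Rightarrow> matching \<Rightarrow> nat \<Rightarrow> int" where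
  "fixed_point_weight p q h w M v = 1 - of_bool (p \<and> crossing_at M v h) - of_bool (q \<and> nesting_at M v w)"

definition bounded_at :: "nat \<Rightarrow> nat \<Rightarrow> matching \<Rightarrow> nat \<Rightarrow> bool" where
  "bounded_at h w M s \<longleftrightarrow> \<not> crossing_at M s (h + 1) \<and> \<not> nesting_at M s (w + 1)"

text \<open>Reading from right to left, only a closing point creates a new open arc. At all other
  points the arcs over the next gap already lie over the current one and the bounds are inherited;
  hence \<open>matching_weight\<close> tests the box only at closing points.\<close>

lemma bounded_at_mono:
  assumes "\<And>i j. (i, j) \<in> arcs M \<Longrightarrow> i \<le> s \<Longrightarrow> s < j \<Longrightarrow> i \<le> t \<and> t < j" "bounded_at h w M t"
  shows "bounded_at h w M s"
proof -
  have c: "crossing_at M t k" if cr: "crossing_at M s k" and k: "0 < k" for k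
  proof -
    obtain i j where ij: "crossing_arcs M k i j" "i k \<le> s" "s < j 1" using cr by (auto simp: crossing_at_def)
    have "i 1 \<le> i k" "j 1 \<le> j k"
      using ij(1) k by (cases "k = 1"; auto simp: crossing_arcs_def strict_mono_on_def intro!: less_imp_le)+
    moreover have "(i 1, j 1) \<in> arcs M" "(i k, j k) \<in> arcs M" using ij(1) k by (auto simp: crossing_arcs_def)
    ultimately have "i k \<le> t" "t < j 1" using assms(1)[of "i 1" "j 1"] assms(1)[of "i k" "j k"] ij by auto
    then show ?thesis using ij(1) by (auto simp: crossing_at_def)
  qed
  have n: "nesting_at M t k" if cr: "nesting_at M s k" and k: "0 < k" for k
  proof -
    obtain i j where ij: "nesting_arcs M k i j" "i k \<le> s" "s < j k" using cr by (auto simp: nesting_at_def)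
    moreover have "(i k, j k) \<in> arcs M" using ij(1) k by (auto simp: nesting_arcs_def)
    ultimately have "i k \<le> t" "t < j k" using assms(1)[of "i k" "j k"] by auto
    then show ?thesis using ij(1) by (auto simp: nesting_at_def)
  qed
  show ?thesis using assms(2) c[of "h + 1"] n[of "w + 1"] by (auto simp: bounded_at_def)
qed

text \<open>Along the reading \<open>W\<close> remains the open word of the current gap. Schensted's
  theorem then turns the box condition into \<open>bounded_at\<close> and each stationary weight
  into the factor of a fixed point.\<close>

lemma matching_weight_eq:
  fixes p q :: bool
  assumes M: "is_matching n M" and hw: "0 < h" "0 < w"
    and st: "\<And>lam. st lam = 1 - of_bool (p \<and> 0 < lam (h - 1)) - of_bool (q \<and> lam 0 = w)"
  shows "t \<le> n \<Longrightarrow> open_word M t W \<Longrightarrow> bounded_at h w M t \<Longrightarrow>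
    matching_weight h w st M t W =
      (if \<forall>s\<le>t. bounded_at h w M s then \<Prod>v\<in>fixed_points M \<inter> {1..t}. fixed_point_weight p q h w M v else 0)"
proof (induction t arbitrary: W)
  case 0
  then show ?case by simp
next
  case (Suc t)
  let ?m = "Suc t"
  have all: "(\<forall>s\<le>?m. bounded_at h w M s) \<longleftrightarrow> (\<forall>s\<le>t. bounded_at h w M s)"
    using Suc.prems(3) by (auto simp: le_Suc_eq)
  have setW: "set W = {i. i \<le> ?m \<and> (\<exists>j>?m. {i, j} \<in> M)}"
    and sW: "sorted_wrt (\<lambda>x y. closer M x < closer M y) W"
    using Suc.prems(2) by (auto simp: open_word_def)
  have dW: "distinct W" using Suc.prems(2) by (rule open_word_distinct)
  have "?m \<in> \<Union>M" using M Suc.prems(1) by (auto simp: is_matching_def partition_on_def)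
  then obtain B where B: "B \<in> M" "?m \<in> B" by auto
  have "card B = 1 \<or> card B = 2" using M B by (auto simp: is_matching_def)
  then consider (single) "{?m} \<in> M" | (pair) x where "{x, ?m} \<in> M" "x \<noteq> ?m"
  proof (elim disjE)
    assume "card B = 1"
    then show ?thesis using B that(1) by (auto simp: card_1_singleton_iff)
  next
    assume "card B = 2"
    then obtain y z where "B = {y, z}" "y \<noteq> z" by (auto simp: card_2_iff)
    then show ?thesis using B that(2)[of y] that(2)[of z] by (auto simp: insert_commute)
  qed
  then consider (single) "{?m} \<in> M" | (opens) j where "{?m, j} \<in> M" "?m < j" | (closes) i where "{i, ?m} \<in> M" "i < ?m"
    by (metis insert_commute linorder_neqE_nat)
  then show ?case
  proof cases
    case single
    have no: "\<not> {x, ?m} \<in> M" if "x \<noteq> ?m" for x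
      using block_unique[OF M single, of "{x, ?m}" ?m] that by auto
    have nW: "?m \<notin> set W" unfolding setW using no by (auto simp: insert_commute)
    have "i \<le> ?m \<and> (\<exists>j>?m. {i, j} \<in> M) \<longleftrightarrow> i \<le> t \<and> (\<exists>j>t. {i, j} \<in> M)" for i
    proof
      assume "i \<le> ?m \<and> (\<exists>j>?m. {i, j} \<in> M)"
      then obtain j where j: "i \<le> ?m" "?m < j" "{i, j} \<in> M" by auto
      then have "i \<noteq> ?m" using no[of j] by (auto simp: insert_commute)
      then show "i \<le> t \<and> (\<exists>j>t. {i, j} \<in> M)" using j by (auto intro: Suc_lessD)
    next
      assume "i \<le> t \<and> (\<exists>j>t. {i, j} \<in> M)"
      then obtain j where j: "i \<le> t" "t < j" "{i, j} \<in> M" by auto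
      then have "j \<noteq> ?m" using no[of i] by auto
      then show "i \<le> ?m \<and> (\<exists>j>?m. {i, j} \<in> M)" using j by (auto intro!: exI[of _ j])
    qed
    then have ow: "open_word M t W" using setW sW by (auto simp: open_word_def)
    have bd: "bounded_at h w M t"
    proof (rule bounded_at_mono[OF _ Suc.prems(3)])
      fix i j assume "(i, j) \<in> arcs M" "i \<le> t" "t < j"
      then show "i \<le> ?m \<and> ?m < j" using no[of i] by (cases "j = ?m") (auto simp: arcs_def)
    qed
    have "in_box h w (shape (insertion_tableau W))"
      using Suc.prems(3) in_box_shape_iff(1)[OF M Suc.prems(2)] by (simp add: bounded_at_def)
    \<comment> \<open>The weight tests \<open>lam 0 = w\<close>, while nestings describe
      \<open>w \<le> lam 0\<close>; inside the box the two agree.\<close>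
    then have "shape (insertion_tableau W) 0 = w \<longleftrightarrow> w \<le> shape (insertion_tableau W) 0"
      by (auto simp: in_box_def)
    then have "st (shape (insertion_tableau W)) = fixed_point_weight p q h w M ?m"
      using in_box_shape_iff(2,3)[OF M Suc.prems(2)] hw by (simp add: st fixed_point_weight_def)
    moreover have "fixed_points M \<inter> {1..?m} = insert ?m (fixed_points M \<inter> {1..t})"
      using single by (auto simp: fixed_points_def atLeastAtMostSuc_conv)
    moreover have "?m \<notin> fixed_points M \<inter> {1..t}" "finite (fixed_points M \<inter> {1..t})" by auto
    ultimately show ?thesis
      using Suc.IH[OF _ ow bd] Suc.prems(1) nW single all by auto
  next
    case (opens j)
    have no: "\<not> {x, ?m} \<in> M" if "x < ?m" for x
      using partner_unique[OF M opens(1), of x] that opens(2) by (auto simp: insert_commute)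
    have mW: "?m \<in> set W" unfolding setW using opens by auto
    have nf: "{?m} \<notin> M" using block_unique[OF M opens(1), of "{?m}" ?m] opens(2) by auto
    have rem: "remove1 ?m W = filter (\<lambda>x. x \<noteq> ?m) W"
      using dW by (simp add: distinct_remove1_removeAll removeAll_filter_not_eq) (metis)
    have "i \<le> ?m \<and> (\<exists>j>?m. {i, j} \<in> M) \<and> i \<noteq> ?m \<longleftrightarrow> i \<le> t \<and> (\<exists>j>t. {i, j} \<in> M)" for i
    proof
      assume "i \<le> t \<and> (\<exists>j>t. {i, j} \<in> M)"
      then obtain j where j: "i \<le> t" "t < j" "{i, j} \<in> M" by auto
      then have "j \<noteq> ?m" using no[of i] by auto
      then show "i \<le> ?m \<and> (\<exists>j>?m. {i, j} \<in> M) \<and> i \<noteq> ?m" using j by (auto intro!: exI[of _ j])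
    qed (auto intro: Suc_lessD)
    then have ow: "open_word M t (remove1 ?m W)"
      using setW sW by (auto simp: open_word_def rem sorted_wrt_filter)
    have bd: "bounded_at h w M t"
    proof (rule bounded_at_mono[OF _ Suc.prems(3)])
      fix i j assume "(i, j) \<in> arcs M" "i \<le> t" "t < j"
      then show "i \<le> ?m \<and> ?m < j" using no[of i] by (cases "j = ?m") (auto simp: arcs_def)
    qed
    have "fixed_points M \<inter> {1..?m} = fixed_points M \<inter> {1..t}"
      using nf by (auto simp: fixed_points_def atLeastAtMostSuc_conv)
    then show ?thesis using Suc.IH[OF _ ow bd] Suc.prems(1) mW all by auto
  next
    case (closes i)
    have op: "opener M ?m = i" by (rule opener_eq[OF M closes(2,1)])
    have cl: "closer M i = ?m" by (rule closer_eq[OF M closes(2,1)])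
    have no: "\<not> {?m, x} \<in> M" if "?m < x" for x
      using partner_unique[OF M, of ?m x i] that closes by (auto simp: insert_commute)
    have mW: "?m \<notin> set W" unfolding setW using no by auto
    have nf: "{?m} \<notin> M" using block_unique[OF M closes(1), of "{?m}" ?m] closes(2) by auto
    have other: "x = i" if "{x, ?m} \<in> M" for x
      using partner_unique[OF M, of ?m x i] that closes nf by (cases "x = ?m") (auto simp: insert_commute)
    have "x = i \<or> (x \<le> ?m \<and> (\<exists>j>?m. {x, j} \<in> M)) \<longleftrightarrow> x \<le> t \<and> (\<exists>j>t. {x, j} \<in> M)" for x
    proof
      assume "x = i \<or> (x \<le> ?m \<and> (\<exists>j>?m. {x, j} \<in> M))"
      then show "x \<le> t \<and> (\<exists>j>t. {x, j} \<in> M)"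
      proof
        assume "x = i"
        then show ?thesis using closes by (auto intro!: exI[of _ ?m])
      next
        assume "x \<le> ?m \<and> (\<exists>j>?m. {x, j} \<in> M)"
        then obtain j where j: "x \<le> ?m" "?m < j" "{x, j} \<in> M" by auto
        then have "x \<noteq> ?m" using no by auto
        then show ?thesis using j by (auto intro!: exI[of _ j])
      qed
    next
      assume "x \<le> t \<and> (\<exists>j>t. {x, j} \<in> M)"
      then obtain j where j: "x \<le> t" "t < j" "{x, j} \<in> M" by auto
      then show "x = i \<or> (x \<le> ?m \<and> (\<exists>j>?m. {x, j} \<in> M))"
        using other[of x] by (cases "j = ?m") (auto intro!: exI[of _ j])
    qed
    then have "set (i # W) = {x. x \<le> t \<and> (\<exists>j>t. {x, j} \<in> M)}" unfolding list.set setW by blast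
    moreover have "\<forall>y\<in>set W. closer M i < closer M y"
      unfolding cl using open_word_closer(3)[OF M Suc.prems(2)] by simp
    ultimately have ow: "open_word M t (i # W)" using sW by (simp add: open_word_def)
    have box: "in_box h w (shape (insertion_tableau (i # W))) \<longleftrightarrow> bounded_at h w M t"
      unfolding bounded_at_def by (rule in_box_shape_iff(1)[OF M ow])
    have fp: "fixed_points M \<inter> {1..?m} = fixed_points M \<inter> {1..t}"
      using nf by (auto simp: fixed_points_def atLeastAtMostSuc_conv)
    show ?thesis
    proof (cases "bounded_at h w M t")
      case True
      then show ?thesis using Suc.IH[OF _ ow True] Suc.prems(1) mW nf op box fp all by auto
    next
      case False
      then have "\<not> (\<forall>s\<le>?m. bounded_at h w M s)" by (metis le_Suc_eq order_refl)
      then show ?thesis using False mW nf op box by auto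
    qed
  qed
qed

theorem sum_fixed_point_weights:
  fixes p q :: bool
  assumes hw: "0 < h" "0 < w"
    and st: "\<And>lam. st lam = 1 - of_bool (p \<and> 0 < lam (h - 1)) - of_bool (q \<and> lam 0 = w)"
  shows "(\<Sum>M | is_matching n M \<and> (\<forall>s\<le>n. bounded_at h w M s).
      \<Prod>v\<in>fixed_points M. fixed_point_weight p q h w M v) = box_walks h w st n (\<lambda>_. 0)"
proof -
  have fin: "finite {M. is_matching n M}"
    using finite_matchings[of "{1..n}"] by (simp add: is_matching_iff)
  have "matching_weight h w st M n [] = (if \<forall>s\<le>n. bounded_at h w M s
      then \<Prod>v\<in>fixed_points M. fixed_point_weight p q h w M v else 0)" if M: "is_matching n M" for M
  proof -
    have le: "j \<le> n" if "(i, j) \<in> arcs M" for i j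
      using block_subset[OF M, of "{i, j}"] that by (auto simp: arcs_def)
    have "open_word M n []"
      using block_subset[OF M] by (force simp: open_word_def)
    moreover have "\<not> crossing_at M n (h + 1)"
    proof
      assume "crossing_at M n (h + 1)"
      then obtain i j where c: "crossing_arcs M (h + 1) i j" "n < j 1" by (auto simp: crossing_at_def)
      then have "(i 1, j 1) \<in> arcs M" by (simp add: crossing_arcs_def)
      with c(2) show False using le by fastforce
    qed
    moreover have "\<not> nesting_at M n (w + 1)"
    proof
      assume "nesting_at M n (w + 1)"
      then obtain i j where c: "nesting_arcs M (w + 1) i j" "n < j (w + 1)" by (auto simp: nesting_at_def)
      then have "(i (w + 1), j (w + 1)) \<in> arcs M" by (simp add: nesting_arcs_def)
      with c(2) show False using le by fastforce
    qed
    moreover have "fixed_points M \<inter> {1..n} = fixed_points M"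
      using block_subset[OF M] by (force simp: fixed_points_def)
    ultimately show ?thesis
      using matching_weight_eq[OF M hw st, of n "[]"] by (auto simp: bounded_at_def)
  qed
  then have "box_walks h w st n (\<lambda>_. 0) = (\<Sum>M | is_matching n M. if \<forall>s\<le>n. bounded_at h w M s
      then \<Prod>v\<in>fixed_points M. fixed_point_weight p q h w M v else 0)"
    unfolding sum_matching_weight_eq_box_walks[where n = n and h = h and w = w and st = st, symmetric] by (intro sum.cong) auto
  also have "\<dots> = (\<Sum>M | M \<in> {M. is_matching n M} \<and> (\<forall>s\<le>n. bounded_at h w M s).
      \<Prod>v\<in>fixed_points M. fixed_point_weight p q h w M v)"
    by (rule sum.inter_filter[symmetric]) (rule fin)
  finally show ?thesis by simp
qed

section \<open>Crossings and nestings without a marked gap, and half-integer parameters\<close>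

lemma no_crossing_iff:
  assumes M: "is_matching n M" and k: "0 < k"
  shows "(\<exists>s\<le>n. crossing_at M s k) \<longleftrightarrow> (\<exists>i j. crossing_arcs M k i j)"
proof
  assume "\<exists>i j. crossing_arcs M k i j"
  then obtain i j where ij: "crossing_arcs M k i j" by auto
  then have "(i k, j k) \<in> arcs M" "i k < j 1" using k by (auto simp: crossing_arcs_def)
  then have "i k \<le> n" using block_subset[OF M, of "{i k, j k}"] by (auto simp: arcs_def)
  then show "\<exists>s\<le>n. crossing_at M s k"
    using ij \<open>i k < j 1\<close> by (auto simp: crossing_at_def intro!: exI[of _ "i k"])
qed (auto simp: crossing_at_def)

lemma no_nesting_iff:
  assumes M: "is_matching n M" and k: "0 < k"
  shows "(\<exists>s\<le>n. nesting_at M s k) \<longleftrightarrow> (\<exists>i j. nesting_arcs M k i j)"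
proof
  assume "\<exists>i j. nesting_arcs M k i j"
  then obtain i j where ij: "nesting_arcs M k i j" by auto
  then have "(i k, j k) \<in> arcs M" "i k < j k" using k by (auto simp: nesting_arcs_def)
  then have "i k \<le> n" using block_subset[OF M, of "{i k, j k}"] by (auto simp: arcs_def)
  then show "\<exists>s\<le>n. nesting_at M s k"
    using ij \<open>i k < j k\<close> by (auto simp: nesting_at_def intro!: exI[of _ "i k"])
qed (auto simp: nesting_at_def)

lemma fixed_point_not_in_arc:
  "is_matching n M \<Longrightarrow> v \<in> fixed_points M \<Longrightarrow> (i, j) \<in> arcs M \<Longrightarrow> v \<noteq> i"
  using block_unique[of n M "{v}" "{i, j}" v] by (auto simp: fixed_points_def arcs_def)

text \<open>The definition demands \<open>i k < v\<close>, the gap only \<open>i k \<le> v\<close>;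
  equality is impossible because a fixed point is not an opener.\<close>

lemma in_half_crossing_iff:
  assumes M: "is_matching n M" and v: "v \<in> fixed_points M" and k: "0 < k"
  shows "in_half_crossing M k v \<longleftrightarrow> crossing_at M v k"
proof -
  have "i k \<noteq> v" if "crossing_arcs M k i j" for i j
    using fixed_point_not_in_arc[OF M v, of "i k" "j k"] that k by (auto simp: crossing_arcs_def)
  then show ?thesis using v by (auto simp: in_half_crossing_def crossing_at_def le_less)
qed

lemma in_half_nesting_iff:
  assumes M: "is_matching n M" and v: "v \<in> fixed_points M" and k: "0 < k"
  shows "in_half_nesting M k v \<longleftrightarrow> nesting_at M v k"
proof -
  have "i k \<noteq> v" if "nesting_arcs M k i j" for i j
    using fixed_point_not_in_arc[OF M v, of "i k" "j k"] that k by (auto simp: nesting_arcs_def)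
  then show ?thesis using v by (auto simp: in_half_nesting_def nesting_at_def le_less)
qed

lemma crossing_arcs_shrink:
  assumes "crossing_arcs M k i j" "0 < l" "l \<le> k"
  shows "crossing_arcs M l i j" "i l \<le> i k"
proof -
  show le: "i l \<le> i k"
    using assms by (cases "l = k") (auto simp: crossing_arcs_def strict_mono_on_def intro: less_imp_le)
  show "crossing_arcs M l i j"
    using assms le by (auto simp: crossing_arcs_def strict_mono_on_def)
qed

lemma nesting_arcs_shrink:
  assumes "nesting_arcs M k i j" "0 < l" "l \<le> k"
  shows "nesting_arcs M l i j" "i l \<le> i k" "j k \<le> j l"
proof -
  show le: "i l \<le> i k" "j k \<le> j l"
    using assms by (cases "l = k"; auto simp: nesting_arcs_def monotone_on_def intro: less_imp_le)+
  show "nesting_arcs M l i j"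
    using assms le by (auto simp: nesting_arcs_def monotone_on_def)
qed

lemma of_nat_neq_half: "(of_nat k :: rat) \<noteq> of_nat l + 1/2" 
proof
  assume "(of_nat k :: rat) = of_nat l + 1/2"
  then have "(of_nat (2 * k) :: rat) = of_nat (2 * l + 1)" by simp
  then have "2 * k = 2 * l + 1" by (simp only: of_nat_eq_iff)
  then show False by presburger
qed

lemma half_not_Ints: "(of_nat k + 1/2 :: rat) \<notin> \<int>"
proof
  assume "(of_nat k + 1/2 :: rat) \<in> \<int>"
  then obtain z where "(of_nat k + 1/2 :: rat) = of_int z" by (auto elim: Ints_cases)
  then have "(of_int (2 * int k + 1) :: rat) = of_int (2 * z)" by simp
  then have "2 * int k + 1 = 2 * z" by (simp only: of_int_eq_iff)
  then show False by presburger
qed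

lemma noncrossing_int: "noncrossing (of_nat h + 1) M \<longleftrightarrow> \<not> (\<exists>i j. crossing_arcs M (h + 1) i j)"
proof -
  have r: "(of_nat h + 1 :: rat) = of_nat (h + 1)" by simp
  have "has_crossing M (of_nat (h + 1)) \<longleftrightarrow> (\<exists>i j. crossing_arcs M (h + 1) i j)"
    unfolding has_crossing_def of_nat_eq_iff using of_nat_neq_half[of "h + 1"] by (simp del: of_nat_add of_nat_Suc)
  then show ?thesis unfolding r noncrossing_def by (simp del: of_nat_add of_nat_Suc)
qed

lemma nonnesting_int: "nonnesting (of_nat h + 1) M \<longleftrightarrow> \<not> (\<exists>i j. nesting_arcs M (h + 1) i j)"
proof -
  have r: "(of_nat h + 1 :: rat) = of_nat (h + 1)" by simp
  have "has_nesting M (of_nat (h + 1)) \<longleftrightarrow> (\<exists>i j. nesting_arcs M (h + 1) i j)"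
    unfolding has_nesting_def of_nat_eq_iff using of_nat_neq_half[of "h + 1"] by (simp del: of_nat_add of_nat_Suc)
  then show ?thesis unfolding r nonnesting_def by (simp del: of_nat_add of_nat_Suc)
qed

text \<open>Large crossings or nestings contain smaller ones, so among all
  \<open>t \<ge> h + 1/2\<close> only the least half-integer and the least integer have to be
  tested. The predicates are abstract to serve crossings and nestings alike.\<close>

lemma no_half_iff:
  fixes full half :: "nat \<Rightarrow> bool"
  assumes h: "0 < h" and full: "\<And>k. full k \<Longrightarrow> h + 1 \<le> k \<Longrightarrow> full (h + 1)" and half: "\<And>k. half k \<Longrightarrow> h \<le> k \<Longrightarrow> half h"
  shows "(\<forall>t::rat. of_nat h + 1/2 \<le> t \<longrightarrow> \<not> (\<exists>k\<ge>1. t = of_nat k \<and> full k \<or> t = of_nat k + 1/2 \<and> half k))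
    \<longleftrightarrow> \<not> full (h + 1) \<and> \<not> half h" (is "?l \<longleftrightarrow> ?r")
proof -
  have ge: "(of_nat h + 1/2 :: rat) \<le> of_nat k \<longleftrightarrow> h + 1 \<le> k" for k
  proof -
    have "(of_nat h + 1/2 :: rat) \<le> of_nat k \<longleftrightarrow> (of_nat (2 * h + 1) :: rat) \<le> of_nat (2 * k)"
      by (simp add: field_simps)
    also have "\<dots> \<longleftrightarrow> 2 * h + 1 \<le> 2 * k" by (rule of_nat_le_iff)
    finally show ?thesis by presburger
  qed
  show ?thesis
  proof
    assume l: ?l
    have "\<not> full (h + 1)"
    proof
      assume "full (h + 1)"
      then have "\<exists>k\<ge>1. (of_nat (h + 1) :: rat) = of_nat k \<and> full k \<or> (of_nat (h + 1) :: rat) = of_nat k + 1/2 \<and> half k"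
        by (intro exI[of _ "h + 1"]) simp
      then show False using l ge[of "h + 1"] by blast
    qed
    moreover have "\<not> half h"
    proof
      assume "half h"
      then have "\<exists>k\<ge>1. (of_nat h + 1/2 :: rat) = of_nat k \<and> full k \<or> (of_nat h + 1/2 :: rat) = of_nat k + 1/2 \<and> half k"
        using h by (intro exI[of _ h]) simp
      then show False using l by blast
    qed
    ultimately show ?r ..
  next
    assume r: ?r
    show ?l
    proof (intro allI impI notI)
      fix t :: rat
      assume t: "of_nat h + 1/2 \<le> t" and "\<exists>k\<ge>1. t = of_nat k \<and> full k \<or> t = of_nat k + 1/2 \<and> half k"
      then obtain k where "t = of_nat k \<and> full k \<or> t = of_nat k + 1/2 \<and> half k" by blast
      then show False
      proof (elim disjE conjE)
        assume "t = of_nat k" "full k"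
        then show False using t ge[of k] full[of k] r by simp
      next
        assume "t = of_nat k + 1/2" "half k"
        then show False using t half[of k] r by simp
      qed
    qed
  qed
qed

lemma noncrossing_half:
  assumes "0 < h"
  shows "noncrossing (of_nat h + 1/2) M \<longleftrightarrow>
    \<not> (\<exists>i j. crossing_arcs M (h + 1) i j) \<and> \<not> (\<exists>v. in_half_crossing M h v)"
proof -
  have "\<exists>v. in_half_crossing M h v" if "\<exists>v. in_half_crossing M k v" "h \<le> k" for k
    using that assms crossing_arcs_shrink[of M k _ _ h] by (force simp: in_half_crossing_def)
  moreover have "\<exists>i j. crossing_arcs M (h + 1) i j" if "\<exists>i j. crossing_arcs M k i j" "h + 1 \<le> k" for k
    using crossing_arcs_shrink(1)[of M k _ _ "h + 1"] that by force
  ultimately have "(\<forall>t\<ge>of_nat h + 1/2. \<not> has_crossing M t) \<longleftrightarrow>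
      \<not> (\<exists>i j. crossing_arcs M (h + 1) i j) \<and> \<not> (\<exists>v. in_half_crossing M h v)"
    unfolding has_crossing_def using assms by (intro no_half_iff)
  then show ?thesis using half_not_Ints[of h] by (simp add: noncrossing_def)
qed

lemma nonnesting_half:
  assumes "0 < h"
  shows "nonnesting (of_nat h + 1/2) M \<longleftrightarrow>
    \<not> (\<exists>i j. nesting_arcs M (h + 1) i j) \<and> \<not> (\<exists>v. in_half_nesting M h v)"
proof -
  have "\<exists>v. in_half_nesting M h v" if "\<exists>v. in_half_nesting M k v" "h \<le> k" for k
    using that assms nesting_arcs_shrink[of M k _ _ h] by (force simp: in_half_nesting_def)
  moreover have "\<exists>i j. nesting_arcs M (h + 1) i j" if "\<exists>i j. nesting_arcs M k i j" "h + 1 \<le> k" for k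
    using nesting_arcs_shrink(1)[of M k _ _ "h + 1"] that by force
  ultimately have "(\<forall>t\<ge>of_nat h + 1/2. \<not> has_nesting M t) \<longleftrightarrow>
      \<not> (\<exists>i j. nesting_arcs M (h + 1) i j) \<and> \<not> (\<exists>v. in_half_nesting M h v)"
    unfolding has_nesting_def using assms by (intro no_half_iff)
  then show ?thesis using half_not_Ints[of h] by (simp add: nonnesting_def)
qed

section \<open>Cylindric tableaux as walks in the alcove\<close>

definition diagram :: "(nat \<Rightarrow> nat) \<Rightarrow> (int \<times> int) set" where
  "diagram lam = {(i, j). 1 \<le> i \<and> 1 \<le> j \<and> j \<le> int (lam (nat (i - 1)))}"

definition part :: "nat list \<Rightarrow> nat \<Rightarrow> nat" where
  "part xs i = (if i < length xs then xs ! i else 0)"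

lemma mem_diagram: "(i, j) \<in> diagram lam \<longleftrightarrow> 1 \<le> i \<and> 1 \<le> j \<and> j \<le> int (lam (nat (i - 1)))"
  by (simp add: diagram_def)

lemma young_diagram_eq: "young_diagram xs = diagram (part xs)"
proof (rule Set.set_eqI)
  fix p :: "int \<times> int"
  obtain i j where p: "p = (i, j)" by (cases p)
  have "(\<exists>k. i = int k + 1 \<and> k < length xs \<and> 1 \<le> j \<and> j \<le> int (xs ! k)) \<longleftrightarrow>
      1 \<le> i \<and> 1 \<le> j \<and> j \<le> int (part xs (nat (i - 1)))" (is "?l \<longleftrightarrow> ?r")
  proof
    assume ?r
    then show ?l by (intro exI[of _ "nat (i - 1)"]) (auto simp: part_def split: if_splits)
  qed (auto simp: part_def)
  then show "p \<in> young_diagram xs \<longleftrightarrow> p \<in> diagram (part xs)"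
    by (auto simp: p young_diagram_def mem_diagram)
qed

lemma part_decreasing: "is_partition xs \<Longrightarrow> part xs (Suc i) \<le> part xs i"
  by (auto simp: part_def is_partition_def sorted_wrt_iff_nth_less)

lemma partition_of_function:
  assumes dec: "\<And>i. lam (Suc i) \<le> lam i" and zero: "lam m = 0"
  shows "\<exists>xs. is_partition xs \<and> part xs = lam"
proof -
  define l where "l = (LEAST i. lam i = 0)"
  have l: "lam l = 0" unfolding l_def using zero by (rule LeastI)
  have pos: "lam i \<noteq> 0" if "i < l" for i using that not_less_Least unfolding l_def by blast
  have mono: "lam j \<le> lam i" if "i \<le> j" for i j using antimono_le[of lam, OF dec that] .
  let ?xs = "map lam [0..<l]"
  have "is_partition ?xs"
    using mono by (auto simp: is_partition_def sorted_wrt_iff_nth_less dest!: pos)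
  moreover have "part ?xs i = lam i" for i
    using mono[of l i] l by (auto simp: part_def)
  ultimately show ?thesis by blast
qed

lemma card_young_diagram: "card (young_diagram xs) = sum_list xs"
proof -
  have "young_diagram xs = (\<Union>k\<in>{0..<length xs}. (\<lambda>j. (int k + 1, j)) ` {1..int (xs ! k)})"
    by (auto simp: young_diagram_def)
  also have "card \<dots> = (\<Sum>k\<in>{0..<length xs}. card ((\<lambda>j. (int k + 1, j)) ` {1..int (xs ! k)}))"
    by (rule card_UN_disjoint) auto
  also have "\<dots> = (\<Sum>k\<in>{0..<length xs}. xs ! k)"
    by (intro sum.cong refl) (subst card_image, auto simp: inj_on_def)
  finally show ?thesis by (simp add: sum_list_sum_nth)
qed

lemma diagram_rows:
  assumes "\<And>i. lam (Suc i) \<le> lam i" "lam a = 0" "(i, j) \<in> diagram lam"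
  shows "1 \<le> i" "i \<le> int a"
proof -
  have "lam k = 0" if "a \<le> k" for k using antimono_le[of lam, OF assms(1) that] assms(2) by simp
  then have "\<not> a \<le> nat (i - 1)" using assms(3) by (auto simp: mem_diagram)
  then show "1 \<le> i" "i \<le> int a" using assms(3) by (auto simp: mem_diagram)
qed

lemma diagram_inj: "diagram lam = diagram mu \<Longrightarrow> lam = mu"
proof
  fix i assume eq: "diagram lam = diagram mu"
  have "(int i + 1, j) \<in> diagram lam \<longleftrightarrow> (int i + 1, j) \<in> diagram mu" for j using eq by simp
  from this[of "int (lam i)"] this[of "int (mu i)"] show "lam i = mu i" by (auto simp: mem_diagram)
qed

text \<open>Going down a column, one leaves the inner diagram before the outer one, so the
  difference meets each column in an interval.\<close>

lemma skew_shape_column_convex: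
  assumes "skew_shape S" "(i1, j) \<in> S" "(i3, j) \<in> S" "i1 \<le> i2" "i2 \<le> i3"
  shows "(i2, j) \<in> S"
proof -
  obtain xs ys p q where xy: "is_partition xs" "is_partition ys" "young_diagram ys \<subseteq> young_diagram xs"
    and S: "S = (\<lambda>(i, j). (i + p, j + q)) ` (young_diagram xs - young_diagram ys)"
    using assms(1) unfolding skew_shape_def by blast
  have S': "(i, j) \<in> S \<longleftrightarrow> (i - p, j - q) \<in> young_diagram xs \<and> (i - p, j - q) \<notin> young_diagram ys" for i j
    unfolding S by force
  have down: "(i, j) \<in> diagram (part zs)" if "(i', j) \<in> diagram (part zs)" "i \<le> i'" "1 \<le> i" "is_partition zs" for i i' j zs
  proof -
    have "part zs (nat (i' - 1)) \<le> part zs (nat (i - 1))"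
      using antimono_le[of "part zs", OF part_decreasing[OF that(4)], of "nat (i - 1)" "nat (i' - 1)"] that(2)
      by (simp add: nat_mono)
    then show ?thesis using that by (auto simp: mem_diagram)
  qed
  show ?thesis
    using assms xy down[of "i3 - p" "j - q" xs "i2 - p"] down[of "i2 - p" "j - q" ys "i1 - p"]
    unfolding S' young_diagram_eq by (auto simp: mem_diagram)
qed

definition row_increasing :: "tableau \<Rightarrow> bool" where
  "row_increasing T \<longleftrightarrow> (\<forall>i j j' x y. j < j' \<and> T (i, j) = Some x \<and> T (i, j') = Some y \<longrightarrow> x < y)"

definition col_increasing :: "tableau \<Rightarrow> bool" where
  "col_increasing T \<longleftrightarrow> (\<forall>i i' j x y. i < i' \<and> T (i, j) = Some x \<and> T (i', j) = Some y \<longrightarrow> x < y)"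

text \<open>Column increase across the seam: in column \<open>j\<close>, the shifted copy carries
  the entries of column \<open>j + b\<close> below all rows of \<open>T\<close>.\<close>

definition wrap_increasing :: "nat \<Rightarrow> tableau \<Rightarrow> bool" where
  "wrap_increasing b T \<longleftrightarrow> (\<forall>i i' j x y. T (i, j) = Some x \<and> T (i', j + int b) = Some y \<longrightarrow> x < y)"

definition cyl_tableau :: "nat \<Rightarrow> nat \<Rightarrow> nat \<Rightarrow> (nat \<Rightarrow> nat) \<Rightarrow> tableau \<Rightarrow> bool" where
  "cyl_tableau a b n lam T \<longleftrightarrow> in_alcove a b lam \<and> dom T = diagram lam \<and> inj_on T (dom T) \<and> ran T = {1..n} \<and>
     row_increasing T \<and> col_increasing T \<and> wrap_increasing b T"

lemma union_shift:
  assumes "dom T = diagram lam" "in_alcove a b lam"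
  shows "(T ++ shift_tableau (int a) (- int b) T) (i, j) = (if i \<le> int a then T (i, j) else T (i - int a, j + int b))"
proof -
  have none: "T (i, j) = None" if "i \<le> 0 \<or> int a < i" for i j
    using that diagram_rows[of lam a i j] assms by (fastforce simp: in_alcove_def)
  show ?thesis
    using none[of "i - int a" "j + int b"] none[of i j]
    by (auto simp: shift_tableau_def map_add_def split: option.split)
qed

lemma CSYT_iff:
  assumes a: "0 < a" and b: "0 < b"
  shows "T \<in> CSYT n a b \<longleftrightarrow> (\<exists>lam. cyl_tableau a b n lam T)"
proof
  assume T: "T \<in> CSYT n a b"
  then obtain xs where xs: "is_partition xs" "dom T = young_diagram xs"
    by (auto simp: CSYT_def SYT_def)
  have dec: "part xs (Suc i) \<le> part xs i" for i using part_decreasing[OF xs(1)] .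
  have d: "dom T = diagram (part xs)" using xs(2) by (simp add: young_diagram_eq)
  let ?U = "T ++ shift_tableau (int a) (- int b) T"
  have cyl: "card (fst ` dom T) \<le> a" "semistandard ?U" using T by (auto simp: CSYT_def cylindric_def)
  have "fst ` dom T = (\<lambda>k. int k + 1) ` {..<length xs}"
  proof
    show "fst ` dom T \<subseteq> (\<lambda>k. int k + 1) ` {..<length xs}"
      unfolding xs(2) by (auto simp: young_diagram_def)
    have "int k + 1 \<in> fst ` dom T" if "k < length xs" for k
    proof -
      have "0 < xs ! k" using xs(1) that nth_mem[OF that] unfolding is_partition_def by (metis gr0I)
      then have "(int k + 1, 1) \<in> dom T" unfolding xs(2) using that by (auto simp: young_diagram_def)
      then show ?thesis by force
    qed
    then show "(\<lambda>k. int k + 1) ` {..<length xs} \<subseteq> fst ` dom T" by auto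
  qed
  then have "card (fst ` dom T) = length xs" by (simp add: card_image inj_on_def)
  then have za: "part xs a = 0" using cyl(1) by (simp add: part_def)
  have alc: "in_alcove a b (part xs)"
    unfolding in_alcove_def
  proof (intro conjI allI dec za)
    show "part xs 0 \<le> part xs (a - 1) + b"
    proof (rule ccontr)
      assume "\<not> ?thesis"
      then have gt: "part xs (a - 1) + b < part xs 0" by simp
      have none: "T (i, j) = None" if "i \<le> 0 \<or> int a < i" for i j
        using that diagram_rows[of "part xs" a i j, OF dec za] d by fastforce
      \<comment> \<open>The column in which the first row of the shifted copy ends. It contains a
        cell of row 1 and one of row \<open>a + 1\<close>, so convexity forces a cell in row
        \<open>a\<close>. The shifted copy starts only in row \<open>a + 1\<close>, so this cell
        belongs to \<open>T\<close>, against \<open>gt\<close>.\<close>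
      let ?j = "int (part xs 0) - int b"
      have domU: "(i, j) \<in> dom ?U \<longleftrightarrow> (i, j) \<in> dom T \<or> (i - int a, j + int b) \<in> dom T" for i j
        by (auto simp: shift_tableau_def)
      have "skew_shape (dom ?U)" using cyl(2) by (simp add: semistandard_def)
      moreover have "(1, ?j) \<in> dom ?U" unfolding domU d using gt by (simp add: mem_diagram)
      moreover have "(int a + 1, ?j) \<in> dom ?U" unfolding domU d using gt by (simp add: mem_diagram)
      ultimately have "(int a, ?j) \<in> dom ?U"
        by (rule skew_shape_column_convex) (use a in auto)
      then have "(int a, ?j) \<in> dom T"
        unfolding domU using none[of "int a - int a" "?j + int b"] by auto
      moreover have "nat (int a - 1) = a - 1" using a by simp
      ultimately show False using gt unfolding d by (simp add: mem_diagram)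
    qed
  qed
  note U = union_shift[OF d alc]
  have "wrap_increasing b T"
    unfolding wrap_increasing_def
  proof (intro allI impI)
    fix i i' j x y assume xy: "T (i, j) = Some x \<and> T (i', j + int b) = Some y"
    then have "(i, j) \<in> diagram (part xs)" "(i', j + int b) \<in> diagram (part xs)" using d by auto
    then have "i \<le> int a" "1 \<le> i'" using diagram_rows[of "part xs" a, OF dec za] by auto
    then have "?U (i, j) = Some x" "?U (i' + int a, j) = Some y" "i < i' + int a" using xy by (auto simp: U)
    moreover have "\<forall>i i' j x y. i < i' \<and> ?U (i, j) = Some x \<and> ?U (i', j) = Some y \<longrightarrow> x < y"
      using cyl(2) unfolding semistandard_def by (elim conjE) assumption
    ultimately show "x < y" by metis
  qed
  moreover have "row_increasing T" "col_increasing T" "inj_on T (dom T)" "ran T = {1..n}"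
    using T unfolding CSYT_def SYT_def row_increasing_def col_increasing_def by blast+
  ultimately show "\<exists>lam. cyl_tableau a b n lam T" using alc d unfolding cyl_tableau_def by blast
next
  assume "\<exists>lam. cyl_tableau a b n lam T"
  then obtain lam where alc: "in_alcove a b lam" and d: "dom T = diagram lam" and inj: "inj_on T (dom T)"
    and ran: "ran T = {1..n}" and inc: "row_increasing T" "col_increasing T" "wrap_increasing b T"
    unfolding cyl_tableau_def by blast
  have dec: "lam (Suc i) \<le> lam i" for i using alc by (simp add: in_alcove_def)
  have mono: "lam v \<le> lam u" if "u \<le> v" for u v using antimono_le[of lam, OF dec that] .
  have za: "lam k = 0" if "a \<le> k" for k using mono[OF that] alc by (simp add: in_alcove_def)
  obtain xs where xs: "is_partition xs" "part xs = lam"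
    using partition_of_function[of lam a, OF dec za] by blast
  have dx: "dom T = young_diagram xs" using d xs(2) by (simp add: young_diagram_eq)
  have "card (dom T) = n"
  proof -
    have "the ` T ` dom T = {1..n}" unfolding ran[symmetric] by (force simp: ran_def)
    moreover have "inj_on the (T ` dom T)" by (auto simp: inj_on_def)
    ultimately have "card (T ` dom T) = n" by (metis card_image card_atLeastAtMost diff_Suc_1)
    then show ?thesis using inj by (simp add: card_image)
  qed
  then have "sum_list xs = n" using card_young_diagram[of xs] dx by simp
  then have syt: "T \<in> SYT n"
    unfolding SYT_def using xs dx inj ran inc by (auto simp: row_increasing_def col_increasing_def)
  define V where "V = T ++ shift_tableau (int a) (- int b) T"
  have U: "V (i, j) = (if i \<le> int a then T (i, j) else T (i - int a, j + int b))" for i j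
    unfolding V_def by (rule union_shift[OF d alc])
  have row: "i \<le> int a" "1 \<le> i" if "T (i, j) = Some x" for i j x
    using diagram_rows[of lam a i j] dec za[of a] that d by auto
  have "fst ` dom T \<subseteq> {1..int a}" using row by auto
  then have "card (fst ` dom T) \<le> card {1..int a}" by (intro card_mono) auto
  then have rows: "card (fst ` dom T) \<le> a" by simp
  have "skew_shape (dom V)"
  proof -
    \<comment> \<open>After translation by \<open>b\<close> columns to the right, the union is the
      shape with rows \<open>lam + b\<close> on top of rows \<open>lam\<close>, minus a rectangle of
      \<open>a\<close> rows and \<open>b\<close> columns.\<close>
    let ?X = "\<lambda>i. if i < a then lam i + b else lam (i - a)"
    let ?Y = "\<lambda>i. if i < a then b else 0"
    have "?X (Suc i) \<le> ?X i" for i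
    proof (cases "Suc i = a")
      case True
      then show ?thesis using alc by (auto simp: in_alcove_def)
    qed (use dec in \<open>auto simp: Suc_diff_le not_less\<close>)
    moreover have "?X (2 * a) = 0" using za by simp
    ultimately obtain us where us: "is_partition us" "part us = ?X" using partition_of_function[of ?X "2 * a"] by metis
    have "?Y (Suc i) \<le> ?Y i" for i by simp
    moreover have "?Y a = 0" by simp
    ultimately obtain vs where vs: "is_partition vs" "part vs = ?Y" using partition_of_function[of ?Y a] by metis
    have "young_diagram vs \<subseteq> young_diagram us"
      unfolding young_diagram_eq us(2) vs(2) by (auto simp: mem_diagram split: if_splits)
    moreover have "dom V = (\<lambda>(i, j). (i + 0, j + (- int b))) ` (young_diagram us - young_diagram vs)"
    proof (rule Set.set_eqI)
      fix c :: "int \<times> int"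
      obtain i j where c: "c = (i, j)" by (cases c)
      have "c \<in> (\<lambda>(i, j). (i + 0, j + (- int b))) ` (young_diagram us - young_diagram vs)
          \<longleftrightarrow> (i, j + int b) \<in> diagram ?X \<and> (i, j + int b) \<notin> diagram ?Y"
        unfolding young_diagram_eq us(2) vs(2) c by force
      also have "\<dots> \<longleftrightarrow> (if i \<le> int a then (i, j) \<in> diagram lam else (i - int a, j + int b) \<in> diagram lam)"
      proof (cases "1 \<le> i")
        case True
        have "nat (i - 1) < a \<longleftrightarrow> i \<le> int a" "nat (i - 1) - a = nat (i - int a - 1)" using True by auto
        then show ?thesis using True by (auto simp: mem_diagram)
      qed (auto simp: mem_diagram)
      also have "\<dots> \<longleftrightarrow> c \<in> dom V" unfolding c dom_def mem_Collect_eq U using d by (auto simp: dom_def)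
      finally show "c \<in> dom V \<longleftrightarrow> c \<in> (\<lambda>(i, j). (i + 0, j + (- int b))) ` (young_diagram us - young_diagram vs)"
        by simp
    qed
    ultimately show ?thesis unfolding skew_shape_def using us(1) vs(1) by blast
  qed
  moreover have "0 \<notin> ran V"
  proof
    assume "0 \<in> ran V"
    then obtain c where c: "V c = Some 0" unfolding ran_def by blast
    obtain i j where "c = (i, j)" by (cases c)
    then have "(if i \<le> int a then T (i, j) else T (i - int a, j + int b)) = Some 0" using c U by metis
    then have "0 \<in> ran T" by (metis ranI)
    then show False using ran by simp
  qed
  moreover have "x \<le> y" if "j < j'" "V (i, j) = Some x" "V (i, j') = Some y" for i j j' x y
    using that(2,3) inc(1) that(1) unfolding U row_increasing_def
    by (cases "i \<le> int a") (simp_all, (metis less_imp_le add_less_cancel_right)+)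
  moreover have "x < y" if "i < i'" "V (i, j) = Some x" "V (i', j) = Some y" for i i' j x y
  proof -
    consider "i' \<le> int a" | "i \<le> int a" "int a < i'" | "int a < i" using that(1) by linarith
    then show ?thesis
    proof cases
      case 1
      then have "T (i, j) = Some x" "T (i', j) = Some y" using that by (simp_all add: U)
      then show ?thesis using inc(2) that(1) unfolding col_increasing_def by blast
    next
      case 2
      then have "T (i, j) = Some x" "T (i' - int a, j + int b) = Some y" using that by (simp_all add: U)
      then show ?thesis using inc(3) unfolding wrap_increasing_def by blast
    next
      case 3
      then have "T (i - int a, j + int b) = Some x" "T (i' - int a, j + int b) = Some y" "i - int a < i' - int a"
        using that by (simp_all add: U)
      then show ?thesis using inc(2) unfolding col_increasing_def by blast
    qed
  qed
  ultimately have "semistandard V" unfolding semistandard_def by blast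
  then show "T \<in> CSYT n a b" using syt rows by (simp add: CSYT_def cylindric_def V_def)
qed

section \<open>Adding and removing the largest entry of a cylindric tableau\<close>

definition add_cell :: "nat \<Rightarrow> nat \<Rightarrow> (nat \<Rightarrow> nat) \<Rightarrow> tableau \<Rightarrow> tableau" where
  "add_cell n i lam T = T((int i + 1, int (lam i) + 1) \<mapsto> Suc n)"

lemma cyl_tableau_add_cell:
  assumes b: "0 < b" and T: "cyl_tableau a b n lam T" and i: "i < a" and alc': "in_alcove a b (lam(i := Suc (lam i)))"
  shows "cyl_tableau a b (Suc n) (lam(i := Suc (lam i))) (add_cell n i lam T)"
proof -
  let ?c = "(int i + 1, int (lam i) + 1)"
  let ?T = "add_cell n i lam T"
  have alc: "in_alcove a b lam" and d: "dom T = diagram lam" and inj: "inj_on T (dom T)"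
    and ran: "ran T = {1..n}" and inc: "row_increasing T" "col_increasing T" "wrap_increasing b T"
    using T unfolding cyl_tableau_def by blast+
  have mono: "lam v \<le> lam u" if "u \<le> v" for u v
    using antimono_le[of lam, OF _ that] alc by (auto simp: in_alcove_def)
  have cell: "T c = Some x \<Longrightarrow> c \<in> diagram lam" "T c = Some x \<Longrightarrow> x < Suc n" for c x
    using d ran ranI[of T c x] by auto
  have val: "?T c = (if c = ?c then Some (Suc n) else T c)" for c by (simp add: add_cell_def)
  have notin: "T ?c = None"
    using cell(1)[of ?c] by (cases "T ?c") (auto simp: mem_diagram)
  have "dom ?T = insert ?c (diagram lam)" using d by (simp add: add_cell_def)
  also have "\<dots> = diagram (lam(i := Suc (lam i)))"
    by (auto simp: mem_diagram split: if_splits)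
  finally have "dom ?T = diagram (lam(i := Suc (lam i)))" .
  moreover have "ran ?T = {1..Suc n}"
    using ran notin by (auto simp: add_cell_def ran_map_upd)
  moreover have "inj_on ?T (dom ?T)"
  proof (rule inj_onI)
    fix p q assume "p \<in> dom ?T" "q \<in> dom ?T" "?T p = ?T q"
    then show "p = q"
      using cell(2)[of p "Suc n"] cell(2)[of q "Suc n"] inj_onD[OF inj, of p q] unfolding val
      by (auto simp: domIff split: if_splits)
  qed
  moreover have "row_increasing ?T"
    unfolding row_increasing_def
  proof (intro allI impI)
    fix k j j' x y assume h: "j < j' \<and> ?T (k, j) = Some x \<and> ?T (k, j') = Some y"
    have "(k, j) \<noteq> ?c"
    proof
      assume eq: "(k, j) = ?c"
      then have "T (k, j') = Some y" using h by (auto simp: val)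
      then show False using cell(1) eq h by (force simp: mem_diagram)
    qed
    then show "x < y" using h cell(2)[of "(k, j)" x] inc(1) unfolding val row_increasing_def
      by (auto split: if_splits)
  qed
  moreover have "col_increasing ?T"
    unfolding col_increasing_def
  proof (intro allI impI)
    fix k k' j x y assume h: "k < k' \<and> ?T (k, j) = Some x \<and> ?T (k', j) = Some y"
    have "(k, j) \<noteq> ?c"
    proof
      assume eq: "(k, j) = ?c"
      then have "T (k', j) = Some y" using h by (auto simp: val)
      then have "j \<le> int (lam (nat (k' - 1)))" using cell(1) by (force simp: mem_diagram)
      moreover have "lam (nat (k' - 1)) \<le> lam i" using eq h by (intro mono) auto
      ultimately show False using eq by auto
    qed
    then show "x < y" using h cell(2)[of "(k, j)" x] inc(2) unfolding val col_increasing_def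
      by (auto split: if_splits)
  qed
  moreover have "wrap_increasing b ?T"
    unfolding wrap_increasing_def
  proof (intro allI impI)
    fix k k' j x y assume h: "?T (k, j) = Some x \<and> ?T (k', j + int b) = Some y"
    have "(k, j) \<noteq> ?c"
    proof
      assume eq: "(k, j) = ?c"
      then have "T (k', j + int b) = Some y" using h b by (auto simp: val split: if_splits)
      then have "j + int b \<le> int (lam (nat (k' - 1)))" using cell(1) by (force simp: mem_diagram)
      \<comment> \<open>An entry \<open>b\<close> columns to the right of the new cell would need a
        row longer than \<open>lam i + b\<close>, but
        \<open>lam 0 \<le> lam (a - 1) + b \<le> lam i + b\<close>.\<close>
      moreover have "lam (nat (k' - 1)) \<le> lam 0" "lam (a - 1) \<le> lam i" using i by (auto intro: mono)
      ultimately show False using eq alc by (auto simp: in_alcove_def)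
    qed
    then show "x < y" using h cell(2)[of "(k, j)" x] inc(3) unfolding val wrap_increasing_def
      by (auto split: if_splits)
  qed
  ultimately show ?thesis using alc' unfolding cyl_tableau_def by blast
qed

lemma cyl_tableau_remove_cell:
  assumes a: "1 < a" and T: "cyl_tableau a b (Suc n) mu T"
  shows "\<exists>lam U i. cyl_tableau a b n lam U \<and> i < a \<and> mu = lam(i := Suc (lam i)) \<and> T = add_cell n i lam U"
proof -
  have alc: "in_alcove a b mu" and d: "dom T = diagram mu" and inj: "inj_on T (dom T)"
    and ran: "ran T = {1..Suc n}" and inc: "row_increasing T" "col_increasing T" "wrap_increasing b T"
    using T unfolding cyl_tableau_def by blast+
  have dec: "mu (Suc i) \<le> mu i" for i using alc by (simp add: in_alcove_def)
  have za: "mu k = 0" if "a \<le> k" for k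
    using antimono_le[of mu, OF dec that] alc by (simp add: in_alcove_def)
  have max: "x \<le> Suc n" if "T c = Some x" for c x using ranI[of T c x] that ran by auto
  have "Suc n \<in> ran T" using ran by simp
  then obtain i0 j0 where c: "T (i0, j0) = Some (Suc n)" by (auto simp: ran_def)
  then have "(i0, j0) \<in> diagram mu" using d by auto
  then have ij: "1 \<le> i0" "1 \<le> j0" "j0 \<le> int (mu (nat (i0 - 1)))" by (auto simp: mem_diagram)
  define i where "i = nat (i0 - 1)"
  have i0: "i0 = int i + 1" using ij by (simp add: i_def)
  have j0: "j0 = int (mu i)"
  proof (rule ccontr)
    assume "j0 \<noteq> int (mu i)"
    then have "(i0, j0 + 1) \<in> dom T" using ij d by (auto simp: mem_diagram i_def)
    then obtain y where y: "T (i0, j0 + 1) = Some y" by auto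
    have "j0 < j0 + 1" by simp
    then have "Suc n < y" using inc(1) c y unfolding row_increasing_def by blast
    then show False using max[OF y] by simp
  qed
  have Suc_i: "nat (1 + int i) = Suc i" by simp
  have lt: "mu (Suc i) < mu i"
  proof (rule ccontr)
    assume "\<not> ?thesis"
    then have "(i0 + 1, j0) \<in> dom T" using ij d j0 by (auto simp: mem_diagram i0 Suc_i)
    then obtain y where y: "T (i0 + 1, j0) = Some y" by auto
    have "i0 < i0 + 1" by simp
    then have "Suc n < y" using inc(2) c y unfolding col_increasing_def by blast
    then show False using max[OF y] by simp
  qed
  have ia: "i < a" using lt za[of i] by (metis not_less less_nat_zero_code)
  define lam where "lam = mu(i := mu i - 1)"
  have mu: "mu = lam(i := Suc (lam i))" using lt by (auto simp: lam_def)
  have alc': "in_alcove a b lam"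
    unfolding in_alcove_def
  proof (intro conjI allI)
    fix k show "lam (Suc k) \<le> lam k" using dec[of k] lt by (auto simp: lam_def intro: diff_le_self order_trans)
  next
    show "lam a = 0" using za ia by (auto simp: lam_def)
    show "lam 0 \<le> lam (a - 1) + b"
    proof (cases "i = a - 1")
      case True
      \<comment> \<open>If the first row were exactly \<open>b\<close> longer than the last, its
        final entry would sit across the seam from \<open>Suc n\<close> and would have to exceed
        it.\<close>
      have "mu 0 \<noteq> mu (a - 1) + b"
      proof
        assume eq: "mu 0 = mu (a - 1) + b"
        then have "(1, j0 + int b) \<in> dom T" using ij d j0 True by (auto simp: mem_diagram)
        then obtain y where y: "T (1, j0 + int b) = Some y" by auto
        then have "Suc n < y" using inc(3) c unfolding wrap_increasing_def by blast
        then show False using max[OF y] by simp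
      qed
      moreover have "mu 0 \<le> mu (a - 1) + b" using alc by (simp add: in_alcove_def)
      ultimately show ?thesis using True a lt by (auto simp: lam_def)
    next
      case False
      then show ?thesis using alc by (auto simp: lam_def in_alcove_def)
    qed
  qed
  define U where "U = T((i0, j0) := None)"
  have val: "U p = (if p = (i0, j0) then None else T p)" for p by (simp add: U_def)
  have "dom U = diagram mu - {(i0, j0)}" using d by (simp add: U_def)
  also have "\<dots> = diagram lam"
    using lt by (auto simp: mem_diagram lam_def i0 j0 of_nat_diff split: if_splits)
  finally have domU: "dom U = diagram lam" .
  have injU: "inj_on U (dom U)" using inj by (auto simp: inj_on_def val dom_def)
  have ranU: "ran U = {1..n}"
  proof
    show "ran U \<subseteq> {1..n}"
    proof
      fix x assume "x \<in> ran U"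
      then obtain p where p: "p \<noteq> (i0, j0)" "T p = Some x" by (auto simp: ran_def val split: if_splits)
      then have "x \<noteq> Suc n" using inj_onD[OF inj, of p "(i0, j0)"] c by (auto simp: domIff)
      moreover have "x \<in> {1..Suc n}" using p ranI[of T p x] ran by simp
      ultimately show "x \<in> {1..n}" by auto
    qed
    show "{1..n} \<subseteq> ran U"
    proof
      fix x assume x: "x \<in> {1..n}"
      then have "x \<in> ran T" using ran by auto
      then obtain p where p: "T p = Some x" by (auto simp: ran_def)
      then have "p \<noteq> (i0, j0)" using c x by auto
      then have "U p = Some x" using p by (simp add: val)
      then show "x \<in> ran U" by (rule ranI)
    qed
  qed
  have sub: "T p = Some x" if "U p = Some x" for p x using that by (auto simp: val split: if_splits)
  have "row_increasing U" "col_increasing U" "wrap_increasing b U"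
    using inc sub unfolding row_increasing_def col_increasing_def wrap_increasing_def by blast+
  then have "cyl_tableau a b n lam U" using alc' domU injU ranU unfolding cyl_tableau_def by blast
  moreover have "T = add_cell n i lam U"
    using c lt by (auto simp: add_cell_def fun_eq_iff val lam_def i0 j0)
  ultimately show ?thesis using ia mu by blast
qed

lemma cyl_tableau_0: "cyl_tableau a b 0 lam T \<longleftrightarrow> lam = (\<lambda>_. 0) \<and> T = Map.empty"
proof
  assume T: "cyl_tableau a b 0 lam T"
  then have "ran T = {}" by (simp add: cyl_tableau_def)
  then have e: "T = Map.empty" by (metis dom_empty dom_eq_empty_conv not_None_eq ranI empty_iff ext)
  then have "diagram lam = diagram (\<lambda>_. 0)" using T by (auto simp: cyl_tableau_def mem_diagram)
  then show "lam = (\<lambda>_. 0) \<and> T = Map.empty" using diagram_inj e by blast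
next
  assume "lam = (\<lambda>_. 0) \<and> T = Map.empty"
  then show "cyl_tableau a b 0 lam T"
    by (auto simp: cyl_tableau_def in_alcove_def mem_diagram row_increasing_def col_increasing_def wrap_increasing_def)
qed

text \<open>\<open>alcove_walks\<close> unfolds at the start of the walk, whereas tableaux grow at
  its end. Tableaux of size \<open>n\<close> followed by \<open>m\<close> free steps interpolate
  between the two, with each induction step moving one step from the walk to the tableau.\<close>

lemma alcove_walks_step:
  assumes a: "1 < a" and b: "0 < b"
  shows "finite {(lam, T). cyl_tableau a b n lam T} \<and>
    (\<Sum>(lam, T)\<in>{(lam, T). cyl_tableau a b n lam T}. alcove_walks a b m lam) = alcove_walks a b (n + m) (\<lambda>_. 0)"
proof (induction n arbitrary: m)
  case 0
  have "{(lam, T). cyl_tableau a b 0 lam T} = {(\<lambda>_. 0, Map.empty)}"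
    by (auto simp: cyl_tableau_0)
  then show ?case by simp
next
  case (Suc n)
  let ?C = "\<lambda>n. {(lam, T). cyl_tableau a b n lam T}"
  let ?I = "\<lambda>lam. {i. i < a \<and> in_alcove a b (lam(i := Suc (lam i)))}"
  let ?S = "SIGMA p:?C n. ?I (fst p)"
  let ?f = "\<lambda>(p, i). ((fst p)(i := Suc (fst p i)), add_cell n i (fst p) (snd p))"
  have fin: "finite (?C n)" using Suc by blast
  have bij: "bij_betw ?f ?S (?C (Suc n))"
  proof (rule bij_betwI')
    fix P Q assume PQ: "P \<in> ?S" "Q \<in> ?S"
    obtain lam T i mu U k where eq: "P = ((lam, T), i)" "Q = ((mu, U), k)"
      by (metis surj_pair)
    have T: "cyl_tableau a b n lam T" and U: "cyl_tableau a b n mu U" using PQ eq by auto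
    show "(?f P = ?f Q) = (P = Q)"
    proof
      assume "?f P = ?f Q"
      then have sh: "lam(i := Suc (lam i)) = mu(k := Suc (mu k))" and tab: "add_cell n i lam T = add_cell n k mu U"
        by (auto simp: eq)
      let ?c = "(int i + 1, int (lam i) + 1)" and ?c' = "(int k + 1, int (mu k) + 1)"
      have none: "V c \<noteq> Some (Suc n)" if "cyl_tableau a b n nu V" for V c nu
        using that ranI[of V c "Suc n"] by (auto simp: cyl_tableau_def)
      have notin: "V (int l + 1, int (nu l) + 1) = None" if "cyl_tableau a b n nu V" for V l nu
      proof -
        have "(int l + 1, int (nu l) + 1) \<notin> dom V" using that by (auto simp: cyl_tableau_def mem_diagram)
        then show ?thesis by blast
      qed
      have "add_cell n k mu U ?c = Some (Suc n)" unfolding tab[symmetric] by (simp add: add_cell_def)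
      then have cc: "?c = ?c'" using none[OF U, of ?c] by (auto simp: add_cell_def split: if_splits)
      then have "i = k" by simp
      then have "lam = mu" using sh by (auto simp: fun_eq_iff split: if_splits)
      moreover have "T = U"
      proof
        fix c show "T c = U c"
          using fun_cong[OF tab, of c] notin[OF T, of i] notin[OF U, of k] cc
          by (auto simp: add_cell_def split: if_splits)
      qed
      ultimately show "P = Q" using eq \<open>i = k\<close> by simp
    qed simp
  next
    fix P assume P: "P \<in> ?S"
    obtain lam T i where eq: "P = ((lam, T), i)" by (metis surj_pair)
    then show "?f P \<in> ?C (Suc n)" using P cyl_tableau_add_cell[OF b, of a n lam T i] by auto
  next
    fix Q assume Q: "Q \<in> ?C (Suc n)"
    obtain mu T where eq: "Q = (mu, T)" by (cases Q)
    then obtain lam U i where U: "cyl_tableau a b n lam U" "i < a" "mu = lam(i := Suc (lam i))" "T = add_cell n i lam U"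
      using cyl_tableau_remove_cell[OF a, of b n mu T] Q by blast
    moreover have "in_alcove a b mu" using Q eq by (simp add: cyl_tableau_def)
    ultimately have "((lam, U), i) \<in> ?S" by auto
    then show "\<exists>P\<in>?S. Q = ?f P" using U eq by (intro bexI[of _ "((lam, U), i)"]) auto
  qed
  have "finite ?S" using fin by auto
  then have fin': "finite (?C (Suc n))" by (rule iffD1[OF bij_betw_finite[OF bij]])
  have "(\<Sum>p\<in>?C (Suc n). alcove_walks a b m (fst p)) = (\<Sum>P\<in>?S. alcove_walks a b m (fst (?f P)))"
    by (rule sum.reindex_bij_betw[OF bij, symmetric])
  also have "\<dots> = (\<Sum>p\<in>?C n. \<Sum>i\<in>?I (fst p). alcove_walks a b m ((fst p)(i := Suc (fst p i))))"
    using fin by (subst sum.Sigma) (auto intro!: sum.cong)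
  also have "\<dots> = (\<Sum>p\<in>?C n. alcove_walks a b (Suc m) (fst p))"
    by simp
  also have "\<dots> = alcove_walks a b (Suc n + m) (\<lambda>_. 0)"
    using Suc[of "Suc m"] by (simp add: case_prod_unfold)
  finally show ?case using fin' by (simp add: case_prod_unfold)
qed

text \<open>A tableau determines its shape, so forgetting the shape in the pairs
  \<open>(lam, T)\<close> is injective.\<close>

theorem card_CSYT:
  assumes a: "1 < a" and b: "0 < b"
  shows "card (CSYT n a b) = alcove_walks a b n (\<lambda>_. 0)"
proof -
  let ?C = "{(lam, T). cyl_tableau a b n lam T}"
  have "CSYT n a b = snd ` ?C" using CSYT_iff[of a b] a b by force
  moreover have "inj_on snd ?C"
  proof (rule inj_onI)
    fix p q assume "p \<in> ?C" "q \<in> ?C" "snd p = snd q"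
    then have "diagram (fst p) = diagram (fst q)" by (auto simp: cyl_tableau_def)
    then show "p = q" using \<open>snd p = snd q\<close> diagram_inj by (metis prod.collapse)
  qed
  ultimately have "card (CSYT n a b) = card ?C" by (simp add: card_image)
  also have "\<dots> = alcove_walks a b n (\<lambda>_. 0)"
    using alcove_walks_step[OF a b, of n 0] by (simp add: case_prod_unfold)
  finally show ?thesis .
qed

section \<open>The four identities\<close>

lemma NCNN_bounded:
  "NCNN n (of_nat h + 1) (of_nat w + 1) = {M. is_matching n M \<and> (\<forall>s\<le>n. bounded_at h w M s)}"
proof -
  have "(\<forall>s\<le>n. bounded_at h w M s) \<longleftrightarrow> noncrossing (of_nat h + 1) M \<and> nonnesting (of_nat w + 1) M"
    if "is_matching n M" for M
    using no_crossing_iff[OF that, of "h + 1"] no_nesting_iff[OF that, of "w + 1"]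
    unfolding noncrossing_int nonnesting_int bounded_at_def by auto
  then show ?thesis by (auto simp: NCNN_def)
qed

lemma finite_fixed_points: "is_matching n M \<Longrightarrow> finite (fixed_points M)"
  using block_subset[of n M] by (intro finite_subset[of "fixed_points M" "{1..n}"]) (auto simp: fixed_points_def)

lemma finite_NCNN: "finite (NCNN n r s)"
  by (rule finite_subset[OF _ finite_matchings[of "{1..n}"]]) (auto simp: NCNN_def is_matching_iff)

lemma sum_indicator_card: "finite A \<Longrightarrow> (\<Sum>x\<in>A. of_bool (P x)) = int (card {x \<in> A. P x})"
  by (simp add: of_bool_def sum.inter_filter[symmetric])

lemma prod_of_bool: "finite A \<Longrightarrow> (\<Prod>x\<in>A. of_bool (P x)) = (of_bool (\<forall>x\<in>A. P x) :: int)"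
  by (induction A rule: finite_induct) auto

text \<open>A factor is 1, 0 or -1 according to whether none, one or both of \<open>P x\<close> and
  \<open>Q x\<close> hold. Survival of the product is then the condition that defines
  \<open>NCNN'\<close>.\<close>

lemma prod_signs:
  assumes "finite A"
  shows "(\<Prod>x\<in>A. 1 - of_bool (P x) - of_bool (Q x)) =
    (if \<forall>x\<in>A. P x \<longleftrightarrow> Q x then (- 1 :: int) ^ card {x \<in> A. P x \<and> Q x} else 0)"
proof (cases "\<forall>x\<in>A. P x \<longleftrightarrow> Q x")
  case True
  then have "(\<Prod>x\<in>A. 1 - of_bool (P x) - of_bool (Q x)) = (\<Prod>x\<in>A. if P x \<and> Q x then - 1 else 1 :: int)"
    by (intro prod.cong) auto
  also have "\<dots> = (- 1) ^ card {x \<in> A. P x \<and> Q x}"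
    using assms by (simp add: prod.inter_filter[symmetric])
  finally show ?thesis using True by simp
next
  case False
  then obtain x where "x \<in> A" "P x \<noteq> Q x" by auto
  then have "(\<Prod>x\<in>A. 1 - of_bool (P x) - of_bool (Q x)) = (0 :: int)"
    using assms by (intro prod_zero) auto
  then show ?thesis using False by simp
qed

lemma card_CSYT_weights:
  assumes "0 < h" "0 < w" "a = 2 * h \<or> a = 2 * h + 1" "b = 2 * w \<or> b = 2 * w + 1"
  shows "int (card (CSYT n a b)) = (\<Sum>M\<in>NCNN n (of_nat h + 1) (of_nat w + 1).
    \<Prod>v\<in>fixed_points M. fixed_point_weight (even a) (even b) h w M v)"
proof -
  interpret alcove_box h w a b using assms by unfold_locales
  have "int (card (CSYT n a b)) = box_walks h w stay_weight n (\<lambda>_. 0)"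
    using card_CSYT[of a b n] assms alcove_walks_eq_box_walks[of n] by auto
  also have "\<dots> = (\<Sum>M | is_matching n M \<and> (\<forall>s\<le>n. bounded_at h w M s).
      \<Prod>v\<in>fixed_points M. fixed_point_weight (even a) (even b) h w M v)"
    using assms by (intro sum_fixed_point_weights[symmetric]) (auto simp: stay_weight_def)
  finally show ?thesis by (simp only: NCNN_bounded)
qed

lemma fixed_point_weight_eq:
  assumes "M \<in> NCNN n r s" "v \<in> fixed_points M" "0 < h" "0 < w"
  shows "fixed_point_weight p q h w M v = 1 - of_bool (p \<and> in_half_crossing M h v) - of_bool (q \<and> in_half_nesting M w v)"
proof -
  have "is_matching n M" using assms(1) by (simp add: NCNN_def)
  then show ?thesis using assms(2-4) in_half_crossing_iff in_half_nesting_iff by (simp add: fixed_point_weight_def)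
qed

theorem corollary8p9:
  fixes h w n :: nat
  assumes "h > 0" and "w > 0" and "n > 0"
  shows "card (CSYT n (2 * h + 1) (2 * w + 1)) = card (NCNN n (of_nat h + 1) (of_nat w + 1)) \<and>
    card (CSYT n (2 * h + 1) (2 * w)) = card (NCNN n (of_nat h + 1) (of_nat w + 1/2)) \<and>
    card (CSYT n (2 * h) (2 * w + 1)) = card (NCNN n (of_nat h + 1/2) (of_nat w + 1)) \<and>
    int (card (CSYT n (2 * h) (2 * w))) = (\<Sum>M\<in>NCNN' n h w. (-1) ^ z_stat h w M)"
proof (intro conjI)
  let ?N = "NCNN n (of_nat h + 1) (of_nat w + 1)"
  note weight = fixed_point_weight_eq[OF _ _ assms(1,2)]
  have fin: "finite (fixed_points M)" if "M \<in> ?N" for M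
    using that finite_fixed_points by (auto simp: NCNN_def)
  \<comment> \<open>For odd \<open>a\<close> and odd \<open>b\<close> every fixed point has weight
    1.\<close>
  have "int (card (CSYT n (2 * h + 1) (2 * w + 1))) = (\<Sum>M\<in>?N. 1)"
    using assms weight by (subst card_CSYT_weights[of h w]) (auto intro!: sum.cong prod.neutral)
  then show "card (CSYT n (2 * h + 1) (2 * w + 1)) = card ?N" by simp

  \<comment> \<open>With only \<open>b\<close> even, each weight is the indicator that the fixed
    point lies in no half-nesting, so the product is an indicator as well.\<close>
  have "int (card (CSYT n (2 * h + 1) (2 * w))) = (\<Sum>M\<in>?N. of_bool (\<forall>v\<in>fixed_points M. \<not> in_half_nesting M w v))"
    using assms fin by (subst card_CSYT_weights[of h w]) (auto intro!: sum.cong simp: weight of_bool_not_iff[symmetric] prod_of_bool)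
  also have "{M \<in> ?N. \<forall>v\<in>fixed_points M. \<not> in_half_nesting M w v} = NCNN n (of_nat h + 1) (of_nat w + 1/2)"
    unfolding NCNN_def nonnesting_half[OF assms(2)] nonnesting_int by (auto simp: in_half_nesting_def)
  then have "(\<Sum>M\<in>?N. of_bool (\<forall>v\<in>fixed_points M. \<not> in_half_nesting M w v)) = int (card (NCNN n (of_nat h + 1) (of_nat w + 1/2)))"
    using sum_indicator_card[OF finite_NCNN[of n "of_nat h + 1" "of_nat w + 1"]] by simp
  finally show "card (CSYT n (2 * h + 1) (2 * w)) = card (NCNN n (of_nat h + 1) (of_nat w + 1/2))" by simp

  have "int (card (CSYT n (2 * h) (2 * w + 1))) = (\<Sum>M\<in>?N. of_bool (\<forall>v\<in>fixed_points M. \<not> in_half_crossing M h v))"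
    using assms fin by (subst card_CSYT_weights[of h w]) (auto intro!: sum.cong simp: weight of_bool_not_iff[symmetric] prod_of_bool)
  also have "{M \<in> ?N. \<forall>v\<in>fixed_points M. \<not> in_half_crossing M h v} = NCNN n (of_nat h + 1/2) (of_nat w + 1)"
    unfolding NCNN_def noncrossing_half[OF assms(1)] noncrossing_int by (auto simp: in_half_crossing_def)
  then have "(\<Sum>M\<in>?N. of_bool (\<forall>v\<in>fixed_points M. \<not> in_half_crossing M h v)) = int (card (NCNN n (of_nat h + 1/2) (of_nat w + 1)))"
    using sum_indicator_card[OF finite_NCNN[of n "of_nat h + 1" "of_nat w + 1"]] by simp
  finally show "card (CSYT n (2 * h) (2 * w + 1)) = card (NCNN n (of_nat h + 1/2) (of_nat w + 1))" by simp

  have "int (card (CSYT n (2 * h) (2 * w))) = (\<Sum>M\<in>?N. if \<forall>v\<in>fixed_points M. in_half_crossing M h v \<longleftrightarrow> in_half_nesting M w v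
      then (- 1) ^ z_stat h w M else 0)"
  proof (subst card_CSYT_weights[of h w], use assms in simp_all, rule sum.cong[OF refl])
    fix M assume M: "M \<in> ?N"
    have "(\<Prod>v\<in>fixed_points M. fixed_point_weight True True h w M v)
        = (\<Prod>v\<in>fixed_points M. 1 - of_bool (in_half_crossing M h v) - of_bool (in_half_nesting M w v))"
      using weight[OF M] by (intro prod.cong) auto
    then show "(\<Prod>v\<in>fixed_points M. fixed_point_weight True True h w M v)
        = (if \<forall>v\<in>fixed_points M. in_half_crossing M h v \<longleftrightarrow> in_half_nesting M w v then (- 1) ^ z_stat h w M else 0)"
      unfolding z_stat_def by (simp only: prod_signs[OF fin[OF M]])
  qed
  also have "\<dots> = (\<Sum>M\<in>{M \<in> ?N. \<forall>v\<in>fixed_points M. in_half_crossing M h v \<longleftrightarrow> in_half_nesting M w v}. (- 1) ^ z_stat h w M)"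
    by (rule sum.inter_filter[symmetric]) (rule finite_NCNN)
  also have "{M \<in> ?N. \<forall>v\<in>fixed_points M. in_half_crossing M h v \<longleftrightarrow> in_half_nesting M w v} = NCNN' n h w"
    unfolding NCNN'_def by blast
  finally show "int (card (CSYT n (2 * h) (2 * w))) = (\<Sum>M\<in>NCNN' n h w. (-1) ^ z_stat h w M)" .
qed

end
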